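(* Let $X_1,\ldots,X_n$ be the truncated heavy-tailed sample described in the context, with tail index $\alpha>0$, truncation thresholds $(M_n)$ and parameters $\beta,\gamma\in(0,1)$. Suppose that Assumptions A, B, C, D and E listed in the context hold. Then, as $n\to\infty$, $$\sqrt{\hat k_n}\left\{h(\hat k_n,n)-\frac1\alpha\right\}\Longrightarrow N\left(0,\frac1{\alpha^2}\right),$$ where $\Longrightarrow$ denotes convergence in distribution, $h(\cdot,\cdot)$ is the Hill statistic of $X_1,\ldots,X_n$ and $\hat k_n$ is the sample-based choice of $k$, both defined in the context.
   Context: Model. Let $H,H_1,H_2,\ldots$ be i.i.d. positive random variables such that $x\mapsto P(H>x)$ is regularly varying at infinity with index $-\alpha$, where $\alpha>0$. Let $L,L_1,L_2,\ldots$ be i.i.d. positive random variables, independent of $(H,H_1,H_2,\ldots)$. Let $(M_n)$ be a sequence of positive numbers with $M_n\to\infty$. For each $n$ the observed sample is $X_1,\ldots,X_n$ (a row of a triangular array; the dependence on $n$ is suppressed), where $$X_j:=H_j\mathbf 1(H_j\le M_n)+(M_n+L_j)\mathbf 1(H_j>M_n),\quad 1\le j\le n.$$ Let $X_{(1)}\ge\cdots\ge X_{(n)}$ be the order statistics of $X_1,\ldots,X_n$. The Hill statistic is, for $1\le k\le n$, $$h(k,n):=\frac1k\sum_{i=1}^k\log\frac{X_{(i)}}{X_{(k)}}.$$ Fix $\beta,\gamma\in(0,1)$ and, with $[\cdot]$ the integer part, set $$\hat k_n:=\left[n\left(\frac1n\sum_{j=1}^n\mathbf 1(X_j>\gamma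 X_{(1)})\right)^\beta\right].$$ Notation: $l(x):=x^\alpha P(H>x)$; $b(y):=\inf\{x:\frac1{P(H>x)}\ge y\}$; $a_n\sim c_n$ means $a_n/c_n\to1$. Assumption A: there exists a sequence $(\varepsilon_n)$ such that $\lim_{n\to\infty}P(H>M_n)^{-(1-\beta)}\varepsilon_n=0$, $\lim_{n\to\infty}nP(H>M_n)P(L>\varepsilon_nM_n)=0$, and $\lim_{n\to\infty}P(H>M_n)^{-(1-\beta)}\left\{\frac{l(\gamma M_n(1+\varepsilon_n))}{l(\gamma M_n)}-1\right\}=0$. Assumption B: $\lim_{n\to\infty}nP(H>M_n)=\infty$. Assumption C: $\lim_{n\to\infty}nP(H>M_n)^{2-\beta}(\log M_n)^2=0$. Assumption D: for any sequence $(v_n)$ satisfying $v_n\sim nP(H>\gamma M_n)^\beta$, $$\lim_{n\to\infty}\sqrt{v_n}\left[\frac n{v_n}P\left(H>b(n/v_n)y^{-1/\alpha}\right)-y\right]=0$$ uniformly for $y$ in compact subsets of $[0,\infty)$ (with $0^{-1/\alpha}=\infty$). Assumption E: for any sequence $(v_n)$ satisfying $v_n\sim nP(H>\gamma M_n)^\beta$, $$\lim_{T\to\infty}\limsup_{n\to\infty}\sqrt{v_n}\int_T^\infty\left|\frac n{v_n}P\left(H>b(n/v_n)s\right)-s^{-\alpha}\right|\frac{ds}s=0.$$ *)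

theory Defs
  imports "HOL-Probability.Probability"
begin

definition regularly_varying_at_top :: "(real \<Rightarrow> real) \<Rightarrow> real \<Rightarrow> bool" where
  "regularly_varying_at_top f \<rho> \<longleftrightarrow>
     f \<in> borel_measurable borel \<and>
     eventually (\<lambda>x. f x > 0) at_top \<and>
     (\<forall>c>0. ((\<lambda>x. f (c * x) / f x) \<longlongrightarrow> c powr \<rho>) at_top)"

definition iid :: "'a measure \<Rightarrow> (nat \<Rightarrow> 'a \<Rightarrow> real) \<Rightarrow> bool" where
  "iid P Y \<longleftrightarrow>
     prob_space.indep_vars P (\<lambda>_. borel) Y UNIV \<and>
     (\<forall>j. distr P borel (Y j) = distr P borel (Y 0))"

definition tail :: "'a measure \<Rightarrow> ('a \<Rightarrow> real) \<Rightarrow> real \<Rightarrow> real" where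
  "tail P Y x = measure P {\<omega> \<in> space P. Y \<omega> > x}"

text \<open>The function \<open>l\<close>, with \<open>P(Y > x) = x powr (-\<alpha>) * l x\<close>.\<close>

definition slow_part :: "'a measure \<Rightarrow> ('a \<Rightarrow> real) \<Rightarrow> real \<Rightarrow> real \<Rightarrow> real" where
  "slow_part P Y \<alpha> x = x powr \<alpha> * tail P Y x"

text \<open>The function \<open>b\<close>. For a positive variable \<open>Y\<close> whose tail never vanishes, the set below is
  nonempty and bounded below exactly when \<open>y > 1\<close>; for \<open>y \<le> 1\<close> the value is meaningless. The
  assumptions below evaluate it only along sequences tending to infinity.\<close>

definition tail_quantile :: "'a measure \<Rightarrow> ('a \<Rightarrow> real) \<Rightarrow> real \<Rightarrow> real" where
  "tail_quantile P Y y = Inf {x. 1 / tail P Y x \<ge> y}"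

definition trunc_obs ::
  "(nat \<Rightarrow> 'a \<Rightarrow> real) \<Rightarrow> (nat \<Rightarrow> 'a \<Rightarrow> real) \<Rightarrow> (nat \<Rightarrow> real) \<Rightarrow> nat \<Rightarrow> nat \<Rightarrow> 'a \<Rightarrow> real" where
  "trunc_obs H L M n j \<omega> =
     H j \<omega> * of_bool (H j \<omega> \<le> M n) + (M n + L j \<omega>) * of_bool (H j \<omega> > M n)"

text \<open>In the following three definitions the sample is \<open>x 1, \<dots>, x n\<close>; the value \<open>x 0\<close> is not
  used. \<open>order_stat x n i\<close> is the \<open>i\<close>-th largest value, for \<open>1 \<le> i \<le> n\<close>.\<close>

definition order_stat :: "(nat \<Rightarrow> real) \<Rightarrow> nat \<Rightarrow> nat \<Rightarrow> real" where
  "order_stat x n i = rev (sort (map x [1..<Suc n])) ! (i - 1)"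

definition hill :: "(nat \<Rightarrow> real) \<Rightarrow> nat \<Rightarrow> nat \<Rightarrow> real" where
  "hill x k n = 1 / real k * (\<Sum>i=1..k. ln (order_stat x n i / order_stat x n k))"

definition k_hat :: "real \<Rightarrow> real \<Rightarrow> (nat \<Rightarrow> real) \<Rightarrow> nat \<Rightarrow> nat" where
  "k_hat \<beta> \<gamma> x n =
     nat \<lfloor>real n * (1 / real n * (\<Sum>j=1..n. of_bool (x j > \<gamma> * order_stat x n 1))) powr \<beta>\<rfloor>"

definition assumption_A ::
  "'a measure \<Rightarrow> ('a \<Rightarrow> real) \<Rightarrow> ('a \<Rightarrow> real) \<Rightarrow> (nat \<Rightarrow> real) \<Rightarrow> real \<Rightarrow> real \<Rightarrow> real \<Rightarrow> bool" where
  "assumption_A P H L M \<alpha> \<beta> \<gamma> \<longleftrightarrow>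
     (\<exists>\<epsilon> :: nat \<Rightarrow> real.
        (\<lambda>n. tail P H (M n) powr (-(1 - \<beta>)) * \<epsilon> n) \<longlonglongrightarrow> 0 \<and>
        (\<lambda>n. real n * tail P H (M n) * tail P L (\<epsilon> n * M n)) \<longlonglongrightarrow> 0 \<and>
        (\<lambda>n. tail P H (M n) powr (-(1 - \<beta>)) *
               (slow_part P H \<alpha> (\<gamma> * M n * (1 + \<epsilon> n)) / slow_part P H \<alpha> (\<gamma> * M n) - 1)) \<longlonglongrightarrow> 0)"

definition assumption_B :: "'a measure \<Rightarrow> ('a \<Rightarrow> real) \<Rightarrow> (nat \<Rightarrow> real) \<Rightarrow> bool" where
  "assumption_B P H M \<longleftrightarrow> filterlim (\<lambda>n. real n * tail P H (M n)) at_top sequentially"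

definition assumption_C :: "'a measure \<Rightarrow> ('a \<Rightarrow> real) \<Rightarrow> (nat \<Rightarrow> real) \<Rightarrow> real \<Rightarrow> bool" where
  "assumption_C P H M \<beta> \<longleftrightarrow>
     (\<lambda>n. real n * tail P H (M n) powr (2 - \<beta>) * (ln (M n))\<^sup>2) \<longlonglongrightarrow> 0"

text \<open>The conditional implements \<open>0 powr (-1/\<alpha>) = \<infinity>\<close>, for which the tail probability is \<open>0\<close>
  (in HOL \<open>0 powr (-1/\<alpha>) = 0\<close>).\<close>

definition assumption_D ::
  "'a measure \<Rightarrow> ('a \<Rightarrow> real) \<Rightarrow> (nat \<Rightarrow> real) \<Rightarrow> real \<Rightarrow> real \<Rightarrow> real \<Rightarrow> bool" where
  "assumption_D P H M \<alpha> \<beta> \<gamma> \<longleftrightarrow>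
     (\<forall>v :: nat \<Rightarrow> real.
        v \<sim>[sequentially] (\<lambda>n. real n * tail P H (\<gamma> * M n) powr \<beta>) \<longrightarrow>
        (\<forall>K. compact K \<and> K \<subseteq> {0..} \<longrightarrow>
           uniform_limit K
             (\<lambda>n y. sqrt (v n) *
                (real n / v n *
                   (if y = 0 then 0
                    else tail P H (tail_quantile P H (real n / v n) * y powr (-1 / \<alpha>))) - y))
             (\<lambda>y. 0) sequentially))"

text \<open>The integral is the nonnegative one, with values in \<open>[0, \<infinity>]\<close>.\<close>

definition assumption_E ::
  "'a measure \<Rightarrow> ('a \<Rightarrow> real) \<Rightarrow> (nat \<Rightarrow> real) \<Rightarrow> real \<Rightarrow> real \<Rightarrow> real \<Rightarrow> bool" where
  "assumption_E P H M \<alpha> \<beta> \<gamma> \<longleftrightarrow>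
     (\<forall>v :: nat \<Rightarrow> real.
        v \<sim>[sequentially] (\<lambda>n. real n * tail P H (\<gamma> * M n) powr \<beta>) \<longrightarrow>
        ((\<lambda>T :: real. limsup (\<lambda>n. ennreal (sqrt (v n)) *
            (\<integral>\<^sup>+ s \<in> {T<..}.
               ennreal (\<bar>real n / v n * tail P H (tail_quantile P H (real n / v n) * s)
                          - s powr (-\<alpha>)\<bar> / s) \<partial>lborel))) \<longlongrightarrow> 0) at_top)"

end

theory Submission
  imports Defs
begin

text \<open>
Write \<open>p = P(H > M)\<close>, \<open>c = \<gamma> M\<close>, \<open>q = P(H > c)\<close>, and let \<open>N\<close> be the number of the \<open>H j\<close> above \<open>c\<close>. The proof
rests on two scales: \<open>N\<close> is of order \<open>n q\<close>, the random \<open>k\<close> is of order \<open>n q powr \<beta>\<close>, and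
\<open>assumption_C\<close> says exactly that \<open>n q ln M\<close> is negligible against \<open>sqrt k\<close>. So all the observations above \<open>c\<close>
together, those changed by the truncation included, contribute nothing to the limit law. Their only
influence is through \<open>k\<close>.

With probability tending to one, the largest observation lies between \<open>M\<close> and \<open>M (1 + \<epsilon>)\<close>, and no \<open>H j\<close>
falls between \<open>c\<close> and \<open>c (1 + \<epsilon>)\<close> (\<open>good_limit\<close>). On this event the number of observations above \<open>\<gamma>\<close>
times the maximum is \<open>N\<close>, so \<open>k\<close> is a fixed function of \<open>N\<close> (\<open>good_sample\<close>). The fluctuations of this \<open>k\<close>
exceed \<open>sqrt k\<close>, so that it cannot simply be replaced by its typical value; but it becomes constant by
conditioning on \<open>N = m\<close>. Given \<open>N = m\<close>, the values up to \<open>c\<close> are \<open>n - m\<close> independent draws from \<open>H\<close>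
conditioned to be at most \<open>c\<close>. This is used through two facts, for functions that are trivial above \<open>c\<close>: a formula for
the expectation of a product (\<open>conditional_expectation_prod\<close>), which gives a central limit theorem
(\<open>conditional_clt\<close>), and a bound for the second moment of a sum (\<open>conditional_second_moment\<close>),
which gives a law of large numbers (\<open>conditional_concentration\<close>).

For a fixed \<open>k\<close> put \<open>u = b(n/k)\<close>. If \<open>\<tau>\<close> is the \<open>k\<close>-th largest observation, \<open>k\<close> times the Hill statistic
is the sum of \<open>ln (x / \<tau>)\<close> over the observations \<open>x > \<tau>\<close>. Counting the observations above the points
\<open>u exp (y / sqrt k)\<close> locates \<open>\<tau>\<close> to within \<open>\<epsilon> / sqrt k\<close> on the logarithmic scale, and moving the
threshold from \<open>\<tau>\<close> to \<open>u\<close> turns the centred sum into the sum of the scores \<open>ln (x / u) - 1 / \<alpha>\<close> over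
the observations above \<open>u\<close>, up to \<open>\<epsilon> sqrt k\<close> (\<open>hill_linearization\<close>). By \<open>assumption_D\<close> and
\<open>assumption_E\<close>, the score of an observation above \<open>u\<close> has mean \<open>o(1 / sqrt k)\<close> and limiting variance
\<open>1 / \<alpha>\<^sup>2\<close> (\<open>score_mean\<close>, \<open>score_variance\<close>), so their normalised sum is asymptotically normal given \<open>N = m\<close>, uniformly for \<open>m\<close>
in a window that contains \<open>N\<close> with probability tending to one (\<open>conditional_char_window\<close>).
Averaging the characteristic functions over \<open>m\<close> and Levy's continuity theorem finish the proof.
\<close>

section \<open>Order statistics and the Hill statistic\<close>

definition exceedances :: "(nat \<Rightarrow> real) \<Rightarrow> nat \<Rightarrow> real \<Rightarrow> nat" where
  "exceedances x n s = card {j \<in> {1..n}. x j > s}"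

definition log_excess :: "(nat \<Rightarrow> real) \<Rightarrow> nat \<Rightarrow> real \<Rightarrow> real" where
  "log_excess x n s = (\<Sum>j=1..n. if x j > s then ln (x j / s) else 0)"

text \<open>The order statistics are a rearrangement of the sample, so every symmetric sum can be computed
from either; below this is applied to counts and to logarithmic excesses.\<close>

lemma sum_order_stat:
  "(\<Sum>i=1..n. g (order_stat x n i)) = (\<Sum>j=1..n. g (x j) :: 'b::comm_monoid_add)"
proof -
  define ys where "ys = rev (sort (map x [1..<Suc n]))"
  have len: "length ys = n" by (simp add: ys_def del: upt_Suc)
  have ms: "mset ys = mset (map x [1..<Suc n])" by (simp add: ys_def del: upt_Suc)
  have "(\<Sum>i=1..n. g (order_stat x n i)) = (\<Sum>i<n. g (ys ! i))"
    by (rule sum.reindex_bij_witness[of _ Suc "\<lambda>i. i - 1"])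
       (auto simp: order_stat_def ys_def)
  also have "\<dots> = sum_list (map g ys)"
    by (simp add: sum_list_sum_nth len lessThan_atLeast0)
  also have "\<dots> = sum_list (map g (map x [1..<Suc n]))"
    using ms by (metis mset_map sum_mset_sum_list)
  also have "\<dots> = (\<Sum>j=1..n. g (x j))"
    by (simp add: sum_list_distinct_conv_sum_set o_def atLeastLessThanSuc_atLeastAtMost del: upt_Suc)
  finally show ?thesis .
qed

lemma order_stat_antimono:
  assumes "1 \<le> i" "i \<le> j" "j \<le> n"
  shows "order_stat x n j \<le> order_stat x n i"
proof -
  define zs where "zs = sort (map x [1..<Suc n])"
  have len: "length zs = n" by (simp add: zs_def del: upt_Suc)
  have "sorted zs" by (simp add: zs_def)
  then have "zs ! (n - Suc (j-1)) \<le> zs ! (n - Suc (i-1))"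
    using assms len by (intro sorted_nth_mono) auto
  then show ?thesis using assms len
    unfolding order_stat_def zs_def[symmetric] by (simp add: rev_nth)
qed

text \<open>The inversion between order statistics and counts: statements about the random threshold
become statements about counts above deterministic levels, which are sums of independent variables.\<close>

lemma order_stat_gt_iff:
  assumes "1 \<le> k" "k \<le> n"
  shows "order_stat x n k > s \<longleftrightarrow> k \<le> exceedances x n s"
proof -
  define I where "I = {i \<in> {1..n}. order_stat x n i > s}"
  have "exceedances x n s = (\<Sum>j=1..n. if x j > s then 1 else 0)"
    unfolding exceedances_def by (simp add: sum.If_cases Int_def)
  also have "\<dots> = (\<Sum>i=1..n. if order_stat x n i > s then 1 else 0)"
    by (rule sum_order_stat[symmetric])
  also have "\<dots> = card I"
    unfolding I_def by (simp add: sum.If_cases Int_def)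
  finally have eq: "exceedances x n s = card I" .
  show ?thesis
  proof
    assume gt: "order_stat x n k > s"
    have "{1..k} \<subseteq> I"
    proof
      fix i assume "i \<in> {1..k}"
      then show "i \<in> I" using gt order_stat_antimono[of i k n x] assms by (auto simp: I_def)
    qed
    then have "card {1..k} \<le> card I" by (intro card_mono) (auto simp: I_def)
    then show "k \<le> exceedances x n s" by (simp add: eq)
  next
    assume le: "k \<le> exceedances x n s"
    show "order_stat x n k > s"
    proof (rule ccontr)
      assume "\<not> order_stat x n k > s"
      then have "i < k" if "i \<in> I" for i
        using that assms order_stat_antimono[of k i n x] by (fastforce simp: I_def)
      then have "I \<subseteq> {1..<k}" by (auto simp: I_def)
      then have "card I \<le> card {1..<k}" by (intro card_mono) auto
      then show False using le eq assms by simp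
    qed
  qed
qed

text \<open>An observation equal to the threshold contributes \<open>ln 1 = 0\<close>, so ties at the \<open>k\<close>-th
largest value do no harm.\<close>

lemma hill_eq_log_excess:
  assumes "1 \<le> k" "k \<le> n" "order_stat x n k > 0"
  shows "real k * hill x k n = log_excess x n (order_stat x n k)"
proof -
  define \<tau> where "\<tau> = order_stat x n k"
  define g where "g y = (if y > \<tau> then ln (y / \<tau>) else 0)" for y
  have "real k * hill x k n = (\<Sum>i=1..k. ln (order_stat x n i / \<tau>))"
    using assms by (simp add: hill_def \<tau>_def)
  also have "\<dots> = (\<Sum>i=1..k. g (order_stat x n i))"
  proof (rule sum.cong[OF refl])
    fix i assume "i \<in> {1..k}"
    then have "order_stat x n i \<ge> \<tau>" using order_stat_antimono[of i k n x] assms by (auto simp: \<tau>_def)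
    then show "ln (order_stat x n i / \<tau>) = g (order_stat x n i)"
      using assms(3) by (auto simp: g_def \<tau>_def)
  qed
  also have "\<dots> = (\<Sum>i=1..n. g (order_stat x n i))"
  proof (rule sum.mono_neutral_left)
    show "\<forall>i\<in>{1..n} - {1..k}. g (order_stat x n i) = 0"
    proof
      fix i assume "i \<in> {1..n} - {1..k}"
      then have "order_stat x n i \<le> \<tau>" using order_stat_antimono[of k i n x] assms by (auto simp: \<tau>_def)
      then show "g (order_stat x n i) = 0" by (simp add: g_def)
    qed
  qed (use assms in auto)
  also have "\<dots> = (\<Sum>j=1..n. g (x j))" by (rule sum_order_stat)
  finally show ?thesis by (simp add: log_excess_def g_def flip: \<tau>_def)
qed

lemma exceedances_eq_sum: "real (exceedances x n s) = (\<Sum>j=1..n. if x j > s then 1 else 0)"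
  unfolding exceedances_def by (simp add: sum.If_cases Int_def)

text \<open>As a function of \<open>ln s\<close>, \<open>log_excess x n s\<close> decreases with slope \<open>- exceedances x n s\<close>, and
this slope is itself monotone in \<open>s\<close>.\<close>

lemma log_excess_diff:
  assumes "0 < s" "s \<le> t"
  shows "real (exceedances x n t) * ln (t / s) \<le> log_excess x n s - log_excess x n t"
    and "log_excess x n s - log_excess x n t \<le> real (exceedances x n s) * ln (t / s)"
proof -
  have st: "ln (t / s) \<ge> 0" using assms by simp
  have eq: "log_excess x n s - log_excess x n t =
     (\<Sum>j=1..n. (if x j > s then ln (x j / s) else 0) - (if x j > t then ln (x j / t) else 0))"
    by (simp add: log_excess_def sum_subtractf)
  have d: "ln (y / s) = ln (y / t) + ln (t / s)" if "y > t" for y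
    using assms that by (simp add: ln_div)
  have p: "ln (y / s) \<ge> 0" if "y > s" for y
    using assms that by simp
  show "real (exceedances x n t) * ln (t / s) \<le> log_excess x n s - log_excess x n t"
    unfolding eq exceedances_eq_sum sum_distrib_right using assms
    by (intro sum_mono) (auto simp: d p)
  show "log_excess x n s - log_excess x n t \<le> real (exceedances x n s) * ln (t / s)"
    unfolding eq exceedances_eq_sum sum_distrib_right using assms
    by (intro sum_mono) (auto simp: d divide_right_mono)
qed

text \<open>On the scale \<open>y / r\<close> with \<open>r = sqrt k\<close>, a count of \<open>k\<close> up to \<open>O(r)\<close> moves the logarithmic excess by
\<open>y r\<close> up to \<open>O(1)\<close>, which is invisible after division by \<open>r\<close>.\<close>

lemma log_excess_linear:
  assumes u: "u > 0" and r: "r > 0"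
    and A: "\<bar>real (exceedances x n u) - r\<^sup>2\<bar> \<le> A * r"
           "\<bar>real (exceedances x n (u * exp (y / r))) - r\<^sup>2\<bar> \<le> A * r"
  shows "\<bar>log_excess x n u - log_excess x n (u * exp (y / r)) - y * r\<bar> \<le> \<bar>y\<bar> * A"
proof -
  define D where "D = log_excess x n u - log_excess x n (u * exp (y / r))"
  define n0 where "n0 = real (exceedances x n u)"
  define n1 where "n1 = real (exceedances x n (u * exp (y / r)))"
  have key: "\<bar>y / r * w - y * r\<bar> \<le> \<bar>y\<bar> * A" if "\<bar>w - r\<^sup>2\<bar> \<le> A * r" for w
  proof -
    have "y / r * w - y * r = y / r * (w - r\<^sup>2)" using r by (simp add: field_simps power2_eq_square)
    then have "\<bar>y / r * w - y * r\<bar> = \<bar>y\<bar> / r * \<bar>w - r\<^sup>2\<bar>" using r by (simp add: abs_mult)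
    also have "\<dots> \<le> \<bar>y\<bar> / r * (A * r)" using that r by (intro mult_left_mono) auto
    finally show ?thesis using r by simp
  qed
  \<comment> \<open>The slope lies between the counts at the two ends, in an order that depends on the sign of \<open>y\<close>.\<close>
  have btw: "(y / r * n0 \<le> D \<and> D \<le> y / r * n1) \<or> (y / r * n1 \<le> D \<and> D \<le> y / r * n0)"
  proof (cases "y \<ge> 0")
    case True
    then have le: "u \<le> u * exp (y / r)" using u r by simp
    have "ln (u * exp (y / r) / u) = y / r" using u by simp
    then show ?thesis using log_excess_diff[OF u le, of x n]
      by (simp add: D_def n0_def n1_def mult.commute)
  next
    case False
    then have le: "u * exp (y / r) \<le> u" and pos: "u * exp (y / r) > 0" using u r
      by (auto simp: divide_le_0_iff)
    have "u / (u * exp (y / r)) = exp (- (y / r))" using u by (simp add: exp_minus field_simps)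
    then have "ln (u / (u * exp (y / r))) = - (y / r)" by simp
    then show ?thesis using log_excess_diff[OF pos le, of x n]
      by (auto simp: D_def n0_def n1_def mult.commute)
  qed
  show ?thesis using btw key[of n0] key[of n1] A unfolding D_def[symmetric] n0_def n1_def by linarith
qed

text \<open>The deterministic core. The counts on a finite grid of levels around \<open>u\<close> are assumed to follow
the line of slope \<open>- \<alpha> r\<close>. Monotonicity of the counts then forces the threshold between two grid
levels next to \<open>(N u - k) / (\<alpha> r)\<close>, and monotonicity of the logarithmic excess transfers this to the
Hill statistic. The grid turns the location of the threshold into finitely many statements about counts.\<close>

lemma hill_linearization:
  fixes x :: "nat \<Rightarrow> real" and n :: nat
  defines "r \<equiv> \<lambda>k. sqrt (real k)" and "N \<equiv> \<lambda>s. exceedances x n s" 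
  assumes k: "1 \<le> k" "k \<le> n" and u: "u > 0" and \<alpha>: "\<alpha> > 0" and e: "e > 0"
    and B: "\<bar>real (N u) - real k\<bar> \<le> \<alpha> * (real R - 2) * e * r k"
    and grid: "\<And>i::int. \<bar>i\<bar> \<le> int R \<Longrightarrow>
       \<bar>real (N (u * exp (of_int i * e / r k))) - real (N u) + \<alpha> * (of_int i * e) * r k\<bar> \<le> \<alpha> * e / 2 * r k"
  shows "\<bar>real k * hill x k n - real k / \<alpha> - (log_excess x n u - real (N u) / \<alpha>)\<bar>
           \<le> 2 * e * r k + 3 * \<alpha> * (real R * e)\<^sup>2"
proof -
  define \<tau> where "\<tau> = order_stat x n k"
  define s where "s = r k"
  define b where "b = (real (N u) - real k) / s"
  have s: "s > 0" "s\<^sup>2 = real k" using k by (auto simp: s_def r_def)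
  have Nu: "real (N u) = real k + b * s" using s by (simp add: b_def)
  \<comment> \<open>The grid levels \<open>i1\<close> and \<open>i2\<close> lie between one and two steps below and above the predicted position; the margin of one step absorbs the error \<open>\<alpha> e / 2\<close> of the counts.\<close>
  define i1 where "i1 = \<lfloor>b / (\<alpha> * e)\<rfloor> - 1"
  define i2 where "i2 = i1 + 3"
  define G where "G = (\<lambda>i::int. log_excess x n (u * exp (of_int i * e / s)))"
  have ae: "\<alpha> * e > 0" using \<alpha> e by simp
  have babs: "\<bar>b\<bar> * s = \<bar>real (N u) - real k\<bar>" using s by (simp add: Nu abs_mult)
  then have bR: "\<bar>b\<bar> \<le> \<alpha> * (real R - 2) * e" using B s unfolding s_def[symmetric]
    using mult_le_cancel_right_pos[OF s(1)] by metis
  then have bR': "\<bar>b / (\<alpha> * e)\<bar> \<le> real R - 2" using ae \<alpha> e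
    by (simp add: abs_divide divide_le_eq mult.commute mult.left_commute)
  have i1b: "of_int i1 + 1 \<le> b / (\<alpha> * e)" "b / (\<alpha> * e) < of_int i1 + 2" 
    unfolding i1_def by (auto; linarith)+
  have R: "\<bar>i1\<bar> \<le> int R" "\<bar>i2\<bar> \<le> int R" unfolding i2_def using i1b bR' by linarith+
  have R2: "real R \<ge> 2" using bR' abs_ge_zero[of "b / (\<alpha> * e)"] by linarith
  have lo: "(of_int i1 + 1) * (\<alpha> * e) \<le> b" and hi: "b < (of_int i1 + 2) * (\<alpha> * e)"
    using i1b ae by (auto simp: pos_le_divide_eq pos_divide_less_eq)
  have g: "\<bar>real (N (u * exp (of_int i * e / s))) - real k - (b - \<alpha> * (of_int i * e)) * s\<bar> \<le> \<alpha> * e / 2 * s"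
    if "\<bar>i\<bar> \<le> int R" for i :: int
    using grid[OF that] unfolding s_def[symmetric] Nu by (simp add: algebra_simps)
  have ge1: "k \<le> N (u * exp (of_int i1 * e / s))"
  proof -
    have "(b - \<alpha> * (of_int i1 * e)) * s \<ge> \<alpha> * e * s" using lo s by (intro mult_right_mono) (auto simp: algebra_simps)
    moreover have "\<alpha> * e * s > 0" using ae s by simp
    ultimately have "real k \<le> real (N (u * exp (of_int i1 * e / s)))" using g[OF R(1)] unfolding abs_le_iff by argo
    then show ?thesis by simp
  qed
  have lt2: "N (u * exp (of_int i2 * e / s)) < k"
  proof -
    have "(b - \<alpha> * (of_int i2 * e)) * s \<le> (- (\<alpha> * e)) * s" using hi s unfolding i2_def
      by (intro mult_right_mono) (auto simp: algebra_simps)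
    moreover have "\<alpha> * e * s > 0" using ae s by simp
    ultimately have "real (N (u * exp (of_int i2 * e / s))) < real k" using g[OF R(2)] unfolding abs_le_iff by argo
    then show ?thesis by simp
  qed
  have t1: "u * exp (of_int i1 * e / s) < \<tau>" using order_stat_gt_iff[OF k] ge1 by (auto simp: \<tau>_def N_def)
  have t2: "\<tau> \<le> u * exp (of_int i2 * e / s)" using order_stat_gt_iff[OF k] lt2 
    by (metis N_def \<tau>_def not_le)
  have p1: "0 < u * exp (of_int i1 * e / s)" using u by simp
  have \<tau>p: "\<tau> > 0" using p1 t1 by linarith
  have mono: "log_excess x n t \<le> log_excess x n s'" if "0 < s'" "s' \<le> t" for s' t
  proof -
    have "0 \<le> real (exceedances x n t) * ln (t / s')" using that by simp
    then show ?thesis using log_excess_diff(1)[OF that, of x n] by linarith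
  qed
  have up: "log_excess x n \<tau> \<le> G i1" unfolding G_def using p1 t1 by (intro mono) auto
  have dn: "G i2 \<le> log_excess x n \<tau>" unfolding G_def using \<tau>p t2 by (intro mono) auto
  have Ge: "\<bar>log_excess x n u - G i - of_int i * e * s\<bar> \<le> 3 * \<alpha> * (real R * e)\<^sup>2"
    if iR: "\<bar>i\<bar> \<le> int R" for i
  proof -
    define y where "y = of_int i * e"
    have ya: "\<bar>y\<bar> \<le> real R * e" using iR e by (auto simp: y_def abs_mult intro!: mult_right_mono)
    define A where "A = 3 * \<alpha> * (real R * e)"
    have x1: "\<alpha> * \<bar>y\<bar> \<le> \<alpha> * (real R * e)" using ya \<alpha> by (intro mult_left_mono) auto
    have x2: "\<bar>b\<bar> + \<alpha> * \<bar>y\<bar> + \<alpha> * e / 2 \<le> A" using bR x1 ae unfolding A_def by (simp add: algebra_simps)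
    have x3: "\<bar>b\<bar> \<le> A" using x2 \<alpha> ae by (smt (verit) abs_ge_zero divide_pos_pos mult_nonneg_nonneg)
    have "\<bar>real (N u) - s\<^sup>2\<bar> \<le> A * s" using x3 s babs by (metis mult_right_mono less_imp_le)
    moreover have "\<bar>real (N (u * exp (y / s))) - s\<^sup>2\<bar> \<le> A * s"
    proof -
      have "\<bar>real (N (u * exp (y / s))) - real k\<bar> \<le> \<bar>(b - \<alpha> * y) * s\<bar> + \<alpha> * e / 2 * s"
        using g[OF iR] unfolding y_def by linarith
      also have "\<bar>(b - \<alpha> * y) * s\<bar> \<le> (\<bar>b\<bar> + \<alpha> * \<bar>y\<bar>) * s" 
      proof -
        have "\<bar>b - \<alpha> * y\<bar> \<le> \<bar>b\<bar> + \<bar>\<alpha> * y\<bar>" by (rule abs_triangle_ineq4)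
        then show ?thesis unfolding abs_mult using s \<alpha> by (intro mult_mono) (auto simp: abs_mult)
      qed
      also have "(\<bar>b\<bar> + \<alpha> * \<bar>y\<bar>) * s + \<alpha> * e / 2 * s = (\<bar>b\<bar> + \<alpha> * \<bar>y\<bar> + \<alpha> * e / 2) * s" 
        by (simp add: algebra_simps)
      also have "\<dots> \<le> A * s" using x2 s by (intro mult_right_mono) auto
      finally show ?thesis using s by simp
    qed
    ultimately have "\<bar>log_excess x n u - log_excess x n (u * exp (y / s)) - y * s\<bar> \<le> \<bar>y\<bar> * A"
      using log_excess_linear[OF u s(1)] unfolding N_def by blast
    also have "\<dots> \<le> (real R * e) * A" using ya \<alpha> e by (intro mult_right_mono) (auto simp: A_def)
    finally show ?thesis by (simp add: G_def y_def A_def power2_eq_square mult_ac)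
  qed
  have y1: "b / \<alpha> * s \<le> of_int i1 * e * s + 2 * e * s" 
  proof -
    have "b / \<alpha> \<le> (of_int i1 + 2) * e" using hi \<alpha> by (simp add: field_simps)
    then have "b / \<alpha> * s \<le> (of_int i1 + 2) * e * s" using s by (intro mult_right_mono) auto
    then show ?thesis by (simp add: algebra_simps)
  qed
  have y2: "of_int i2 * e * s - 2 * e * s \<le> b / \<alpha> * s" 
  proof -
    have "(of_int i1 + 1) * e \<le> b / \<alpha>" using lo \<alpha> by (simp add: field_simps)
    then have "(of_int i1 + 1) * e * s \<le> b / \<alpha> * s" using s by (intro mult_right_mono) auto
    then show ?thesis by (simp add: i2_def algebra_simps)
  qed
  have h: "real k * hill x k n = log_excess x n \<tau>" using hill_eq_log_excess[OF k] \<tau>p by (simp add: \<tau>_def)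
  have Nd: "real (N u) / \<alpha> = real k / \<alpha> + b / \<alpha> * s" by (simp add: Nu add_divide_distrib)
  show ?thesis unfolding h Nd s_def[symmetric]
    using up dn Ge[OF R(1)] Ge[OF R(2)] y1 y2 by (simp add: abs_le_iff)
qed

section \<open>Sums over a sample given its number of exceedances\<close>

lemma iid_measurable:
  assumes "prob_space P" "iid P Y"
  shows "Y j \<in> borel_measurable P"
proof -
  interpret prob_space P by fact
  show ?thesis using assms(2) by (auto simp: iid_def indep_vars_def)
qed

lemma iid_integral:
  fixes f :: "real \<Rightarrow> 'b::{banach, second_countable_topology}"
  assumes "prob_space P" "iid P Y" "f \<in> borel_measurable borel"
  shows "(\<integral>\<omega>. f (Y j \<omega>) \<partial>P) = (\<integral>\<omega>. f (Y 0 \<omega>) \<partial>P)"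
proof -
  have [measurable]: "Y i \<in> borel_measurable P" for i by (rule iid_measurable[OF assms(1,2)])
  have "(\<integral>\<omega>. f (Y j \<omega>) \<partial>P) = (\<integral>x. f x \<partial>(distr P borel (Y j)))"
    using assms(3) by (subst integral_distr) auto
  also have "distr P borel (Y j) = distr P borel (Y 0)" using assms(2) by (simp add: iid_def)
  also have "(\<integral>x. f x \<partial>(distr P borel (Y 0))) = (\<integral>\<omega>. f (Y 0 \<omega>) \<partial>P)"
    using assms(3) by (subst integral_distr) auto
  finally show ?thesis .
qed

lemma exceedances_measurable [measurable]:
  assumes [measurable]: "\<And>j. Y j \<in> borel_measurable P"
  shows "(\<lambda>\<omega>. exceedances (\<lambda>j. Y j \<omega>) n c) \<in> measurable P (count_space UNIV)"
proof -
  have eq: "exceedances (\<lambda>j. Y j \<omega>) n c = (\<Sum>j=1..n. if Y j \<omega> > c then 1 else 0)" for \<omega>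
    unfolding exceedances_def by (simp add: sum.If_cases Int_def)
  show ?thesis unfolding eq by measurable
qed

text \<open>The product splits according to the set \<open>A\<close> of indices whose value exceeds \<open>c\<close>: for
each of the \<open>n choose m\<close> sets of size \<open>m\<close>, independence gives the same product.\<close>

lemma expectation_prod_exceedances:
  fixes g :: "real \<Rightarrow> complex"
  assumes P: "prob_space P" and Y: "iid P Y" and g [measurable]: "g \<in> borel_measurable borel"
    and g1: "\<And>y. norm (g y) \<le> 1"
  shows "(\<integral>\<omega>. of_bool (exceedances (\<lambda>j. Y j \<omega>) n c = m) *
              (\<Prod>j=1..n. if Y j \<omega> > c then 1 else g (Y j \<omega>)) \<partial>P)
       = of_nat (n choose m) * of_real (tail P (Y 0) c) ^ m *
         (\<integral>\<omega>. g (Y 0 \<omega>) * of_bool (Y 0 \<omega> \<le> c) \<partial>P) ^ (n - m)"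
proof -
  interpret prob_space P by fact
  have [measurable]: "Y i \<in> borel_measurable P" for i by (rule iid_measurable[OF P Y])
  define h :: "nat set \<Rightarrow> nat \<Rightarrow> real \<Rightarrow> complex" where
    "h A j y = (if j \<in> A then of_bool (y > c) else g y * of_bool (y \<le> c))" for A j y
  have [measurable]: "h A j \<in> borel_measurable borel" for A j
    unfolding h_def by (cases "j \<in> A") auto
  define \<A> where "\<A> = {A. A \<subseteq> {1..n} \<and> card A = m}"
  have finA: "finite \<A>" unfolding \<A>_def by simp
  have h1: "norm (h A j y) \<le> 1" for A j y unfolding h_def using g1 by (auto simp: norm_mult)
  have pw: "of_bool (exceedances (\<lambda>j. Y j \<omega>) n c = m) * (\<Prod>j=1..n. if Y j \<omega> > c then 1 else g (Y j \<omega>))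
     = (\<Sum>A\<in>\<A>. \<Prod>j=1..n. h A j (Y j \<omega>))" for \<omega>
  proof -
    define A0 where "A0 = {j \<in> {1..n}. Y j \<omega> > c}"
    \<comment> \<open>Only the actual set of exceedances contributes.\<close>
    have z: "(\<Prod>j=1..n. h A j (Y j \<omega>)) = 0" if A: "A \<in> \<A>" and ne: "A \<noteq> A0" for A
    proof -
      obtain j where "(j \<in> A) \<noteq> (j \<in> A0)" using ne by blast
      moreover from this have "j \<in> {1..n}" using A unfolding \<A>_def A0_def by auto
      ultimately have "j \<in> {1..n}" "j \<in> A \<longleftrightarrow> \<not> Y j \<omega> > c"
        unfolding A0_def by simp_all
      then show ?thesis by (intro prod_zero) (auto simp: h_def intro!: bexI[of _ j])
    qed
    have e: "(\<Prod>j=1..n. h A0 j (Y j \<omega>)) = (\<Prod>j=1..n. if Y j \<omega> > c then 1 else g (Y j \<omega>))"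
      by (intro prod.cong) (auto simp: h_def A0_def)
    have "(\<Sum>A\<in>\<A>. \<Prod>j=1..n. h A j (Y j \<omega>)) = (\<Sum>A\<in>\<A>. if A = A0 then (\<Prod>j=1..n. h A0 j (Y j \<omega>)) else 0)"
      using z by (intro sum.cong) auto
    also have "\<dots> = of_bool (A0 \<in> \<A>) * (\<Prod>j=1..n. h A0 j (Y j \<omega>))" using finA by simp
    also have "A0 \<in> \<A> \<longleftrightarrow> exceedances (\<lambda>j. Y j \<omega>) n c = m"
      by (auto simp: \<A>_def A0_def exceedances_def)
    finally show ?thesis using e by simp
  qed
  have ind: "indep_vars (\<lambda>_. borel) (\<lambda>j \<omega>. h A j (Y j \<omega>)) {1..n}" for A
  proof -
    have "indep_vars (\<lambda>_. borel) Y {1..n}" 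
      using Y indep_vars_subset[of "\<lambda>_. borel" Y UNIV "{1..n}"] by (simp add: iid_def)
    then show ?thesis by (rule indep_vars_compose2) simp
  qed
  have int: "integrable P (\<lambda>\<omega>. h A j (Y j \<omega>))" for A j
    by (rule integrable_const_bound[where B=1]) (auto simp: h1)
  have ev: "(\<integral>\<omega>. h A j (Y j \<omega>) \<partial>P) = (if j \<in> A then of_real (tail P (Y 0) c)
               else (\<integral>\<omega>. g (Y 0 \<omega>) * of_bool (Y 0 \<omega> \<le> c) \<partial>P))" for A j
  proof -
    have "(\<integral>\<omega>. h A j (Y j \<omega>) \<partial>P) = (\<integral>\<omega>. h A j (Y 0 \<omega>) \<partial>P)" by (rule iid_integral[OF P Y]) simp
    moreover have "(\<integral>\<omega>. of_bool (Y 0 \<omega> > c) \<partial>P) = complex_of_real (tail P (Y 0) c)"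
    proof -
      have "(\<integral>\<omega>. complex_of_real (indicator {\<omega> \<in> space P. Y 0 \<omega> > c} \<omega>) \<partial>P) = complex_of_real (tail P (Y 0) c)"
        by (simp add: tail_def)
      then show ?thesis by (subst Bochner_Integration.integral_cong[OF refl, where g="\<lambda>\<omega>. complex_of_real (indicator {\<omega> \<in> space P. Y 0 \<omega> > c} \<omega>)"]) (auto simp: indicator_def)
    qed
    ultimately show ?thesis by (simp add: h_def)
  qed
  have one: "(\<integral>\<omega>. (\<Prod>j=1..n. h A j (Y j \<omega>)) \<partial>P) = of_real (tail P (Y 0) c) ^ m *
     (\<integral>\<omega>. g (Y 0 \<omega>) * of_bool (Y 0 \<omega> \<le> c) \<partial>P) ^ (n - m)" if "A \<in> \<A>" for A
  proof -
    have A: "A \<subseteq> {1..n}" "card A = m" using that by (auto simp: \<A>_def)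
    have "(\<integral>\<omega>. (\<Prod>j=1..n. h A j (Y j \<omega>)) \<partial>P) = (\<Prod>j=1..n. \<integral>\<omega>. h A j (Y j \<omega>) \<partial>P)"
      by (rule indep_vars_lebesgue_integral) (use ind int in auto)
    also have "\<dots> = of_real (tail P (Y 0) c) ^ card ({1..n} \<inter> {j. j \<in> A}) *
     (\<integral>\<omega>. g (Y 0 \<omega>) * of_bool (Y 0 \<omega> \<le> c) \<partial>P) ^ card ({1..n} \<inter> - {j. j \<in> A})"
      unfolding ev by (simp add: prod.If_cases)
    also have "{1..n} \<inter> {j. j \<in> A} = A" using A by auto
    also have "{1..n} \<inter> - {j. j \<in> A} = {1..n} - A" by auto
    finally show ?thesis using A by (simp add: card_Diff_subset finite_subset)
  qed
  have intp: "integrable P (\<lambda>\<omega>. \<Prod>j=1..n. h A j (Y j \<omega>))" for A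
    by (rule indep_vars_integrable) (use ind int in auto)
  have "(\<integral>\<omega>. of_bool (exceedances (\<lambda>j. Y j \<omega>) n c = m) *
              (\<Prod>j=1..n. if Y j \<omega> > c then 1 else g (Y j \<omega>)) \<partial>P) 
     = (\<Sum>A\<in>\<A>. \<integral>\<omega>. (\<Prod>j=1..n. h A j (Y j \<omega>)) \<partial>P)"
    unfolding pw by (rule Bochner_Integration.integral_sum) (rule intp)
  also have "\<dots> = of_nat (card \<A>) * (of_real (tail P (Y 0) c) ^ m *
     (\<integral>\<omega>. g (Y 0 \<omega>) * of_bool (Y 0 \<omega> \<le> c) \<partial>P) ^ (n - m))"
    by (subst sum.cong[OF refl one], assumption) simp
  also have "card \<A> = n choose m" unfolding \<A>_def by (subst n_subsets) auto
  finally show ?thesis by (simp add: mult.assoc)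
qed

lemma integral_of_bool:
  assumes "finite_measure P" "{\<omega> \<in> space P. Q \<omega>} \<in> sets P"
  shows "(\<integral>\<omega>. of_bool (Q \<omega>) \<partial>P) = measure P {\<omega> \<in> space P. Q \<omega>}"
    "integrable P (\<lambda>\<omega>. of_bool (Q \<omega>) :: real)"
proof -
  interpret finite_measure P by fact
  have eq: "\<omega> \<in> space P \<Longrightarrow> of_bool (Q \<omega>) = (indicator {\<omega> \<in> space P. Q \<omega>} \<omega> :: real)" for \<omega>
    by (auto simp: indicator_def)
  show "(\<integral>\<omega>. of_bool (Q \<omega>) \<partial>P) = measure P {\<omega> \<in> space P. Q \<omega>}"
    using assms by (subst Bochner_Integration.integral_cong[OF refl eq]) auto
  show "integrable P (\<lambda>\<omega>. of_bool (Q \<omega>) :: real)"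
    using assms(2) by (subst Bochner_Integration.integrable_cong[OF refl eq]) (auto simp: emeasure_eq_measure)
qed

lemma prob_le_tail:
  assumes "prob_space P" "Y \<in> borel_measurable P"
  shows "(\<integral>\<omega>. of_bool (Y \<omega> \<le> c) \<partial>P) = 1 - tail P Y c"
proof -
  interpret prob_space P by fact
  note [measurable] = assms(2)
  have "{\<omega> \<in> space P. Y \<omega> \<le> c} = space P - {\<omega> \<in> space P. Y \<omega> > c}" by auto
  then show ?thesis by (simp add: integral_of_bool finite_measure_axioms tail_def prob_compl)
qed

lemma prob_exceedances_eq:
  assumes P: "prob_space P" and Y: "iid P Y"
  shows "measure P {\<omega> \<in> space P. exceedances (\<lambda>j. Y j \<omega>) n c = m} =
           real (n choose m) * tail P (Y 0) c ^ m * (1 - tail P (Y 0) c) ^ (n - m)"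
proof -
  interpret prob_space P by fact
  have [measurable]: "Y i \<in> borel_measurable P" for i by (rule iid_measurable[OF P Y])
  have ob: "(\<integral>\<omega>. of_bool (Q \<omega>) \<partial>P) = complex_of_real (\<integral>\<omega>. of_bool (Q \<omega>) \<partial>P)" for Q
  proof -
    have "(\<lambda>\<omega>. of_bool (Q \<omega>)) = (\<lambda>\<omega>. complex_of_real (of_bool (Q \<omega>)))" by auto
    then show ?thesis by (simp only: integral_complex_of_real)
  qed
  have "(\<integral>\<omega>. of_bool (exceedances (\<lambda>j. Y j \<omega>) n c = m) \<partial>P) =
     complex_of_real (real (n choose m) * tail P (Y 0) c ^ m * (1 - tail P (Y 0) c) ^ (n - m))"
    using expectation_prod_exceedances[OF P Y, of "\<lambda>_. 1" n c m]
    by (simp add: ob prob_le_tail P)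
  then show ?thesis unfolding ob of_real_eq_iff by (simp add: integral_of_bool finite_measure_axioms)
qed

text \<open>Dividing by the probability of \<open>m\<close> exceedances leaves \<open>n - m\<close> factors, each an expectation
under the law of \<open>Y\<close> conditioned on \<open>Y \<le> c\<close>.\<close>

lemma conditional_expectation_prod:
  fixes g :: "real \<Rightarrow> complex"
  assumes P: "prob_space P" and Y: "iid P Y" and g: "g \<in> borel_measurable borel"
    and g1: "\<And>y. norm (g y) \<le> 1" and q: "tail P (Y 0) c < 1"
  shows "(\<integral>\<omega>. of_bool (exceedances (\<lambda>j. Y j \<omega>) n c = m) *
              (\<Prod>j=1..n. if Y j \<omega> > c then 1 else g (Y j \<omega>)) \<partial>P)
       = of_real (measure P {\<omega> \<in> space P. exceedances (\<lambda>j. Y j \<omega>) n c = m}) *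
         ((\<integral>\<omega>. g (Y 0 \<omega>) * of_bool (Y 0 \<omega> \<le> c) \<partial>P) / of_real (1 - tail P (Y 0) c)) ^ (n - m)"
proof -
  have "complex_of_real (1 - tail P (Y 0) c) \<noteq> 0" using q by (simp only: of_real_eq_0_iff)
  then show ?thesis
    unfolding expectation_prod_exceedances[OF P Y g g1] prob_exceedances_eq[OF P Y]
    by (simp add: power_divide del: of_real_diff)
qed

text \<open>Since \<open>\<phi>\<close> vanishes above \<open>c\<close>, on the support of \<open>\<phi> (Y i)\<close> the event of having \<open>m\<close> exceedances
only concerns the other indices. So mixed terms vanish as in the unconditional case, and each
diagonal term costs at most the factor \<open>1 / P (Y \<le> c)\<close>.\<close>

lemma conditional_second_moment:
  fixes \<phi> :: "real \<Rightarrow> real"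
  assumes P: "prob_space P" and Y: "iid P Y" and \<phi> [measurable]: "\<phi> \<in> borel_measurable borel"
    and bd: "\<And>y. \<bar>\<phi> y\<bar> \<le> B" and sup: "\<And>y. y > c \<Longrightarrow> \<phi> y = 0" and mean: "(\<integral>\<omega>. \<phi> (Y 0 \<omega>) \<partial>P) = 0"
    and q: "tail P (Y 0) c < 1"
  shows "(\<integral>\<omega>. of_bool (exceedances (\<lambda>j. Y j \<omega>) n c = m) * (\<Sum>j=1..n. \<phi> (Y j \<omega>))\<^sup>2 \<partial>P)
     \<le> real n * (\<integral>\<omega>. (\<phi> (Y 0 \<omega>))\<^sup>2 \<partial>P) / (1 - tail P (Y 0) c) *
         measure P {\<omega> \<in> space P. exceedances (\<lambda>j. Y j \<omega>) n c = m}"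
proof -
  interpret prob_space P by fact
  have [measurable]: "Y i \<in> borel_measurable P" for i by (rule iid_measurable[OF P Y])
  define Q where "Q = (\<lambda>\<omega>. exceedances (\<lambda>j. Y j \<omega>) n c = m)"
  define R where "R i y = (card {l \<in> {1..n} - {i}. y l > c} = m)" for i and y :: "nat \<Rightarrow> real"
  have [measurable]: "Measurable.pred P Q" unfolding Q_def by measurable
  have QR: "Q \<omega> \<longleftrightarrow> R i (\<lambda>l. Y l \<omega>)" if "\<not> Y i \<omega> > c" for i \<omega>
  proof -
    have "{l \<in> {1..n} - {i}. Y l \<omega> > c} = {l \<in> {1..n}. Y l \<omega> > c}" using that by auto
    then show ?thesis unfolding Q_def R_def exceedances_def by simp
  qed
  have R_restrict: "R i (restrict y ({1..n} - {i})) = R i y" for i y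
    unfolding R_def by (rule arg_cong[where f="\<lambda>A. card A = m"]) auto
  have Rm: "Measurable.pred (PiM ({1..n} - {i}) (\<lambda>_. borel)) (R i)" for i
  proof -
    have "card {l \<in> {1..n} - {i}. y l > c} = (\<Sum>l\<in>{1..n} - {i}. if y l > c then 1 else 0)" for y :: "nat \<Rightarrow> real"
      by (simp add: sum.If_cases Int_def)
    then show ?thesis unfolding R_def by simp
  qed
  have indep: "expectation (\<lambda>\<omega>. f (Y i \<omega>) * G (\<lambda>l. Y l \<omega>)) = expectation (\<lambda>\<omega>. f (Y i \<omega>)) * expectation (\<lambda>\<omega>. G (\<lambda>l. Y l \<omega>))"
    if f [measurable]: "f \<in> borel_measurable borel" and fb: "\<And>y. \<bar>f y\<bar> \<le> F"
      and G: "G \<in> borel_measurable (PiM ({1..n} - {i}) (\<lambda>_. borel))" and Gr: "\<And>y. G (restrict y ({1..n} - {i})) = G y"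
      and Gb: "\<And>y. \<bar>G y\<bar> \<le> D" for i f F and G :: "(nat \<Rightarrow> real) \<Rightarrow> real" and D
  proof -
    have "indep_var (PiM {i} (\<lambda>_. borel)) (\<lambda>\<omega>. restrict (\<lambda>l. Y l \<omega>) {i})
              (PiM ({1..n} - {i}) (\<lambda>_. borel)) (\<lambda>\<omega>. restrict (\<lambda>l. Y l \<omega>) ({1..n} - {i}))"
      using Y unfolding iid_def by (intro indep_var_restrict[where I=UNIV]) auto
    then have "indep_var borel ((\<lambda>y. f (y i)) \<circ> (\<lambda>\<omega>. restrict (\<lambda>l. Y l \<omega>) {i}))
              borel (G \<circ> (\<lambda>\<omega>. restrict (\<lambda>l. Y l \<omega>) ({1..n} - {i})))"
      by (rule indep_var_compose) (use G in auto)
    then have iv: "indep_var borel (\<lambda>\<omega>. f (Y i \<omega>)) borel (\<lambda>\<omega>. G (\<lambda>l. Y l \<omega>))"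
      unfolding o_def Gr by simp
    have [measurable]: "(\<lambda>\<omega>. G (\<lambda>l. Y l \<omega>)) \<in> borel_measurable P" using indep_var_rv2[OF iv] .
    show ?thesis
    proof (rule indep_var_lebesgue_integral[OF iv])
      show "integrable P (\<lambda>\<omega>. f (Y i \<omega>))" by (rule integrable_const_bound[where B=F]) (auto simp: fb)
      show "integrable P (\<lambda>\<omega>. G (\<lambda>l. Y l \<omega>))" by (rule integrable_const_bound[where B=D]) (auto simp: Gb)
    qed
  qed
  define p where "p = measure P {\<omega> \<in> space P. Q \<omega>}"
  define v where "v = (\<integral>\<omega>. (\<phi> (Y 0 \<omega>))\<^sup>2 \<partial>P)"
  have B0: "B \<ge> 0" using bd[of 0] by linarith
  have mi: "expectation (\<lambda>\<omega>. \<phi> (Y i \<omega>)) = 0" for i using iid_integral[OF P Y \<phi>, of i] mean by simp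
  have vi: "expectation (\<lambda>\<omega>. (\<phi> (Y i \<omega>))\<^sup>2) = v" for i using iid_integral[OF P Y, of "\<lambda>x. (\<phi> x)\<^sup>2" i] by (simp add: v_def)
  have sq: "(\<phi> y)\<^sup>2 \<le> B\<^sup>2" for y using bd[of y] B0 by (simp add: abs_le_square_iff[symmetric])
  have swap: "of_bool (Q \<omega>) * (\<phi> (Y i \<omega>) * z) = of_bool (R i (\<lambda>l. Y l \<omega>)) * (\<phi> (Y i \<omega>) * z)" for i \<omega> z
    using QR[of i \<omega>] sup[of "Y i \<omega>"] by (cases "Y i \<omega> > c") auto
  have off: "expectation (\<lambda>\<omega>. of_bool (Q \<omega>) * (\<phi> (Y i \<omega>) * \<phi> (Y j \<omega>))) = 0" 
    if "i \<in> {1..n}" "j \<in> {1..n}" "i \<noteq> j" for i j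
  proof -
    note [measurable] = Rm[of i]
    have "expectation (\<lambda>\<omega>. \<phi> (Y i \<omega>) * (\<lambda>y. of_bool (R i y) * \<phi> (y j)) (\<lambda>l. Y l \<omega>)) = 
       expectation (\<lambda>\<omega>. \<phi> (Y i \<omega>)) * expectation (\<lambda>\<omega>. (\<lambda>y. of_bool (R i y) * \<phi> (y j)) (\<lambda>l. Y l \<omega>))"
    proof (rule indep[OF \<phi> bd])
      have [measurable]: "j \<in> {1..n} - {i}" using that by auto
      show "(\<lambda>y. of_bool (R i y) * \<phi> (y j)) \<in> borel_measurable (PiM ({1..n} - {i}) (\<lambda>_. borel))"
        by measurable
      show "\<bar>of_bool (R i y) * \<phi> (y j)\<bar> \<le> B" for y using bd B0 by auto
      show "of_bool (R i (restrict y ({1..n} - {i}))) * \<phi> (restrict y ({1..n} - {i}) j) = of_bool (R i y) * \<phi> (y j)"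
        for y unfolding R_restrict using that by simp
    qed
    then show ?thesis unfolding swap by (simp add: mi mult_ac)
  qed
  have diag: "expectation (\<lambda>\<omega>. of_bool (Q \<omega>) * (\<phi> (Y i \<omega>) * \<phi> (Y i \<omega>))) \<le> v / (1 - tail P (Y 0) c) * p" 
    if "i \<in> {1..n}" for i
  proof -
    note [measurable] = Rm[of i]
    define r :: real where "r = expectation (\<lambda>\<omega>. of_bool (R i (\<lambda>l. Y l \<omega>)))"
    have sq': "\<bar>(\<phi> y)\<^sup>2\<bar> \<le> B\<^sup>2" for y using sq[of y] by simp
    have Rr: "of_bool (R i (restrict y ({1..n} - {i}))) = (of_bool (R i y) :: real)" for y
      by (simp only: R_restrict)
    have b1: "\<bar>of_bool (R i y)\<bar> \<le> (1::real)" for y by simp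
    have b2: "\<bar>of_bool (y \<le> c)\<bar> \<le> (1::real)" for y by simp
    have Gm: "(\<lambda>y. of_bool (R i y) :: real) \<in> borel_measurable (PiM ({1..n} - {i}) (\<lambda>_. borel))" by measurable
    have [measurable]: "Measurable.pred P (\<lambda>\<omega>. R i (\<lambda>l. Y l \<omega>))" 
    proof -
      have "Measurable.pred P (\<lambda>\<omega>. R i (restrict (\<lambda>l. Y l \<omega>) ({1..n} - {i})))"
        by (rule measurable_compose[OF _ Rm]) measurable
      then show ?thesis unfolding R_restrict .
    qed
    have "expectation (\<lambda>\<omega>. (\<phi> (Y i \<omega>))\<^sup>2 * (\<lambda>y. of_bool (R i y)) (\<lambda>l. Y l \<omega>)) = v * r"
      unfolding vi[of i, symmetric] r_def
      by (rule indep[OF _ sq' Gm Rr b1]) simp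
    then have a: "expectation (\<lambda>\<omega>. of_bool (Q \<omega>) * (\<phi> (Y i \<omega>) * \<phi> (Y i \<omega>))) = v * r"
      unfolding swap by (simp add: mult_ac power2_eq_square)
    have "expectation (\<lambda>\<omega>. of_bool (Y i \<omega> \<le> c) * (\<lambda>y. of_bool (R i y)) (\<lambda>l. Y l \<omega>)) = (1 - tail P (Y 0) c) * r"
    proof -
      have "expectation (\<lambda>\<omega>. of_bool (Y i \<omega> \<le> c)) = 1 - tail P (Y 0) c"
        using iid_integral[OF P Y, of "\<lambda>y. of_bool (y \<le> c) :: real" i] by (simp add: prob_le_tail P)
      moreover have "expectation (\<lambda>\<omega>. of_bool (Y i \<omega> \<le> c) * (\<lambda>y. of_bool (R i y)) (\<lambda>l. Y l \<omega>)) = 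
          expectation (\<lambda>\<omega>. of_bool (Y i \<omega> \<le> c)) * r"
        unfolding r_def by (rule indep[OF _ b2 Gm Rr b1]) simp
      ultimately show ?thesis by simp
    qed
    moreover have "expectation (\<lambda>\<omega>. of_bool (Y i \<omega> \<le> c) * (\<lambda>y. of_bool (R i y)) (\<lambda>l. Y l \<omega>)) \<le> 
        expectation (\<lambda>\<omega>. of_bool (Q \<omega>) :: real)"
    proof (rule integral_mono)
      show "integrable P (\<lambda>\<omega>. of_bool (Y i \<omega> \<le> c) * of_bool (R i (\<lambda>l. Y l \<omega>)) :: real)"
        by (rule integrable_const_bound[where B=1]) auto
      show "integrable P (\<lambda>\<omega>. of_bool (Q \<omega>) :: real)"
        by (rule integrable_const_bound[where B=1]) auto
    qed (use QR in \<open>auto simp: not_less\<close>)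
    ultimately have "(1 - tail P (Y 0) c) * r \<le> p" by (simp add: p_def integral_of_bool finite_measure_axioms)
    then have "r \<le> p / (1 - tail P (Y 0) c)" using q by (simp add: field_simps)
    moreover have "v \<ge> 0" by (simp add: v_def)
    ultimately show ?thesis unfolding a using mult_left_mono[of r "p / (1 - tail P (Y 0) c)" v] by simp
  qed
  have int: "integrable P (\<lambda>\<omega>. of_bool (Q \<omega>) * (\<phi> (Y i \<omega>) * \<phi> (Y j \<omega>)))" for i j
    by (rule integrable_const_bound[where B="B * B"]) (use bd B0 in \<open>auto simp: abs_mult intro!: mult_mono\<close>)
  have "(\<integral>\<omega>. of_bool (Q \<omega>) * (\<Sum>j=1..n. \<phi> (Y j \<omega>))\<^sup>2 \<partial>P) =
     (\<integral>\<omega>. (\<Sum>i=1..n. \<Sum>j=1..n. of_bool (Q \<omega>) * (\<phi> (Y i \<omega>) * \<phi> (Y j \<omega>))) \<partial>P)"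
    unfolding power2_eq_square sum_product by (simp only: sum_distrib_left)
  also have "\<dots> = (\<Sum>i=1..n. \<Sum>j=1..n. (\<integral>\<omega>. of_bool (Q \<omega>) * (\<phi> (Y i \<omega>) * \<phi> (Y j \<omega>)) \<partial>P))"
    by (subst Bochner_Integration.integral_sum, intro Bochner_Integration.integrable_sum int,
        intro sum.cong refl Bochner_Integration.integral_sum int)
  also have "\<dots> = (\<Sum>i=1..n. \<Sum>j=1..n. if i = j then (\<integral>\<omega>. of_bool (Q \<omega>) * (\<phi> (Y i \<omega>) * \<phi> (Y i \<omega>)) \<partial>P) else 0)"
    using off by (intro sum.cong) auto
  also have "\<dots> = (\<Sum>i=1..n. (\<integral>\<omega>. of_bool (Q \<omega>) * (\<phi> (Y i \<omega>) * \<phi> (Y i \<omega>)) \<partial>P))"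
    by (intro sum.cong) auto
  also have "\<dots> \<le> (\<Sum>i=1..n. v / (1 - tail P (Y 0) c) * p)" using diag by (intro sum_mono) auto
  finally show ?thesis by (simp add: Q_def p_def v_def)
qed

section \<open>Truncated logarithmic moments\<close>

lemma tail_antimono:
  assumes "prob_space P" "Y \<in> borel_measurable P" "s \<le> t"
  shows "tail P Y t \<le> tail P Y s"
proof -
  interpret prob_space P by fact
  note [measurable] = assms(2)
  show ?thesis unfolding tail_def using assms(3) by (intro finite_measure_mono) auto
qed

lemma tail_nonneg: "0 \<le> tail P Y t" by (simp add: tail_def)

lemma tail_le_1: "prob_space P \<Longrightarrow> tail P Y t \<le> 1"
  unfolding tail_def by (rule prob_space.prob_le_1)

lemma tail_measurable [measurable]:
  assumes "prob_space P" "Y \<in> borel_measurable P"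
  shows "tail P Y \<in> borel_measurable borel"
proof -
  have "mono (\<lambda>t. - tail P Y t)" using tail_antimono[OF assms] by (auto simp: mono_def)
  then have "(\<lambda>t. - (- tail P Y t)) \<in> borel_measurable borel"
    by (intro borel_measurable_uminus borel_measurable_mono)
  then show ?thesis by simp
qed

lemma tail_diff:
  assumes "prob_space P" "Y \<in> borel_measurable P" "s \<le> t"
  shows "measure P {\<omega> \<in> space P. s < Y \<omega> \<and> Y \<omega> \<le> t} = tail P Y s - tail P Y t"
proof -
  interpret prob_space P by fact
  note [measurable] = assms(2)
  have eq: "{\<omega> \<in> space P. s < Y \<omega> \<and> Y \<omega> \<le> t} = {\<omega> \<in> space P. s < Y \<omega>} - {\<omega> \<in> space P. t < Y \<omega>}"
    by (auto simp: not_less)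
  have sub: "{\<omega> \<in> space P. t < Y \<omega>} \<subseteq> {\<omega> \<in> space P. s < Y \<omega>}" using assms(3) by auto
  have "{\<omega> \<in> space P. s < Y \<omega>} \<in> sets P" "{\<omega> \<in> space P. t < Y \<omega>} \<in> sets P" by measurable
  then show ?thesis unfolding tail_def eq using sub by (rule finite_measure_Diff)
qed

text \<open>Tonelli's theorem, with \<open>G (Y / u)\<close> written as the integral of \<open>g\<close> from \<open>1\<close> to \<open>Y / u\<close>.\<close>

lemma expectation_truncated_antiderivative:
  fixes g G :: "real \<Rightarrow> real"
  assumes P: "prob_space P" and Y [measurable]: "Y \<in> borel_measurable P"
    and u: "u > 0" and b: "b \<ge> 1"
    and g [measurable]: "g \<in> borel_measurable borel" and g0: "\<And>s. 1 \<le> s \<Longrightarrow> 0 \<le> g s"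
    and G: "\<And>s. 1 \<le> s \<Longrightarrow> (G has_real_derivative g s) (at s)" and G1: "G 1 = 0"
    and Gm [measurable]: "G \<in> borel_measurable borel"
  shows "(\<integral>\<omega>. of_bool (u < Y \<omega> \<and> Y \<omega> \<le> u * b) * G (Y \<omega> / u) \<partial>P) =
     (\<integral>s. indicator {1..b} s * (g s * (tail P Y (u * s) - tail P Y (u * b))) \<partial>lborel)"
    and "0 \<le> G b"
    and "integrable lborel (\<lambda>s. indicator {1..b} s * g s)"
    and "(\<integral>s. indicator {1..b} s * g s \<partial>lborel) = G b"
proof -
  interpret prob_space P by fact
  interpret PL: pair_sigma_finite P lborel ..
  have [measurable]: "tail P Y \<in> borel_measurable borel" by (rule tail_measurable[OF P Y])
  have FTC: "(\<integral>\<^sup>+s. ennreal (g s) * indicator {1..y} s \<partial>lborel) = ennreal (G y)" if "1 \<le> y" for y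
    using nn_integral_FTC_Icc[OF g, of 1 y G] that g0 G G1 
    by (auto simp: has_field_derivative_at_within)
  have Gnn: "0 \<le> G y" if "1 \<le> y" for y
    using DERIV_nonneg_imp_nondecreasing[OF that, of G] G g0 G1 by metis
  show "0 \<le> G b" using Gnn b by simp
  have ge: "ennreal (indicator {1..b} s * g s) = ennreal (g s) * indicator {1..b} s" for s
    by (auto simp: indicator_def)
  have gi: "0 \<le> indicator {1..b} s * g s" for s using g0 by (auto simp: indicator_def)
  have nn: "(\<integral>\<^sup>+s. ennreal (indicator {1..b} s * g s) \<partial>lborel) = ennreal (G b)"
    unfolding ge by (rule FTC[OF b])
  show int: "integrable lborel (\<lambda>s. indicator {1..b} s * g s)"
    by (rule integrableI_nonneg) (use nn gi in auto)
  show "(\<integral>s. indicator {1..b} s * g s \<partial>lborel) = G b"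
    by (subst integral_eq_nn_integral) (use nn gi Gnn b in auto)
  have inner: "ennreal (of_bool (u < Y \<omega> \<and> Y \<omega> \<le> u * b) * G (Y \<omega> / u)) =
      (\<integral>\<^sup>+s. ennreal (g s) * indicator {1..b} s * of_bool (u * s < Y \<omega> \<and> Y \<omega> \<le> u * b) \<partial>lborel)" for \<omega>
  proof (cases "u < Y \<omega> \<and> Y \<omega> \<le> u * b")
    case True
    then have y: "1 \<le> Y \<omega> / u" "Y \<omega> / u \<le> b" using u by (auto simp: field_simps)
    have "(\<integral>\<^sup>+s. ennreal (g s) * indicator {1..b} s * of_bool (u * s < Y \<omega> \<and> Y \<omega> \<le> u * b) \<partial>lborel)
        = (\<integral>\<^sup>+s. ennreal (g s) * indicator {1..Y \<omega> / u} s \<partial>lborel)"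
    proof (rule nn_integral_cong_AE)
      show "AE s in lborel. ennreal (g s) * indicator {1..b} s * of_bool (u * s < Y \<omega> \<and> Y \<omega> \<le> u * b) =
         ennreal (g s) * indicator {1..Y \<omega> / u} s"
        using AE_lborel_singleton[of "Y \<omega> / u"]
      proof eventually_elim
        case (elim s)
        have "u * s < Y \<omega> \<longleftrightarrow> s < Y \<omega> / u" using u by (simp add: field_simps)
        then show ?case using elim True y by (auto simp: indicator_def)
      qed
    qed
    also have "\<dots> = ennreal (G (Y \<omega> / u))" by (rule FTC[OF y(1)])
    finally show ?thesis using True by simp
  next
    case False
    have "\<not> (u * s < Y \<omega> \<and> Y \<omega> \<le> u * b)" if "1 \<le> s" for s
    proof -
      have "u * 1 \<le> u * s" using u that by (intro mult_left_mono) auto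
      then show ?thesis using False by auto
    qed
    then have "ennreal (g s) * indicator {1..b} s * of_bool (u * s < Y \<omega> \<and> Y \<omega> \<le> u * b) = 0" for s
      by (auto simp: indicator_def)
    then have "(\<integral>\<^sup>+s. ennreal (g s) * indicator {1..b} s * of_bool (u * s < Y \<omega> \<and> Y \<omega> \<le> u * b) \<partial>lborel) = 0"
      by (simp only: nn_integral_const) simp
    moreover have "of_bool (u < Y \<omega> \<and> Y \<omega> \<le> u * b) = (0::real)" using False by simp
    ultimately show ?thesis by (simp only: mult_zero_left ennreal_0)
  qed
  have outer: "(\<integral>\<^sup>+\<omega>. ennreal (g s) * indicator {1..b} s * of_bool (u * s < Y \<omega> \<and> Y \<omega> \<le> u * b) \<partial>P)
      = ennreal (indicator {1..b} s * (g s * (tail P Y (u * s) - tail P Y (u * b))))" for s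
  proof (cases "s \<in> {1..b}")
    case True
    then have us: "u * s \<le> u * b" using u by simp
    have "(\<integral>\<^sup>+\<omega>. of_bool (u * s < Y \<omega> \<and> Y \<omega> \<le> u * b) \<partial>P) = 
       (\<integral>\<^sup>+\<omega>. indicator {\<omega> \<in> space P. u * s < Y \<omega> \<and> Y \<omega> \<le> u * b} \<omega> \<partial>P)"
      by (intro nn_integral_cong) (auto simp: indicator_def)
    also have "\<dots> = ennreal (tail P Y (u * s) - tail P Y (u * b))"
      using tail_diff[OF P Y us] by (simp add: emeasure_eq_measure)
    finally show ?thesis using True g0[of s] tail_antimono[OF P Y us]
      by (simp add: nn_integral_cmult ennreal_mult)
  qed simp
  have nonneg: "0 \<le> of_bool (u < Y \<omega> \<and> Y \<omega> \<le> u * b) * G (Y \<omega> / u)" for \<omega>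
    using Gnn[of "Y \<omega> / u"] u by (auto simp: field_simps)
  have nonneg': "0 \<le> indicator {1..b} s * (g s * (tail P Y (u * s) - tail P Y (u * b)))" for s
    using g0[of s] tail_antimono[OF P Y, of "u * s" "u * b"] u by (auto simp: indicator_def)
  have "(\<integral>\<^sup>+\<omega>. ennreal (of_bool (u < Y \<omega> \<and> Y \<omega> \<le> u * b) * G (Y \<omega> / u)) \<partial>P) =
    (\<integral>\<^sup>+s. ennreal (indicator {1..b} s * (g s * (tail P Y (u * s) - tail P Y (u * b)))) \<partial>lborel)"
    unfolding inner outer[symmetric] by (rule PL.Fubini'[symmetric]) measurable
  then show "(\<integral>\<omega>. of_bool (u < Y \<omega> \<and> Y \<omega> \<le> u * b) * G (Y \<omega> / u) \<partial>P) =
     (\<integral>s. indicator {1..b} s * (g s * (tail P Y (u * s) - tail P Y (u * b))) \<partial>lborel)"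
    by (subst (1 2) integral_eq_nn_integral) (use nonneg nonneg' in auto)
qed

text \<open>The moment of \<open>G\<close> is an integral of the tail, so replacing the tail by \<open>s powr (- \<alpha>)\<close> costs at most
the integrated tail error \<open>I\<close>; the last term comes from the truncation at \<open>u b\<close>. The truncation
keeps the weight \<open>s g s\<close> bounded by \<open>C\<close>, which makes the square of the logarithm accessible although
\<open>I\<close> is weighted by \<open>1 / s\<close> only.\<close>

lemma truncated_moment_approx:
  fixes g G K :: "real \<Rightarrow> real"
  assumes P: "prob_space P" and Y [measurable]: "Y \<in> borel_measurable P"
    and u: "u > 0" and b: "b \<ge> 1"
    and g [measurable]: "g \<in> borel_measurable borel" and g0: "\<And>s. 1 \<le> s \<Longrightarrow> 0 \<le> g s"
    and G: "\<And>s. 1 \<le> s \<Longrightarrow> (G has_real_derivative g s) (at s)" and G1: "G 1 = 0"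
    and Gm: "G \<in> borel_measurable borel"
    and K: "\<And>s. 1 \<le> s \<Longrightarrow> (K has_real_derivative g s * s powr (-\<alpha>)) (at s)"
    and gC: "\<And>s. 1 \<le> s \<Longrightarrow> s \<le> b \<Longrightarrow> g s \<le> C / s" and C: "C \<ge> 0"
    and N: "N \<ge> 0" and I0: "I \<ge> 0"
    and I: "(\<integral>\<^sup>+ s \<in> {1<..}. ennreal (\<bar>N * tail P Y (u * s) - s powr (-\<alpha>)\<bar> / s) \<partial>lborel) \<le> ennreal I"
  shows "\<bar>N * (\<integral>\<omega>. of_bool (u < Y \<omega> \<and> Y \<omega> \<le> u * b) * G (Y \<omega> / u) \<partial>P) - (K b - K 1)\<bar>
     \<le> C * I + N * tail P Y (u * b) * G b"
proof -
  interpret prob_space P by fact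
  have [measurable]: "tail P Y \<in> borel_measurable borel" by (rule tail_measurable[OF P Y])
  note E = expectation_truncated_antiderivative[OF P Y u b g g0 G G1 Gm]
  define T where "T = (\<lambda>s. tail P Y (u * s))"
  have [measurable]: "T \<in> borel_measurable borel" unfolding T_def by measurable
  have T1: "\<bar>T s\<bar> \<le> 1" for s using tail_le_1[OF P, of Y "u * s"] tail_nonneg[of P Y "u * s"]
    by (simp add: T_def abs_le_iff)
  define i where "i = (\<lambda>s. indicator {1..b} s * g s)"
  have i0: "i s \<ge> 0" for s using g0 by (auto simp: i_def indicator_def)
  have [measurable]: "i \<in> borel_measurable borel" unfolding i_def by measurable
  have ii: "integrable lborel i" using E(3) by (simp add: i_def)
  have iT: "integrable lborel (\<lambda>s. i s * T s)"
    by (rule Bochner_Integration.integrable_bound[OF ii]) (use T1 i0 in \<open>auto simp: abs_mult intro!: mult_left_le\<close>)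
  have p1: "i s * s powr (-\<alpha>) \<le> i s * (1 + b powr (-\<alpha>))" for s 
  proof (cases "s \<in> {1..b}")
    case True
    have "s powr (-\<alpha>) \<le> 1 + b powr (-\<alpha>)"
    proof (cases "\<alpha> \<ge> 0")
      case t: True
      have "s powr (-\<alpha>) \<le> 1" using powr_mono[of "-\<alpha>" 0 s] t True by simp
      then show ?thesis by (smt (verit) powr_ge_zero)
    next
      case False
      have "s powr (-\<alpha>) \<le> b powr (-\<alpha>)" using False True by (intro powr_mono2) auto
      then show ?thesis by simp
    qed
    then show ?thesis using i0 by (intro mult_left_mono)
  qed (simp add: i_def)
  have ip: "integrable lborel (\<lambda>s. i s * s powr (-\<alpha>))"
    by (rule Bochner_Integration.integrable_bound[where f="\<lambda>s. i s * (1 + b powr (-\<alpha>))"])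
       (use ii p1 i0 in \<open>auto simp: abs_mult\<close>)
  have Kb: "(\<integral>s. i s * s powr (-\<alpha>) \<partial>lborel) = K b - K 1"
  proof -
    have le: "K 1 \<le> K b" using DERIV_nonneg_imp_nondecreasing[OF b, of K] K g0
      by (metis mult_nonneg_nonneg powr_ge_zero)
    have "(\<integral>\<^sup>+s. ennreal (g s * s powr (-\<alpha>)) * indicator {1..b} s \<partial>lborel) = ennreal (K b - K 1)"
      using b g0 K by (intro nn_integral_FTC_Icc) (auto simp: has_field_derivative_at_within)
    moreover have "ennreal (g s * s powr (-\<alpha>)) * indicator {1..b} s = ennreal (i s * s powr (-\<alpha>))" for s
      by (auto simp: i_def indicator_def)
    ultimately show ?thesis using le i0 by (subst integral_eq_nn_integral) auto
  qed
  define D where "D = (\<integral>s. i s * (N * T s - s powr (-\<alpha>)) \<partial>lborel)"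
  have Dint: "integrable lborel (\<lambda>s. i s * (N * T s - s powr (-\<alpha>)))"
    using iT ip by (simp add: right_diff_distrib mult.left_commute[of _ N])
  have "N * (\<integral>\<omega>. of_bool (u < Y \<omega> \<and> Y \<omega> \<le> u * b) * G (Y \<omega> / u) \<partial>P) = 
     N * (\<integral>s. i s * (T s - T b) \<partial>lborel)"
    using E(1) unfolding i_def T_def mult.assoc by (rule arg_cong[where f="\<lambda>x. N * x"])
  also have "\<dots> = N * (\<integral>s. i s * T s \<partial>lborel) - N * T b * G b"
    using iT ii E(4) by (simp add: right_diff_distrib flip: i_def)
  also have "N * (\<integral>s. i s * T s \<partial>lborel) = D + (K b - K 1)"
  proof -
    have "D = N * (\<integral>s. i s * T s \<partial>lborel) - (\<integral>s. i s * s powr (-\<alpha>) \<partial>lborel)"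
      unfolding D_def using iT ip by (simp add: right_diff_distrib mult.left_commute[of _ N])
    then show ?thesis using Kb by simp
  qed
  finally have eq: "N * (\<integral>\<omega>. of_bool (u < Y \<omega> \<and> Y \<omega> \<le> u * b) * G (Y \<omega> / u) \<partial>P) - (K b - K 1) = D - N * T b * G b"
    by simp
  have "\<bar>D\<bar> \<le> (\<integral>s. \<bar>i s * (N * T s - s powr (-\<alpha>))\<bar> \<partial>lborel)"
    unfolding D_def by (rule integral_abs_bound)
  also have "\<dots> \<le> C * I"
  proof -
    have "(\<integral>\<^sup>+s. ennreal \<bar>i s * (N * T s - s powr (-\<alpha>))\<bar> \<partial>lborel) \<le> 
       (\<integral>\<^sup>+s. ennreal C * (ennreal (\<bar>N * T s - s powr (-\<alpha>)\<bar> / s) * indicator {1<..} s) \<partial>lborel)"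
    proof (rule nn_integral_mono_AE)
      show "AE s in lborel. ennreal \<bar>i s * (N * T s - s powr (-\<alpha>))\<bar> \<le> 
         ennreal C * (ennreal (\<bar>N * T s - s powr (-\<alpha>)\<bar> / s) * indicator {1<..} s)"
        using AE_lborel_singleton[of 1]
      proof eventually_elim
        case (elim s)
        show ?case
        proof (cases "s \<in> {1..b}")
          case True
          then have s: "s > 1" using elim by auto
          have "\<bar>i s * (N * T s - s powr (-\<alpha>))\<bar> = g s * \<bar>N * T s - s powr (-\<alpha>)\<bar>" 
            using True g0[of s] by (simp add: i_def abs_mult)
          also have "\<dots> \<le> C / s * \<bar>N * T s - s powr (-\<alpha>)\<bar>" using gC[of s] True by (intro mult_right_mono) auto
          finally have "ennreal \<bar>i s * (N * T s - s powr (-\<alpha>))\<bar> \<le> ennreal (C * (\<bar>N * T s - s powr (-\<alpha>)\<bar> / s))"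
            by (intro ennreal_leI) simp
          also have "\<dots> = ennreal C * ennreal (\<bar>N * T s - s powr (-\<alpha>)\<bar> / s)"
            using C s by (intro ennreal_mult) auto
          finally show ?thesis using s by simp
        qed (simp add: i_def)
      qed
    qed
    also have "\<dots> = ennreal C * (\<integral>\<^sup>+ s \<in> {1<..}. ennreal (\<bar>N * T s - s powr (-\<alpha>)\<bar> / s) \<partial>lborel)"
      by (rule nn_integral_cmult) measurable
    also have "\<dots> \<le> ennreal C * ennreal I" using I by (intro mult_left_mono) (auto simp: T_def)
    also have "\<dots> = ennreal (C * I)" using C I0 by (simp add: ennreal_mult)
    finally have le: "(\<integral>\<^sup>+s. ennreal \<bar>i s * (N * T s - s powr (-\<alpha>))\<bar> \<partial>lborel) \<le> ennreal (C * I)" .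
    have "integrable lborel (\<lambda>s. \<bar>i s * (N * T s - s powr (-\<alpha>))\<bar>)" using Dint by (rule integrable_abs)
    then have "ennreal (\<integral>s. \<bar>i s * (N * T s - s powr (-\<alpha>))\<bar> \<partial>lborel) \<le> ennreal (C * I)" 
      using le by (subst nn_integral_eq_integral[symmetric]) auto
    then show ?thesis using C I0 by (simp add: ennreal_le_iff)
  qed
  finally have "\<bar>D\<bar> \<le> C * I" .
  moreover have "0 \<le> N * T b * G b" using N E(2) tail_nonneg[of P Y "u * b"] by (simp add: T_def)
  ultimately show ?thesis unfolding eq by (simp add: T_def)
qed

lemma truncated_log_moment:
  assumes P: "prob_space P" and Y: "Y \<in> borel_measurable P"
    and u: "u > 0" and b: "b \<ge> 1" and \<alpha>: "\<alpha> > 0" and N: "N \<ge> 0" and I0: "I \<ge> 0"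
    and I: "(\<integral>\<^sup>+ s \<in> {1<..}. ennreal (\<bar>N * tail P Y (u * s) - s powr (-\<alpha>)\<bar> / s) \<partial>lborel) \<le> ennreal I"
  shows "\<bar>N * (\<integral>\<omega>. of_bool (u < Y \<omega> \<and> Y \<omega> \<le> u * b) * ln (Y \<omega> / u) \<partial>P) - 1 / \<alpha>\<bar>
     \<le> I + b powr (-\<alpha>) / \<alpha> + N * tail P Y (u * b) * ln b"
proof -
  have "\<bar>N * (\<integral>\<omega>. of_bool (u < Y \<omega> \<and> Y \<omega> \<le> u * b) * ln (Y \<omega> / u) \<partial>P) - (- (b powr (-\<alpha>)) / \<alpha> - - (1 powr (-\<alpha>)) / \<alpha>)\<bar>
     \<le> 1 * I + N * tail P Y (u * b) * ln b"
  proof (rule truncated_moment_approx[OF P Y u b, where g="\<lambda>s. 1 / s" and K="\<lambda>s. - (s powr (-\<alpha>)) / \<alpha>"])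
    show "((\<lambda>s. - (s powr (-\<alpha>)) / \<alpha>) has_real_derivative 1 / s * s powr (-\<alpha>)) (at s)" if "1 \<le> s" for s
      using that \<alpha> by (auto intro!: derivative_eq_intros simp: powr_diff field_simps)
  qed (use N I0 I in \<open>auto intro!: derivative_eq_intros\<close>)
  moreover have "b powr (-\<alpha>) / \<alpha> \<ge> 0" using \<alpha> by simp
  ultimately show ?thesis by simp
qed

lemma truncated_log_square_moment:
  assumes P: "prob_space P" and Y: "Y \<in> borel_measurable P"
    and u: "u > 0" and b: "b \<ge> 1" and \<alpha>: "\<alpha> > 0" and N: "N \<ge> 0" and I0: "I \<ge> 0"
    and I: "(\<integral>\<^sup>+ s \<in> {1<..}. ennreal (\<bar>N * tail P Y (u * s) - s powr (-\<alpha>)\<bar> / s) \<partial>lborel) \<le> ennreal I"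
  shows "\<bar>N * (\<integral>\<omega>. of_bool (u < Y \<omega> \<and> Y \<omega> \<le> u * b) * (ln (Y \<omega> / u))\<^sup>2 \<partial>P) - 2 / \<alpha>\<^sup>2\<bar>
     \<le> 2 * ln b * I + 2 * b powr (-\<alpha>) * (ln b / \<alpha> + 1 / \<alpha>\<^sup>2) + N * tail P Y (u * b) * (ln b)\<^sup>2"
proof -
  \<comment> \<open>An antiderivative of \<open>2 * ln s * s powr (- \<alpha> - 1)\<close>, by parts.\<close>
  define K where "K = (\<lambda>s::real. - 2 * s powr (-\<alpha>) * (ln s / \<alpha> + 1 / \<alpha>\<^sup>2))"
  have "\<bar>N * (\<integral>\<omega>. of_bool (u < Y \<omega> \<and> Y \<omega> \<le> u * b) * (ln (Y \<omega> / u))\<^sup>2 \<partial>P) - (K b - K 1)\<bar>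
     \<le> (2 * ln b) * I + N * tail P Y (u * b) * (ln b)\<^sup>2"
  proof (rule truncated_moment_approx[OF P Y u b, where g="\<lambda>s. 2 * ln s / s"])
    show "(K has_real_derivative 2 * ln s / s * s powr (-\<alpha>)) (at s)" if "1 \<le> s" for s
      unfolding K_def using that \<alpha> 
      by (auto intro!: derivative_eq_intros simp: powr_diff field_simps power2_eq_square)
    show "2 * ln s / s \<le> 2 * ln b / s" if "1 \<le> s" "s \<le> b" for s 
      using that by (intro divide_right_mono mult_left_mono) auto
  qed (use N I0 I b in \<open>auto intro!: derivative_eq_intros\<close>)
  moreover have "b powr (-\<alpha>) * (ln b / \<alpha> + 1 / \<alpha>\<^sup>2) \<ge> 0" using \<alpha> b by simp
  moreover have "K 1 = - 2 / \<alpha>\<^sup>2" by (simp add: K_def)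
  ultimately show ?thesis by (simp add: K_def)
qed

section \<open>Limit theorems given the number of exceedances\<close>

lemma eventually_greater:
  fixes f :: "nat \<Rightarrow> real"
  assumes "filterlim f at_top sequentially"
  shows "eventually (\<lambda>n. z < f n) sequentially"
  using assms by (simp add: filterlim_at_top_dense)

lemma exp_scale_limit:
  fixes g :: "nat \<Rightarrow> real"
  assumes g: "filterlim g at_top sequentially"
  shows "(\<lambda>n. g n * (exp (y / g n) - 1)) \<longlonglongrightarrow> y"
proof -
  have "((\<lambda>h. exp (y * h)) has_real_derivative y) (at 0)"
    by (auto intro!: derivative_eq_intros)
  then have lim: "((\<lambda>h. (exp (y * h) - 1) / h) \<longlongrightarrow> y) (at 0)"
    by (simp add: has_field_derivative_iff)
  have "filterlim (\<lambda>n. inverse (g n)) (at 0) sequentially"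
    by (rule filterlim_mono[OF filterlim_compose[OF filterlim_inverse_at_right_top g]])
       (auto intro: at_le)
  from filterlim_compose[OF lim this] show ?thesis by (simp add: field_simps)
qed

text \<open>Chebyshev's inequality for \<open>f\<close> centred by its mean under the law conditioned on \<open>Y \<le> c\<close>;
centring cannot increase the second moment.\<close>

lemma conditional_Chebyshev:
  fixes f :: "real \<Rightarrow> real" and c a B :: real and n m :: nat
  assumes P: "prob_space P" and Y: "iid P Y" and f [measurable]: "f \<in> borel_measurable borel"
    and bd: "\<And>y. \<bar>f y\<bar> \<le> B" and sup: "\<And>y. y > c \<Longrightarrow> f y = 0"
    and q: "tail P (Y 0) c < 1" and a: "a > 0"
  defines "N \<equiv> \<lambda>\<omega>. exceedances (\<lambda>j. Y j \<omega>) n c"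
  defines "\<mu> \<equiv> (\<integral>\<omega>. f (Y 0 \<omega>) \<partial>P) / (1 - tail P (Y 0) c)"
  shows "measure P {\<omega> \<in> space P. N \<omega> = m \<and> \<bar>(\<Sum>j=1..n. f (Y j \<omega>)) - (real n - real m) * \<mu>\<bar> \<ge> a}
     \<le> real n * (\<integral>\<omega>. (f (Y 0 \<omega>))\<^sup>2 \<partial>P) / (1 - tail P (Y 0) c) / a\<^sup>2 * measure P {\<omega> \<in> space P. N \<omega> = m}"
proof -
  interpret prob_space P by fact
  have [measurable]: "Y i \<in> borel_measurable P" for i by (rule iid_measurable[OF P Y])
  have [measurable]: "N \<in> measurable P (count_space UNIV)" unfolding N_def by measurable
  define Q where "Q = 1 - tail P (Y 0) c"
  have Q: "Q > 0" using q by (simp add: Q_def)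
  define \<phi> where "\<phi> y = (f y - \<mu>) * of_bool (y \<le> c)" for y
  have [measurable]: "\<phi> \<in> borel_measurable borel" unfolding \<phi>_def by measurable
  have B0: "B \<ge> 0" using bd[of 0] by linarith
  have \<phi>bd: "\<bar>\<phi> y\<bar> \<le> B + \<bar>\<mu>\<bar>" for y using bd[of y] B0 by (auto simp: \<phi>_def)
  have \<phi>f: "\<phi> y = f y - \<mu> * of_bool (y \<le> c)" for y using sup[of y] by (auto simp: \<phi>_def)
  have Qe: "(\<integral>\<omega>. of_bool (Y 0 \<omega> \<le> c) \<partial>P) = Q" using prob_le_tail[OF P, of "Y 0" c] by (simp add: Q_def)
  have iY: "integrable P (\<lambda>\<omega>. of_bool (Y 0 \<omega> \<le> c) :: real)" by (rule integrable_const_bound[where B=1]) auto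
  have iF: "integrable P (\<lambda>\<omega>. f (Y 0 \<omega>))" by (rule integrable_const_bound[where B=B]) (use bd in auto)
  have sq: "(f y)\<^sup>2 \<le> B\<^sup>2" for y using bd[of y] B0 by (simp add: abs_le_square_iff[symmetric])
  have iF2: "integrable P (\<lambda>\<omega>. (f (Y 0 \<omega>))\<^sup>2)" by (rule integrable_const_bound[where B="B\<^sup>2"]) (use sq in auto)
  have \<mu>Q: "(\<integral>\<omega>. f (Y 0 \<omega>) \<partial>P) = \<mu> * Q" using Q by (simp add: \<mu>_def Q_def)
  have mean: "(\<integral>\<omega>. \<phi> (Y 0 \<omega>) \<partial>P) = 0"
    unfolding \<phi>f using iY iF by (simp add: Qe \<mu>Q)
  have "(\<phi> y)\<^sup>2 = (f y)\<^sup>2 - 2 * \<mu> * f y + \<mu>\<^sup>2 * of_bool (y \<le> c)" for y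
    using sup[of y] by (auto simp: \<phi>_def power2_eq_square algebra_simps)
  then have "(\<integral>\<omega>. (\<phi> (Y 0 \<omega>))\<^sup>2 \<partial>P) = (\<integral>\<omega>. (f (Y 0 \<omega>))\<^sup>2 \<partial>P) - 2 * \<mu> * (\<mu> * Q) + \<mu>\<^sup>2 * Q"
    using iY iF iF2 by (simp add: Qe \<mu>Q)
  also have "\<dots> = (\<integral>\<omega>. (f (Y 0 \<omega>))\<^sup>2 \<partial>P) - \<mu>\<^sup>2 * Q" by (simp add: power2_eq_square)
  also have "\<dots> \<le> (\<integral>\<omega>. (f (Y 0 \<omega>))\<^sup>2 \<partial>P)" using Q by simp
  finally have var: "(\<integral>\<omega>. (\<phi> (Y 0 \<omega>))\<^sup>2 \<partial>P) \<le> (\<integral>\<omega>. (f (Y 0 \<omega>))\<^sup>2 \<partial>P)" .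
  define S where "S \<omega> = (\<Sum>j=1..n. f (Y j \<omega>)) - (real n - real m) * \<mu>" for \<omega>
  define A where "A = {\<omega> \<in> space P. N \<omega> = m \<and> \<bar>S \<omega>\<bar> \<ge> a}"
  have [measurable]: "S \<in> borel_measurable P" unfolding S_def by measurable
  have A: "A \<in> sets P" unfolding A_def by measurable
  have S\<phi>: "S \<omega> = (\<Sum>j=1..n. \<phi> (Y j \<omega>))" if "N \<omega> = m" for \<omega>
  proof -
    have "(\<Sum>j=1..n. of_bool (Y j \<omega> \<le> c)) = (\<Sum>j=1..n. 1 - (if Y j \<omega> > c then 1 else 0) :: real)"
      by (intro sum.cong) auto
    also have "\<dots> = real n - real m"
      using that unfolding N_def by (simp add: sum_subtractf exceedances_eq_sum[symmetric] del: One_nat_def)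
    finally have "(\<Sum>j=1..n. of_bool (Y j \<omega> \<le> c)) = real n - real m" .
    moreover have "(\<Sum>j=1..n. \<phi> (Y j \<omega>)) = (\<Sum>j=1..n. f (Y j \<omega>)) - (\<Sum>j=1..n. of_bool (Y j \<omega> \<le> c)) * \<mu>"
      unfolding \<phi>f sum_subtractf sum_distrib_right by (simp add: mult.commute)
    ultimately show ?thesis by (simp add: S_def)
  qed
  have "a\<^sup>2 * measure P A = (\<integral>\<omega>. a\<^sup>2 * indicator A \<omega> \<partial>P)" using A by simp
  also have "\<dots> \<le> (\<integral>\<omega>. of_bool (N \<omega> = m) * (\<Sum>j=1..n. \<phi> (Y j \<omega>))\<^sup>2 \<partial>P)"
  proof (rule integral_mono)
    show "integrable P (\<lambda>\<omega>. a\<^sup>2 * indicator A \<omega>)" using A by (simp add: emeasure_eq_measure)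
    have "\<bar>\<Sum>j=1..n. \<phi> (Y j \<omega>)\<bar> \<le> real n * (B + \<bar>\<mu>\<bar>)" for \<omega>
      using sum_norm_bound[of "{1..n}" "\<lambda>j. \<phi> (Y j \<omega>)" "B + \<bar>\<mu>\<bar>"] \<phi>bd by simp
    then have "(\<Sum>j=1..n. \<phi> (Y j \<omega>))\<^sup>2 \<le> (real n * (B + \<bar>\<mu>\<bar>))\<^sup>2" for \<omega>
      by (metis abs_ge_zero power2_abs power_mono)
    then show "integrable P (\<lambda>\<omega>. of_bool (N \<omega> = m) * (\<Sum>j=1..n. \<phi> (Y j \<omega>))\<^sup>2)"
      by (intro integrable_const_bound[where B="(real n * (B + \<bar>\<mu>\<bar>))\<^sup>2"]) auto
    show "a\<^sup>2 * indicator A \<omega> \<le> of_bool (N \<omega> = m) * (\<Sum>j=1..n. \<phi> (Y j \<omega>))\<^sup>2" for \<omega>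
    proof (cases "\<omega> \<in> A")
      case True
      then have "N \<omega> = m" "a \<le> \<bar>\<Sum>j=1..n. \<phi> (Y j \<omega>)\<bar>" using S\<phi> by (auto simp: A_def)
      then show ?thesis using True a power_mono[of a "\<bar>\<Sum>j=1..n. \<phi> (Y j \<omega>)\<bar>" 2] by simp
    qed simp
  qed
  also have "\<dots> \<le> real n * (\<integral>\<omega>. (\<phi> (Y 0 \<omega>))\<^sup>2 \<partial>P) / (1 - tail P (Y 0) c) *
         measure P {\<omega> \<in> space P. N \<omega> = m}"
    unfolding N_def
    by (rule conditional_second_moment[OF P Y _ \<phi>bd _ mean q]) (auto simp: \<phi>_def)
  also have "\<dots> \<le> real n * (\<integral>\<omega>. (f (Y 0 \<omega>))\<^sup>2 \<partial>P) / (1 - tail P (Y 0) c) *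
         measure P {\<omega> \<in> space P. N \<omega> = m}"
    using var q by (intro mult_right_mono divide_right_mono mult_left_mono) auto
  finally have "measure P A \<le> real n * (\<integral>\<omega>. (f (Y 0 \<omega>))\<^sup>2 \<partial>P) / (1 - tail P (Y 0) c) *
         measure P {\<omega> \<in> space P. N \<omega> = m} / a\<^sup>2"
    by (subst pos_le_divide_eq) (use a in \<open>auto simp: mult.commute\<close>)
  then show ?thesis by (simp add: A_def S_def)
qed

text \<open>The conditional mean \<open>(n - m) E f / (1 - q)\<close> may be replaced by \<open>n E f\<close>, and so by \<open>L\<close>, as the two
differ by \<open>n E f\<close> times a quantity of the order of \<open>q + m / n\<close>; the assumptions \<open>neg\<close> make this negligible.\<close>

lemma conditional_concentration:
  fixes f :: "nat \<Rightarrow> real \<Rightarrow> real" and c B L :: "nat \<Rightarrow> real" and m :: "nat \<Rightarrow> nat"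
  assumes P: "prob_space P" and Y: "iid P Y" and f [measurable]: "\<And>n. f n \<in> borel_measurable borel"
    and bd: "\<And>n y. \<bar>f n y\<bar> \<le> B n" and sup: "\<And>n y. y > c n \<Longrightarrow> f n y = 0"
    and q: "(\<lambda>n. tail P (Y 0) (c n)) \<longlonglongrightarrow> 0" and m: "(\<lambda>n. real (m n) / real n) \<longlonglongrightarrow> 0"
    and L: "(\<lambda>n. real n * (\<integral>\<omega>. f n (Y 0 \<omega>) \<partial>P) - L n) \<longlonglongrightarrow> 0"
    and neg: "(\<lambda>n. real n * (\<integral>\<omega>. f n (Y 0 \<omega>) \<partial>P) * tail P (Y 0) (c n)) \<longlonglongrightarrow> 0"
      "(\<lambda>n. real n * (\<integral>\<omega>. f n (Y 0 \<omega>) \<partial>P) * (real (m n) / real n)) \<longlonglongrightarrow> 0"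
    and v: "(\<lambda>n. real n * (\<integral>\<omega>. (f n (Y 0 \<omega>))\<^sup>2 \<partial>P)) \<longlonglongrightarrow> v"
    and a: "a > 0" "v < \<delta> * a\<^sup>2"
  defines "N \<equiv> \<lambda>n \<omega>. exceedances (\<lambda>j. Y j \<omega>) n (c n)"
  shows "eventually (\<lambda>n. measure P {\<omega> \<in> space P. N n \<omega> = m n \<and> \<bar>(\<Sum>j=1..n. f n (Y j \<omega>)) - L n\<bar> \<ge> 2 * a}
     \<le> \<delta> * measure P {\<omega> \<in> space P. N n \<omega> = m n}) sequentially"
proof -
  interpret prob_space P by fact
  have [measurable]: "Y i \<in> borel_measurable P" for i by (rule iid_measurable[OF P Y])
  have [measurable]: "N n \<in> measurable P (count_space UNIV)" for n unfolding N_def by measurable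
  define q' where "q' n = tail P (Y 0) (c n)" for n
  define e where "e n = (\<integral>\<omega>. f n (Y 0 \<omega>) \<partial>P)" for n
  have q1: "eventually (\<lambda>n. q' n < 1/2) sequentially"
    using q unfolding q'_def by (intro order_tendstoD(2)) auto
  have z0: "(0 - 0) / (1 - 0) + 0 = (0::real)" by simp
  have lim0: "(\<lambda>n. (real n * e n * q' n - real n * e n * (real (m n) / real n)) / (1 - q' n) + (real n * e n - L n)) \<longlonglongrightarrow> (0 - 0) / (1 - 0) + 0"
    using q L neg unfolding q'_def[symmetric] e_def[symmetric] by (intro tendsto_intros) auto
  then have "eventually (\<lambda>n. \<bar>(real n * e n * q' n - real n * e n * (real (m n) / real n)) / (1 - q' n) + (real n * e n - L n)\<bar> < a) sequentially"
    using tendstoD[OF lim0[unfolded z0] a(1)] by (simp only: dist_real_def diff_0_right)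
  then have mean: "eventually (\<lambda>n. \<bar>(real n - real (m n)) * (e n / (1 - q' n)) - L n\<bar> < a) sequentially"
    using q1 eventually_gt_at_top[of "0::nat"]
  proof eventually_elim
    case (elim n)
    have "(real n - real (m n)) * (e n / (1 - q' n)) = real n * e n + (real n * e n * q' n - real n * e n * (real (m n) / real n)) / (1 - q' n)"
      using elim by (simp add: field_simps)
    then show ?case using elim(1) by (simp add: algebra_simps)
  qed
  have "(\<lambda>n. real n * (\<integral>\<omega>. (f n (Y 0 \<omega>))\<^sup>2 \<partial>P) / (1 - q' n) / a\<^sup>2) \<longlonglongrightarrow> v / (1 - 0) / a\<^sup>2"
    using q v a unfolding q'_def by (intro tendsto_intros) auto
  moreover have "v / (1 - 0) / a\<^sup>2 < \<delta>" using a by (simp add: pos_divide_less_eq)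
  ultimately have var: "eventually (\<lambda>n. real n * (\<integral>\<omega>. (f n (Y 0 \<omega>))\<^sup>2 \<partial>P) / (1 - q' n) / a\<^sup>2 < \<delta>) sequentially"
    by (rule order_tendstoD(2))
  show ?thesis using mean var q1
  proof eventually_elim
    case (elim n)
    have "measure P {\<omega> \<in> space P. N n \<omega> = m n \<and> \<bar>(\<Sum>j=1..n. f n (Y j \<omega>)) - L n\<bar> \<ge> 2 * a}
      \<le> measure P {\<omega> \<in> space P. N n \<omega> = m n \<and> \<bar>(\<Sum>j=1..n. f n (Y j \<omega>)) - (real n - real (m n)) * (e n / (1 - q' n))\<bar> \<ge> a}"
    proof (rule finite_measure_mono)
      show "{\<omega> \<in> space P. N n \<omega> = m n \<and> \<bar>(\<Sum>j=1..n. f n (Y j \<omega>)) - L n\<bar> \<ge> 2 * a} \<subseteq>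
        {\<omega> \<in> space P. N n \<omega> = m n \<and> \<bar>(\<Sum>j=1..n. f n (Y j \<omega>)) - (real n - real (m n)) * (e n / (1 - q' n))\<bar> \<ge> a}"
      proof (rule Collect_mono, intro impI, elim conjE, intro conjI)
        have gen: "a \<le> \<bar>x - y\<bar>" if "2 * a \<le> \<bar>x - z\<bar>" "\<bar>y - z\<bar> < a" for x y z :: real
          using that by linarith
        fix \<omega> assume "2 * a \<le> \<bar>(\<Sum>j=1..n. f n (Y j \<omega>)) - L n\<bar>"
        then show "a \<le> \<bar>(\<Sum>j=1..n. f n (Y j \<omega>)) - (real n - real (m n)) * (e n / (1 - q' n))\<bar>"
          using elim(1) by (rule gen)
      qed
    qed measurable
    also have "\<dots> \<le> real n * (\<integral>\<omega>. (f n (Y 0 \<omega>))\<^sup>2 \<partial>P) / (1 - q' n) / a\<^sup>2 * measure P {\<omega> \<in> space P. N n \<omega> = m n}"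
      unfolding N_def e_def q'_def
      by (rule conditional_Chebyshev[OF P Y f bd sup _ a(1)]) (use elim(3) in \<open>auto simp: q'_def\<close>)
    also have "\<dots> \<le> \<delta> * measure P {\<omega> \<in> space P. N n \<omega> = m n}"
      using elim(2) by (intro mult_right_mono) auto
    finally show ?case .
  qed
qed

text \<open>Second order Taylor expansion of the exponential; the third order remainder is \<open>B\<close> times a
second moment.\<close>

lemma truncated_char_estimate:
  fixes f :: "real \<Rightarrow> real"
  assumes P: "prob_space P" and Y [measurable]: "Y \<in> borel_measurable P" and f [measurable]: "f \<in> borel_measurable borel"
    and bd: "\<And>y. \<bar>f y\<bar> \<le> B" and sup: "\<And>y. y > c \<Longrightarrow> f y = 0"
  shows "norm ((\<integral>\<omega>. iexp (t * f (Y \<omega>)) * of_bool (Y \<omega> \<le> c) \<partial>P) - 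
      (of_real (1 - tail P Y c) + \<i> * of_real (t * (\<integral>\<omega>. f (Y \<omega>) \<partial>P)) - of_real (t\<^sup>2 / 2 * (\<integral>\<omega>. (f (Y \<omega>))\<^sup>2 \<partial>P))))
     \<le> \<bar>t\<bar>^3 * B / 6 * (\<integral>\<omega>. (f (Y \<omega>))\<^sup>2 \<partial>P)"
proof -
  interpret prob_space P by fact
  have B0: "B \<ge> 0" using bd[of 0] by linarith
  have iY: "integrable P (\<lambda>\<omega>. of_bool (Y \<omega> \<le> c) :: real)" by (rule integrable_const_bound[where B=1]) auto
  have iF: "integrable P (\<lambda>\<omega>. f (Y \<omega>))" by (rule integrable_const_bound[where B=B]) (use bd in auto)
  have sq: "(f y)\<^sup>2 \<le> B\<^sup>2" for y using bd[of y] B0 by (simp add: abs_le_square_iff[symmetric])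
  have iF2: "integrable P (\<lambda>\<omega>. (f (Y \<omega>))\<^sup>2)" by (rule integrable_const_bound[where B="B\<^sup>2"]) (use sq in auto)
  have iE: "integrable P (\<lambda>\<omega>. iexp (t * f (Y \<omega>)) * of_bool (Y \<omega> \<le> c))"
    by (rule integrable_const_bound[where B=1]) (auto simp: norm_mult)
  define T where "T y = complex_of_real (of_bool (y \<le> c)) + \<i> * complex_of_real (t * f y) - complex_of_real (t\<^sup>2 / 2 * (f y)\<^sup>2)" for y
  have iT: "integrable P (\<lambda>\<omega>. T (Y \<omega>))" unfolding T_def using iY iF iF2 
    by (intro Bochner_Integration.integrable_diff Bochner_Integration.integrable_add integrable_mult_right integrable_of_real) auto
  have ET: "(\<integral>\<omega>. T (Y \<omega>) \<partial>P) = of_real (1 - tail P Y c) + \<i> * of_real (t * (\<integral>\<omega>. f (Y \<omega>) \<partial>P)) - of_real (t\<^sup>2 / 2 * (\<integral>\<omega>. (f (Y \<omega>))\<^sup>2 \<partial>P))"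
  proof -
    have "(\<integral>\<omega>. T (Y \<omega>) \<partial>P) = (\<integral>\<omega>. complex_of_real (of_bool (Y \<omega> \<le> c)) \<partial>P) + (\<integral>\<omega>. \<i> * complex_of_real (t * f (Y \<omega>)) \<partial>P)
       - (\<integral>\<omega>. complex_of_real (t\<^sup>2 / 2 * (f (Y \<omega>))\<^sup>2) \<partial>P)"
      unfolding T_def using iY iF iF2
      by (subst Bochner_Integration.integral_diff Bochner_Integration.integral_add;
          (intro Bochner_Integration.integrable_add integrable_mult_right integrable_of_real)?)+ auto
    then show ?thesis by (simp only: integral_complex_of_real integral_mult_right_zero prob_le_tail[OF P Y])
  qed
  have pw: "norm (iexp (t * f y) * of_bool (y \<le> c) - T y) \<le> \<bar>t\<bar>^3 * B / 6 * (f y)\<^sup>2" for y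
  proof (cases "y \<le> c")
    case True
    have "(\<Sum>k\<le>2. (\<i> * complex_of_real (t * f y))^k / fact k) = T y"
      using True by (simp add: T_def numeral_2_eq_2 power_mult_distrib)
    then have "norm (iexp (t * f y) * of_bool (y \<le> c) - T y) \<le> \<bar>t * f y\<bar>^3 / 6"
      using iexp_approx1[of "t * f y" 2] True by (simp add: numeral_3_eq_3 fact_numeral)
    also have "\<dots> = \<bar>t\<bar>^3 * \<bar>f y\<bar> / 6 * (f y)\<^sup>2"
      by (simp add: abs_mult power_mult_distrib power2_eq_square power3_eq_cube abs_mult_self_eq mult_ac)
    also have "\<dots> \<le> \<bar>t\<bar>^3 * B / 6 * (f y)\<^sup>2"
      using bd by (intro mult_right_mono divide_right_mono mult_left_mono) auto
    finally show ?thesis .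
  next
    case False
    then show ?thesis using sup[of y] by (simp add: T_def)
  qed
  have "norm ((\<integral>\<omega>. iexp (t * f (Y \<omega>)) * of_bool (Y \<omega> \<le> c) \<partial>P) - (\<integral>\<omega>. T (Y \<omega>) \<partial>P))
     = norm (\<integral>\<omega>. iexp (t * f (Y \<omega>)) * of_bool (Y \<omega> \<le> c) - T (Y \<omega>) \<partial>P)"
    using iE iT by (subst Bochner_Integration.integral_diff) auto
  also have "\<dots> \<le> (\<integral>\<omega>. \<bar>t\<bar>^3 * B / 6 * (f (Y \<omega>))\<^sup>2 \<partial>P)"
    by (rule order_trans[OF integral_norm_bound integral_mono]) (use iE iT iF2 pw in auto)
  finally show ?thesis unfolding ET by simp
qed

text \<open>The summands are uniformly small (\<open>B\<close> tends to \<open>0\<close>), so the Taylor expansion of the characteristic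
function of one summand has a remainder of order \<open>o(1 / n)\<close>, and the power \<open>n - m\<close> is compared with
that of \<open>exp (- a / (n - m))\<close>, where \<open>a = t\<^sup>2 v / 2\<close>. All errors are relative to the probability of \<open>m\<close>
exceedances, so that they can be summed over \<open>m\<close>.\<close>

lemma conditional_clt:
  fixes f :: "nat \<Rightarrow> real \<Rightarrow> real" and c B :: "nat \<Rightarrow> real" and m :: "nat \<Rightarrow> nat"
  assumes P: "prob_space P" and Y: "iid P Y" and f [measurable]: "\<And>n. f n \<in> borel_measurable borel"
    and bd: "\<And>n y. \<bar>f n y\<bar> \<le> B n" and sup: "\<And>n y. y > c n \<Longrightarrow> f n y = 0"
    and q: "(\<lambda>n. tail P (Y 0) (c n)) \<longlonglongrightarrow> 0" and m: "(\<lambda>n. real (m n) / real n) \<longlonglongrightarrow> 0"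
    and B: "B \<longlonglongrightarrow> 0"
    and mean: "(\<lambda>n. real n * (\<integral>\<omega>. f n (Y 0 \<omega>) \<partial>P)) \<longlonglongrightarrow> 0"
    and v: "(\<lambda>n. real n * (\<integral>\<omega>. (f n (Y 0 \<omega>))\<^sup>2 \<partial>P)) \<longlonglongrightarrow> v"
    and \<delta>: "\<delta> > 0"
  defines "N \<equiv> \<lambda>n \<omega>. exceedances (\<lambda>j. Y j \<omega>) n (c n)"
  shows "eventually (\<lambda>n. norm ((\<integral>\<omega>. of_bool (N n \<omega> = m n) * iexp (t * (\<Sum>j=1..n. f n (Y j \<omega>))) \<partial>P)
        - of_real (measure P {\<omega> \<in> space P. N n \<omega> = m n} * exp (- t\<^sup>2 * v / 2)))
     \<le> \<delta> * measure P {\<omega> \<in> space P. N n \<omega> = m n}) sequentially"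
proof -
  interpret prob_space P by fact
  have Ym [measurable]: "Y i \<in> borel_measurable P" for i by (rule iid_measurable[OF P Y])
  define q' where "q' n = tail P (Y 0) (c n)" for n
  define e where "e n = (\<integral>\<omega>. f n (Y 0 \<omega>) \<partial>P)" for n
  define s where "s n = (\<integral>\<omega>. (f n (Y 0 \<omega>))\<^sup>2 \<partial>P)" for n
  define ch where "ch n = (\<integral>\<omega>. iexp (t * f n (Y 0 \<omega>)) * of_bool (Y 0 \<omega> \<le> c n) \<partial>P) / of_real (1 - q' n)" for n
  define a where "a = t\<^sup>2 * v / 2"
  \<comment> \<open>The \<open>n - m n\<close>-th root of the limit; the powers are compared through their bases.\<close>
  define w where "w n = exp (- a / real (n - m n))" for n
  define d where "d n = real n * norm (ch n - of_real (w n))" for n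
  have q1: "eventually (\<lambda>n. q' n < 1/2) sequentially"
    using q unfolding q'_def by (intro order_tendstoD(2)) auto
  have m1: "eventually (\<lambda>n. real (m n) / real n < 1/2) sequentially"
    using m by (intro order_tendstoD(2)) auto
  have s0: "s n \<ge> 0" for n unfolding s_def by simp
  have v0: "v \<ge> 0"
    by (rule LIMSEQ_le_const[OF v]) (use s0 in \<open>auto simp: s_def\<close>)
  have a0: "a \<ge> 0" using v0 by (simp add: a_def)
  have eqp: "(\<integral>\<omega>. of_bool (N n \<omega> = m n) * iexp (t * (\<Sum>j=1..n. f n (Y j \<omega>))) \<partial>P)
     = of_real (measure P {\<omega> \<in> space P. N n \<omega> = m n}) * ch n ^ (n - m n)" if "q' n < 1" for n
  proof -
    have "iexp (t * (\<Sum>j=1..n. f n (Y j \<omega>))) = (\<Prod>j=1..n. if Y j \<omega> > c n then 1 else iexp (t * f n (Y j \<omega>)))" for \<omega>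
    proof -
      have "iexp (t * (\<Sum>j=1..n. f n (Y j \<omega>))) = (\<Prod>j=1..n. iexp (t * f n (Y j \<omega>)))"
        by (simp add: sum_distrib_left flip: exp_sum)
      also have "\<dots> = (\<Prod>j=1..n. if Y j \<omega> > c n then 1 else iexp (t * f n (Y j \<omega>)))"
        using sup by (intro prod.cong) auto
      finally show ?thesis .
    qed
    then show ?thesis unfolding N_def ch_def q'_def
      using conditional_expectation_prod[OF P Y, of "\<lambda>y. iexp (t * f n y)" "c n" n "m n"] that
      by (simp add: q'_def)
  qed
  have ch1: "norm (ch n) \<le> 1" if "q' n < 1" for n
  proof -
    have "norm (\<integral>\<omega>. iexp (t * f n (Y 0 \<omega>)) * of_bool (Y 0 \<omega> \<le> c n) \<partial>P) \<le> (\<integral>\<omega>. norm (iexp (t * f n (Y 0 \<omega>)) * of_bool (Y 0 \<omega> \<le> c n)) \<partial>P)"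
      by (rule integral_norm_bound)
    also have "\<dots> = (\<integral>\<omega>. of_bool (Y 0 \<omega> \<le> c n) \<partial>P)" by (intro Bochner_Integration.integral_cong) (auto simp: norm_mult)
    also have "\<dots> = 1 - q' n" unfolding q'_def by (rule prob_le_tail[OF P]) simp
    finally show ?thesis using that unfolding ch_def norm_divide norm_of_real by simp
  qed
  have ratio: "(\<lambda>n. real (n - m n) / real n) \<longlonglongrightarrow> 1"
  proof -
    have "(\<lambda>n. 1 - real (m n) / real n) \<longlonglongrightarrow> 1 - 0" by (intro tendsto_intros m)
    moreover have "eventually (\<lambda>n. 1 - real (m n) / real n = real (n - m n) / real n) sequentially"
      using m1 eventually_gt_at_top[of "0::nat"] 
      by eventually_elim (auto simp: field_simps of_nat_diff)
    ultimately show ?thesis using Lim_transform_eventually by force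
  qed
  have Nlim: "filterlim (\<lambda>n. real (n - m n)) at_top sequentially"
  proof -
    have "filterlim (\<lambda>n. real (n - m n) / real n * real n) at_top sequentially"
      by (rule filterlim_tendsto_pos_mult_at_top[OF ratio _ filterlim_real_sequentially]) simp
    moreover have "eventually (\<lambda>n. real (n - m n) / real n * real n = real (n - m n)) sequentially"
      using eventually_gt_at_top[of "0::nat"] by eventually_elim simp
    ultimately show ?thesis by (rule filterlim_cong[THEN iffD1, OF refl refl, rotated])
  qed
  have wlim: "(\<lambda>n. real n * (w n - 1)) \<longlonglongrightarrow> - a"
  proof -
    have "(\<lambda>n. inverse (real (n - m n) / real n) * (real (n - m n) * (exp (- a / real (n - m n)) - 1))) \<longlonglongrightarrow> inverse 1 * (- a)"
      by (intro tendsto_mult tendsto_inverse ratio exp_scale_limit Nlim) simp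
    moreover have "eventually (\<lambda>n. inverse (real (n - m n) / real n) * (real (n - m n) * (exp (- a / real (n - m n)) - 1)) = real n * (w n - 1)) sequentially"
      using eventually_greater[OF Nlim, of 0]
      by eventually_elim (simp add: w_def)
    ultimately show ?thesis using Lim_transform_eventually by force
  qed
  define D where "D n = \<bar>t\<bar> * \<bar>real n * e n\<bar> / (1 - q' n) + \<bar>t\<bar>^3 * B n / 6 * (real n * s n) / (1 - q' n)
      + \<bar>- (t\<^sup>2 / 2 * (real n * s n) / (1 - q' n)) - real n * (w n - 1)\<bar>" for n
  have "D \<longlonglongrightarrow> \<bar>t\<bar> * \<bar>0\<bar> / (1 - 0) + \<bar>t\<bar>^3 * 0 / 6 * v / (1 - 0) + \<bar>- (t\<^sup>2 / 2 * v / (1 - 0)) - (- a)\<bar>"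
    unfolding D_def using q mean v B wlim unfolding q'_def[symmetric] e_def[symmetric] s_def[symmetric]
    by (intro tendsto_intros) auto
  then have "D \<longlonglongrightarrow> 0" by (simp add: a_def)
  then have Dlim: "eventually (\<lambda>n. D n < \<delta>) sequentially" using \<delta> by (rule order_tendstoD(2))
  have est: "d n \<le> D n" if "q' n < 1" for n
  proof -
    define Q where "Q = 1 - q' n"
    have Q: "Q > 0" using that by (simp add: Q_def)
    define X where "X = (\<integral>\<omega>. iexp (t * f n (Y 0 \<omega>)) * of_bool (Y 0 \<omega> \<le> c n) \<partial>P)"
    have X: "norm (X - (of_real Q + \<i> * of_real (t * e n) - of_real (t\<^sup>2 / 2 * s n))) \<le> \<bar>t\<bar>^3 * B n / 6 * s n"
      using truncated_char_estimate[OF P Ym f bd sup, where t=t] by (simp add: X_def Q_def q'_def e_def s_def)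
    define R where "R = X - (of_real Q + \<i> * of_real (t * e n) - of_real (t\<^sup>2 / 2 * s n))"
    have "ch n - of_real (w n) = R / of_real Q + \<i> * of_real (t * e n / Q) + of_real (- (t\<^sup>2 / 2 * s n / Q) - (w n - 1))"
      using Q by (simp add: ch_def R_def X_def field_simps flip: Q_def)
    then have "norm (ch n - of_real (w n)) \<le> norm R / Q + \<bar>t * e n / Q\<bar> + \<bar>- (t\<^sup>2 / 2 * s n / Q) - (w n - 1)\<bar>"
      using Q norm_triangle_ineq[of "R / of_real Q + \<i> * of_real (t * e n / Q)" "of_real (- (t\<^sup>2 / 2 * s n / Q) - (w n - 1))"]
        norm_triangle_ineq[of "R / of_real Q" "\<i> * of_real (t * e n / Q)"]
      by (simp only: norm_mult norm_divide norm_of_real norm_ii)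
    also have "\<dots> \<le> \<bar>t\<bar>^3 * B n / 6 * s n / Q + \<bar>t * e n / Q\<bar> + \<bar>- (t\<^sup>2 / 2 * s n / Q) - (w n - 1)\<bar>"
      using X Q unfolding R_def[symmetric] by (intro add_right_mono divide_right_mono) auto
    finally have "d n \<le> real n * (\<bar>t\<bar>^3 * B n / 6 * s n / Q + \<bar>t * e n / Q\<bar> + \<bar>- (t\<^sup>2 / 2 * s n / Q) - (w n - 1)\<bar>)"
      unfolding d_def by (intro mult_left_mono) auto
    also have "\<dots> = \<bar>t\<bar>^3 * B n / 6 * (real n * s n) / Q + \<bar>t\<bar> * \<bar>real n * e n\<bar> / Q + \<bar>real n * (- (t\<^sup>2 / 2 * s n / Q) - (w n - 1))\<bar>"
      using Q by (simp add: distrib_left abs_mult mult_ac)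
    also have "real n * (- (t\<^sup>2 / 2 * s n / Q) - (w n - 1)) = - (t\<^sup>2 / 2 * (real n * s n) / Q) - real n * (w n - 1)"
      by (simp add: algebra_simps)
    finally show ?thesis by (simp add: D_def Q_def)
  qed
  show ?thesis using q1 m1 Dlim eventually_greater[OF Nlim, of 0]
  proof eventually_elim
    case (elim n)
    define pm where "pm = measure P {\<omega> \<in> space P. N n \<omega> = m n}"
    have q: "q' n < 1" using elim by simp
    have w1: "norm (complex_of_real (w n)) \<le> 1" using a0 by (simp add: w_def)
    have wN: "w n ^ (n - m n) = exp (- a)" 
      using elim(4) by (simp add: w_def flip: exp_of_nat_mult)
    have "norm (ch n ^ (n - m n) - of_real (w n) ^ (n - m n)) \<le> real (n - m n) * norm (ch n - of_real (w n))"
      by (rule norm_power_diff[OF ch1[OF q] w1])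
    also have "\<dots> \<le> d n" unfolding d_def by (intro mult_right_mono) auto
    also have "\<dots> \<le> \<delta>" using est[OF q] elim(3) by simp
    finally have "norm (ch n ^ (n - m n) - of_real (exp (- a))) \<le> \<delta>" by (simp flip: wN)
    then have "pm * norm (ch n ^ (n - m n) - of_real (exp (- a))) \<le> pm * \<delta>"
      by (intro mult_left_mono) (auto simp: pm_def)
    moreover have "norm (of_real pm * ch n ^ (n - m n) - of_real (pm * exp (- a))) = pm * norm (ch n ^ (n - m n) - of_real (exp (- a)))"
    proof -
      have "of_real pm * ch n ^ (n - m n) - of_real (pm * exp (- a)) = of_real pm * (ch n ^ (n - m n) - of_real (exp (- a)))"
        by (simp add: algebra_simps)
      then show ?thesis by (simp only: norm_mult norm_of_real) (simp add: pm_def)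
    qed
    ultimately show ?case unfolding eqp[OF q] by (simp add: pm_def a_def mult.commute)
  qed
qed

text \<open>The shape in which the integrated tail error enters: it is at most \<open>\<delta> / sqrt k\<close> for every \<open>\<delta>\<close>,
eventually.\<close>

lemma tendsto_0_if_le_add:
  fixes a g :: "nat \<Rightarrow> real"
  assumes "\<And>\<delta>. \<delta> > 0 \<Longrightarrow> eventually (\<lambda>n. \<bar>a n\<bar> \<le> \<delta> * h n + g n) sequentially"
    and g: "g \<longlonglongrightarrow> 0" and h: "h \<longlonglongrightarrow> l"
  shows "a \<longlonglongrightarrow> 0"
proof (rule tendstoI)
  fix e :: real assume e: "e > 0"
  have p: "e / (2 * (\<bar>l\<bar> + 1)) > 0" using e by simp
  have "eventually (\<lambda>n. g n < e / 2) sequentially" using g e by (intro order_tendstoD(2)) auto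
  moreover have "eventually (\<lambda>n. h n < \<bar>l\<bar> + 1) sequentially" using h by (intro order_tendstoD(2)[where y=l]) auto
  ultimately show "eventually (\<lambda>n. dist (a n) 0 < e) sequentially"
    using assms(1)[OF p]
  proof eventually_elim
    case (elim n)
    have "e / (2 * (\<bar>l\<bar> + 1)) * h n \<le> e / (2 * (\<bar>l\<bar> + 1)) * (\<bar>l\<bar> + 1)" using elim p by (intro mult_left_mono) auto
    also have "\<dots> = e / 2" by (simp add: field_simps)
    finally show ?case using elim unfolding dist_real_def by linarith
  qed
qed

lemma norm_iexp_diff: "norm (iexp x - iexp y) \<le> \<bar>x - y\<bar>"
proof -
  have "iexp x - iexp y = iexp y * (iexp (x - y) - 1)"
    by (simp add: algebra_simps flip: exp_add)
  then have "norm (iexp x - iexp y) = norm (iexp (x - y) - 1)" by (simp add: norm_mult)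
  also have "\<dots> \<le> \<bar>x - y\<bar>" using iexp_approx1[of "x - y" 0] by simp
  finally show ?thesis .
qed

section \<open>Consequences of the tail assumptions\<close>

text \<open>The assumptions on a single variable; the replacement variables \<open>L\<close> enter only with the truncated
sample.\<close>

locale tail_asymptotics =
  fixes P :: "'a measure" and Y :: "'a \<Rightarrow> real" and M :: "nat \<Rightarrow> real" and \<alpha> \<beta> \<gamma> :: real
  assumes prob: "prob_space P" and Y: "Y \<in> borel_measurable P"
    and \<alpha>: "\<alpha> > 0" and rv: "regularly_varying_at_top (tail P Y) (-\<alpha>)"
    and M_pos: "\<And>n. M n > 0" and M_lim: "filterlim M at_top sequentially"
    and \<beta>: "0 < \<beta>" "\<beta> < 1" and \<gamma>: "0 < \<gamma>" "\<gamma> < 1"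
    and B: "assumption_B P Y M" and C: "assumption_C P Y M \<beta>"
    and D: "assumption_D P Y M \<alpha> \<beta> \<gamma>" and E: "assumption_E P Y M \<alpha> \<beta> \<gamma>"
begin

abbreviation F where "F \<equiv> tail P Y"
definition p where "p n = F (M n)"
definition q where "q n = F (\<gamma> * M n)"
definition c where "c n = \<gamma> * M n"

lemma F_mono: "s \<le> t \<Longrightarrow> F t \<le> F s"
  by (rule tail_antimono[OF prob Y])

lemma F_pos: "F x > 0"
proof -
  have "eventually (\<lambda>x. F x > 0) at_top" using rv by (simp add: regularly_varying_at_top_def)
  then obtain z where z: "\<And>y. y \<ge> z \<Longrightarrow> F y > 0" by (auto simp: eventually_at_top_linorder)
  show ?thesis using z[of "max x z"] F_mono[of x "max x z"] by simp
qed

lemma F_tendsto_0: "(F \<longlongrightarrow> 0) at_top"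
proof -
  interpret prob_space P by (rule prob)
  note [measurable] = Y
  interpret D: real_distribution "distr P borel Y" by (rule real_distribution_distr) measurable
  have "F = (\<lambda>x. 1 - cdf (distr P borel Y) x)"
  proof
    fix x
    have "cdf (distr P borel Y) x = prob {\<omega> \<in> space P. Y \<omega> \<le> x}"
      unfolding cdf_def by (subst measure_distr) (auto intro!: arg_cong[where f=prob])
    moreover have "{\<omega> \<in> space P. Y \<omega> > x} = space P - {\<omega> \<in> space P. Y \<omega> \<le> x}" by auto
    ultimately show "F x = 1 - cdf (distr P borel Y) x" unfolding tail_def by (simp add: prob_compl)
  qed
  moreover have "((\<lambda>x. 1 - cdf (distr P borel Y) x) \<longlongrightarrow> 1 - 1) at_top"
    by (intro tendsto_diff tendsto_const D.cdf_lim_at_top_prob)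
  ultimately show ?thesis by simp
qed

lemma p_pos: "p n > 0" and q_pos: "q n > 0"
  by (simp_all add: p_def q_def F_pos)

lemma \<gamma>M_lim: "filterlim (\<lambda>n. \<gamma> * M n) at_top sequentially"
  by (rule filterlim_tendsto_pos_mult_at_top[OF tendsto_const \<gamma>(1) M_lim])

lemma q_lim: "q \<longlonglongrightarrow> 0"
  unfolding q_def using F_tendsto_0 \<gamma>M_lim by (rule filterlim_compose)

lemma q_over_p: "(\<lambda>n. q n / p n) \<longlonglongrightarrow> \<gamma> powr (-\<alpha>)"
proof -
  have "((\<lambda>x. F (\<gamma> * x) / F x) \<longlongrightarrow> \<gamma> powr (-\<alpha>)) at_top" 
    using rv \<gamma> by (simp add: regularly_varying_at_top_def)
  from filterlim_compose[OF this M_lim] show ?thesis by (simp add: p_def q_def)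
qed

lemma np_lim: "filterlim (\<lambda>n. real n * p n) at_top sequentially"
  using B by (simp add: assumption_B_def p_def)

lemma nq_lim: "filterlim (\<lambda>n. real n * q n) at_top sequentially"
proof -
  have "filterlim (\<lambda>n. q n / p n * (real n * p n)) at_top sequentially"
    by (rule filterlim_tendsto_pos_mult_at_top[OF q_over_p _ np_lim]) (use \<gamma> in auto)
  moreover have "q n / p n * (real n * p n) = real n * q n" for n using p_pos[of n] by simp
  ultimately show ?thesis by simp
qed

lemma nqb_lim: "filterlim (\<lambda>n. real n * q n powr \<beta>) at_top sequentially"
proof (rule filterlim_at_top_mono[OF nq_lim])
  show "eventually (\<lambda>n. real n * q n \<le> real n * q n powr \<beta>) sequentially"
  proof (rule always_eventually, rule allI)
    fix n
    have "q n \<le> 1" unfolding q_def by (rule tail_le_1[OF prob])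
    then have "q n powr 1 \<le> q n powr \<beta>" using q_pos[of n] \<beta> by (intro powr_mono') auto
    then show "real n * q n \<le> real n * q n powr \<beta>" using q_pos[of n] by (simp add: mult_left_mono)
  qed
qed

lemma n_pos: "eventually (\<lambda>n. n > (0::nat)) sequentially"
  by (rule eventually_gt_at_top)

lemma C_q: "(\<lambda>n. real n * q n powr (2 - \<beta>) * (ln (M n))\<^sup>2) \<longlonglongrightarrow> 0"
proof -
  have "(\<lambda>n. real n * p n powr (2 - \<beta>) * (ln (M n))\<^sup>2 * (q n / p n) powr (2 - \<beta>)) \<longlonglongrightarrow> 
     0 * (\<gamma> powr (-\<alpha>)) powr (2 - \<beta>)"
    using C \<gamma> unfolding assumption_C_def p_def[symmetric]
    by (intro tendsto_mult tendsto_powr q_over_p tendsto_const) auto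
  moreover have "real n * p n powr (2 - \<beta>) * (ln (M n))\<^sup>2 * (q n / p n) powr (2 - \<beta>) =
      real n * q n powr (2 - \<beta>) * (ln (M n))\<^sup>2" for n
    using p_pos[of n] q_pos[of n] by (simp add: powr_divide)
  ultimately show ?thesis by simp
qed

lemma ln_M_lim: "filterlim (\<lambda>n. ln (M n)) at_top sequentially"
  by (rule filterlim_compose[OF ln_at_top M_lim])

end

text \<open>The assumptions on the tail are made for all sequences of the order of \<open>n q powr \<beta>\<close>. This
freedom is what allows \<open>k\<close> to depend on the number of exceedances on which one conditions.\<close>

locale intermediate_sequence = tail_asymptotics +
  fixes k :: "nat \<Rightarrow> nat"
  assumes k: "(\<lambda>n. real (k n) / (real n * q n powr \<beta>)) \<longlonglongrightarrow> 1"
begin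

definition u where "u n = tail_quantile P Y (real n / real (k n))"
abbreviation r where "r n \<equiv> sqrt (real (k n))"

lemma k_asymp: "(\<lambda>n. real (k n)) \<sim>[sequentially] (\<lambda>n. real n * tail P Y (\<gamma> * M n) powr \<beta>)"
  using k unfolding q_def by (rule asymp_equivI')

lemma k_lim: "filterlim (\<lambda>n. real (k n)) at_top sequentially"
proof -
  have "filterlim (\<lambda>n. real (k n) / (real n * q n powr \<beta>) * (real n * q n powr \<beta>)) at_top sequentially"
    by (rule filterlim_tendsto_pos_mult_at_top[OF k _ nqb_lim]) simp
  moreover have "eventually (\<lambda>n. real (k n) / (real n * q n powr \<beta>) * (real n * q n powr \<beta>) = real (k n)) sequentially"
    using n_pos
  proof eventually_elim
    case (elim n)
    have "real n * q n powr \<beta> > 0" using elim q_pos[of n] by simp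
    then have "real n * q n powr \<beta> \<noteq> 0" by linarith
    then show ?case by (metis nonzero_eq_divide_eq)
  qed
  ultimately show ?thesis by (rule filterlim_cong[THEN iffD1, OF refl refl, rotated])
qed

lemma r_lim: "filterlim r at_top sequentially"
  by (rule filterlim_compose[OF sqrt_at_top k_lim])

lemma k_pos: "eventually (\<lambda>n. k n > 0) sequentially"
  using eventually_greater[OF k_lim, of 0] by (simp add: eventually_mono)

lemma k_over_n: "(\<lambda>n. real (k n) / real n) \<longlonglongrightarrow> 0"
proof -
  have "(\<lambda>n. real (k n) / (real n * q n powr \<beta>) * q n powr \<beta>) \<longlonglongrightarrow> 1 * 0 powr \<beta>"
    using \<beta> q_pos by (intro tendsto_mult k tendsto_powr' q_lim tendsto_const) (auto simp: less_imp_le)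
  moreover have "real (k n) / (real n * q n powr \<beta>) * q n powr \<beta> = real (k n) / real n" for n
    using q_pos[of n] by simp
  ultimately show ?thesis by simp
qed

text \<open>This is where the logarithm in \<open>assumption_C\<close> is used: the \<open>O(n q)\<close> observations above \<open>\<gamma> M\<close>
contribute at most \<open>O(ln M)\<close> each to a sum that is of order \<open>sqrt k\<close>.\<close>

lemma nq_ln_over_r: "(\<lambda>n. real n * q n * ln (M n) / r n) \<longlonglongrightarrow> 0"
proof -
  have "(\<lambda>n. real n * q n powr (2 - \<beta>) * (ln (M n))\<^sup>2 * (inverse (real (k n) / (real n * q n powr \<beta>)))) \<longlonglongrightarrow> 0 * inverse 1"
    by (intro tendsto_mult C_q tendsto_inverse k) simp
  then have "(\<lambda>n. sqrt (real n * q n powr (2 - \<beta>) * (ln (M n))\<^sup>2 * (inverse (real (k n) / (real n * q n powr \<beta>))))) \<longlonglongrightarrow> sqrt 0"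
    by (intro tendsto_real_sqrt) simp
  moreover have "eventually (\<lambda>n. sqrt (real n * q n powr (2 - \<beta>) * (ln (M n))\<^sup>2 * (inverse (real (k n) / (real n * q n powr \<beta>))))
      = real n * q n * ln (M n) / r n) sequentially"
    using n_pos k_pos eventually_greater[OF ln_M_lim, of 0]
  proof eventually_elim
    case (elim n)
    have "q n powr (2 - \<beta>) * q n powr \<beta> = (q n)\<^sup>2" using q_pos[of n] by (simp flip: powr_add)
    then have "real n * q n powr (2 - \<beta>) * (ln (M n))\<^sup>2 * (inverse (real (k n) / (real n * q n powr \<beta>))) =
       (real n * q n * ln (M n))\<^sup>2 / real (k n)"
      by (simp add: power_mult_distrib field_simps power2_eq_square)
    moreover have "real n * q n * ln (M n) \<ge> 0" using elim q_pos[of n] by simp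
    ultimately show ?case by (simp only: real_sqrt_divide real_sqrt_abs abs_of_nonneg)
  qed
  ultimately have "(\<lambda>n. real n * q n * ln (M n) / r n) \<longlonglongrightarrow> sqrt 0" by (rule Lim_transform_eventually)
  then show ?thesis by simp
qed

lemma nq_over_r: "(\<lambda>n. real n * q n / r n) \<longlonglongrightarrow> 0"
proof (rule tendsto_sandwich[OF _ _ tendsto_const nq_ln_over_r])
  show "eventually (\<lambda>n. 0 \<le> real n * q n / r n) sequentially" using q_pos by (simp add: less_imp_le)
  show "eventually (\<lambda>n. real n * q n / r n \<le> real n * q n * ln (M n) / r n) sequentially"
    using eventually_greater[OF ln_M_lim, of 1]
  proof eventually_elim
    case (elim n)
    have "real n * q n * 1 \<le> real n * q n * ln (M n)" using elim q_pos[of n] by (intro mult_left_mono) auto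
    then show ?case by (simp add: divide_right_mono)
  qed
qed

text \<open>The score of a single observation is small against \<open>sqrt k\<close>, since \<open>n q \<ge> 1\<close> eventually. This yields
both the Lindeberg condition and the negligible error in the second moment.\<close>

lemma ln_M_over_r: "(\<lambda>n. ln (M n) / r n) \<longlonglongrightarrow> 0"
proof (rule tendsto_sandwich[OF _ _ tendsto_const nq_ln_over_r])
  show "eventually (\<lambda>n. 0 \<le> ln (M n) / r n) sequentially" 
    using eventually_greater[OF ln_M_lim, of 0] by eventually_elim simp
  show "eventually (\<lambda>n. ln (M n) / r n \<le> real n * q n * ln (M n) / r n) sequentially"
    using eventually_greater[OF ln_M_lim, of 0]
      eventually_greater[OF nq_lim, of 1]
  proof eventually_elim
    case (elim n)
    have "1 * ln (M n) \<le> real n * q n * ln (M n)" using elim q_pos[of n] by (intro mult_right_mono) auto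
    then show ?case by (simp add: divide_right_mono)
  qed
qed

lemma D_uniform:
  assumes "\<delta> > 0"
  shows "eventually (\<lambda>n. \<forall>y. 0 < y \<and> y \<le> 2 \<longrightarrow> 
    \<bar>real n * F (u n * y powr (-1/\<alpha>)) - real (k n) * y\<bar> \<le> \<delta> * r n) sequentially"
proof -
  have "uniform_limit {0..2} (\<lambda>n y. r n * (real n / real (k n) *
                   (if y = 0 then 0 else F (u n * y powr (-1 / \<alpha>))) - y)) (\<lambda>y. 0) sequentially"
    using D k_asymp unfolding assumption_D_def u_def by auto
  from uniform_limitD[OF this assms] k_pos show ?thesis
  proof eventually_elim
    case (elim n)
    show ?case
    proof (intro allI impI)
      fix y :: real assume y: "0 < y \<and> y \<le> 2"
      define z where "z = F (u n * y powr (-1 / \<alpha>))"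
      have "\<bar>r n * (real n / real (k n) * z - y)\<bar> < \<delta>"
        using elim(1)[rule_format, of y] y by (simp add: dist_real_def z_def)
      moreover have "real n * z - real (k n) * y = r n * (real n / real (k n) * z - y) * r n"
        using elim(2) by (simp add: field_simps)
      ultimately show "\<bar>real n * z - real (k n) * y\<bar> \<le> \<delta> * r n"
        by (simp add: abs_mult mult_right_mono)
    qed
  qed
qed

text \<open>The level \<open>u exp (y / r)\<close> corresponds to the argument \<open>exp (- \<alpha> y / r)\<close> in the uniform expansion of
the tail, which lies in \<open>{0<..2}\<close> eventually.\<close>

lemma F_local: "(\<lambda>n. (real n * F (u n * exp (y / r n)) - real (k n)) / r n) \<longlonglongrightarrow> - \<alpha> * y"
proof -
  define z where "z = (\<lambda>n. exp (- \<alpha> * y / r n))"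
  have "(\<lambda>n. - \<alpha> * y / r n) \<longlonglongrightarrow> 0"
    by (rule real_tendsto_divide_at_top[OF tendsto_const r_lim])
  then have "z \<longlonglongrightarrow> exp 0" unfolding z_def by (intro tendsto_exp)
  then have z2: "eventually (\<lambda>n. z n < 2) sequentially" by (intro order_tendstoD) auto
  have zp: "z n powr (-1/\<alpha>) = exp (y / r n)" for n
    using \<alpha> by (simp add: z_def powr_def field_simps)
  have "(\<lambda>n. (real n * F (u n * exp (y / r n)) - real (k n) * z n) / r n) \<longlonglongrightarrow> 0"
  proof (rule LIMSEQ_I)
    fix e :: real assume e: "e > 0"
    have "eventually (\<lambda>n. norm ((real n * F (u n * exp (y / r n)) - real (k n) * z n) / r n - 0) < e) sequentially"
      using D_uniform[OF half_gt_zero[OF e]] z2 k_pos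
    proof eventually_elim
      case (elim n)
      have "\<bar>real n * F (u n * exp (y / r n)) - real (k n) * z n\<bar> \<le> e/2 * r n"
        using elim(1)[rule_format, of "z n"] elim(2) unfolding zp by (simp add: z_def)
      also have "\<dots> < e * r n" using e elim(3) by simp
      finally show ?case using elim(3) by (simp add: pos_divide_less_eq)
    qed
    then show "\<exists>no. \<forall>n\<ge>no. norm ((real n * F (u n * exp (y / r n)) - real (k n) * z n) / r n - 0) < e"
      by (simp add: eventually_sequentially)
  qed
  from tendsto_add[OF this exp_scale_limit[OF r_lim, of "- \<alpha> * y"]]
  have "(\<lambda>n. (real n * F (u n * exp (y / r n)) - real (k n) * z n) / r n + r n * (z n - 1)) \<longlonglongrightarrow> - \<alpha> * y"
    by (simp add: z_def)
  moreover have "eventually (\<lambda>n. (real n * F (u n * exp (y / r n)) - real (k n) * z n) / r n + r n * (z n - 1)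
     = (real n * F (u n * exp (y / r n)) - real (k n)) / r n) sequentially"
    using k_pos
  proof eventually_elim
    case (elim n)
    have "real (k n) / r n = r n" using elim by (simp add: real_div_sqrt)
    then show ?case by (simp add: diff_divide_distrib algebra_simps flip: times_divide_eq_right)
  qed
  ultimately show ?thesis by (rule Lim_transform_eventually)
qed

lemma F_u: "(\<lambda>n. (real n * F (u n) - real (k n)) / r n) \<longlonglongrightarrow> 0"
  using F_local[of 0] by simp

lemma F_u_ratio: "(\<lambda>n. real n * F (u n) / real (k n)) \<longlonglongrightarrow> 1"
proof -
  have "(\<lambda>n. (real n * F (u n) - real (k n)) / r n / r n) \<longlonglongrightarrow> 0"
    by (rule real_tendsto_divide_at_top[OF F_u r_lim])
  from tendsto_add[OF this tendsto_const[of 1]]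
  have "(\<lambda>n. (real n * F (u n) - real (k n)) / r n / r n + 1) \<longlonglongrightarrow> 1" by simp
  moreover have "eventually (\<lambda>n. (real n * F (u n) - real (k n)) / r n / r n + 1 = real n * F (u n) / real (k n)) sequentially"
    using k_pos by eventually_elim (simp add: field_simps)
  ultimately show ?thesis by (rule Lim_transform_eventually)
qed

text \<open>As \<open>n F(u) / k \<longlongrightarrow> 1\<close> and \<open>k / n \<longlongrightarrow> 0\<close>, the tail at \<open>u\<close> vanishes, and it is positive at every fixed level.\<close>

lemma u_lim: "filterlim u at_top sequentially"
  unfolding filterlim_at_top
proof
  fix Z :: real
  have "(\<lambda>n. real n * F (u n) / real (k n) * (real (k n) / real n)) \<longlonglongrightarrow> 1 * 0"
    by (intro tendsto_mult F_u_ratio k_over_n)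
  then have "eventually (\<lambda>n. real n * F (u n) / real (k n) * (real (k n) / real n) < F Z) sequentially"
    using F_pos[of Z] by (intro order_tendstoD(2)) auto
  then show "eventually (\<lambda>n. Z \<le> u n) sequentially"
    using k_pos n_pos
  proof eventually_elim
    case (elim n)
    then have "F (u n) < F Z" by simp
    then show ?case using F_mono[of "u n" Z] by linarith
  qed
qed

lemma u_less: "eventually (\<lambda>n. u n < \<gamma> * M n) sequentially"
proof -
  have "(\<lambda>n. real n * q n / r n / r n) \<longlonglongrightarrow> 0"
    by (rule real_tendsto_divide_at_top[OF nq_over_r r_lim])
  from tendsto_diff[OF F_u_ratio this]
  have "eventually (\<lambda>n. real n * F (u n) / real (k n) - real n * q n / r n / r n > 0) sequentially"
    by (intro order_tendstoD(1)) auto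
  then show ?thesis using k_pos n_pos
  proof eventually_elim
    case (elim n)
    have "real n * q n / r n / r n = real n * q n / real (k n)" by simp
    then have "real n * q n / real (k n) < real n * F (u n) / real (k n)" using elim(1) by linarith
    then have "F (\<gamma> * M n) < F (u n)" using elim by (simp add: q_def field_simps)
    then show ?case using F_mono[of "\<gamma> * M n" "u n"] by linarith
  qed
qed

definition b where "b n = \<gamma> * M n / u n"

lemma eventually_window:
  "eventually (\<lambda>n. 1 \<le> u n \<and> u n < \<gamma> * M n \<and> u n * b n = \<gamma> * M n \<and> 1 < b n \<and> b n \<le> M n \<and> 1 \<le> ln (M n)
      \<and> 0 < k n \<and> 0 < n) sequentially"
  using u_less k_pos n_pos filterlim_at_top[THEN iffD1, rule_format, OF u_lim, of 1]
    filterlim_at_top[THEN iffD1, rule_format, OF ln_M_lim, of 1]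
proof eventually_elim
  case (elim n)
  have "\<gamma> * M n / u n \<le> \<gamma> * M n / 1" using elim \<gamma> M_pos[of n] by (intro divide_left_mono) auto
  also have "\<dots> \<le> M n" using \<gamma> M_pos[of n] by simp
  finally show ?case using elim by (simp add: b_def field_simps)
qed

text \<open>The uniform expansion of the tail at the argument \<open>b powr (- \<alpha>)\<close>, which belongs to the level \<open>\<gamma> M\<close>;
uniformity down to \<open>0\<close> is essential, since this argument tends to \<open>0\<close>.\<close>

lemma b_powr: "(\<lambda>n. r n * b n powr (-\<alpha>)) \<longlonglongrightarrow> 0"
proof (rule LIMSEQ_I)
  fix e :: real assume e: "e > 0"
  have "eventually (\<lambda>n. real n * q n / r n < e/2) sequentially"
    using nq_over_r e by (intro order_tendstoD(2)) auto
  then have "eventually (\<lambda>n. norm (r n * b n powr (-\<alpha>) - 0) < e) sequentially"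
    using D_uniform[OF half_gt_zero[OF e]] eventually_window
  proof eventually_elim
    case (elim n)
    define y where "y = b n powr (-\<alpha>)"
    have b: "b n > 1" using elim by simp
    have y: "0 < y" "y \<le> 2" using powr_mono[of "-\<alpha>" 0 "b n"] b \<alpha> by (auto simp: y_def)
    have "y powr (-1/\<alpha>) = b n" using b \<alpha> by (simp add: y_def powr_powr)
    then have "\<bar>real n * q n - real (k n) * y\<bar> \<le> e/2 * r n"
      using elim(2)[rule_format, of y] y elim(3) by (simp add: q_def)
    moreover have "real n * q n < e/2 * r n" using elim by (simp add: pos_divide_less_eq)
    ultimately have "real (k n) * y < e * r n" unfolding abs_le_iff by argo
    moreover have "real (k n) = r n * r n" by simp
    ultimately have "r n * (r n * y) < r n * e" by (simp add: mult_ac)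
    moreover have "r n > 0" using elim by simp
    ultimately have "r n * y < e" by (metis mult_less_cancel_left_pos)
    then show ?case using y by (simp add: y_def abs_mult)
  qed
  then show "\<exists>no. \<forall>n\<ge>no. norm (r n * b n powr (-\<alpha>) - 0) < e" by (simp add: eventually_sequentially)
qed

text \<open>The uniform expansion controls a bounded range of \<open>s\<close>, the integral assumption controls the rest.\<close>

lemma tail_integral:
  assumes d: "\<delta> > 0"
  shows "eventually (\<lambda>n. (\<integral>\<^sup>+ s \<in> {1<..}. ennreal (\<bar>real n / real (k n) * F (u n * s) - s powr (-\<alpha>)\<bar> / s) \<partial>lborel)
     \<le> ennreal (\<delta> / r n)) sequentially"
proof -
  have [measurable]: "F \<in> borel_measurable borel" by (rule tail_measurable[OF prob Y])
  define h where "h n s = ennreal (\<bar>real n / real (k n) * F (u n * s) - s powr (-\<alpha>)\<bar> / s)" for n s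
  have [measurable]: "h n \<in> borel_measurable borel" for n unfolding h_def by measurable
  have "((\<lambda>T :: real. limsup (\<lambda>n. ennreal (r n) * (\<integral>\<^sup>+ s \<in> {T<..}. h n s \<partial>lborel))) \<longlongrightarrow> 0) at_top"
    using E k_asymp unfolding assumption_E_def u_def h_def by blast
  then have "eventually (\<lambda>T. limsup (\<lambda>n. ennreal (r n) * (\<integral>\<^sup>+ s \<in> {T<..}. h n s \<partial>lborel)) < ennreal (\<delta>/2)) at_top"
    using d by (intro order_tendstoD(2)) (auto simp: ennreal_zero_less_divide)
  then have "eventually (\<lambda>T. limsup (\<lambda>n. ennreal (r n) * (\<integral>\<^sup>+ s \<in> {T<..}. h n s \<partial>lborel)) < ennreal (\<delta>/2) \<and> T > 1) at_top"
    using eventually_gt_at_top by (rule eventually_conj)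
  then obtain T where T: "T > 1" and lim: "limsup (\<lambda>n. ennreal (r n) * (\<integral>\<^sup>+ s \<in> {T<..}. h n s \<partial>lborel)) < ennreal (\<delta>/2)"
    by (auto dest: eventually_happens)
  from Limsup_lessD[OF lim]
  have "eventually (\<lambda>n. ennreal (r n) * (\<integral>\<^sup>+ s \<in> {T<..}. h n s \<partial>lborel) < ennreal (\<delta>/2)) sequentially" .
  moreover have "\<delta> / (2 * T) > 0" using d T by simp
  note D_uniform[OF this]
  ultimately show ?thesis unfolding h_def[symmetric] using k_pos
  proof eventually_elim
    case (elim n)
    have rp: "r n > 0" using elim by simp
    have far: "(\<integral>\<^sup>+ s \<in> {T<..}. h n s \<partial>lborel) \<le> ennreal (\<delta> / 2 / r n)"
    proof -
      have "ennreal (inverse (r n)) * (ennreal (r n) * (\<integral>\<^sup>+ s \<in> {T<..}. h n s \<partial>lborel)) \<le> ennreal (inverse (r n)) * ennreal (\<delta>/2)"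
        using elim(1) by (intro mult_left_mono) auto
      then show ?thesis
      proof -
        assume le: "ennreal (inverse (r n)) * (ennreal (r n) * (\<integral>\<^sup>+ s \<in> {T<..}. h n s \<partial>lborel)) \<le> ennreal (inverse (r n)) * ennreal (\<delta>/2)"
        have "ennreal (inverse (r n)) * ennreal (r n) = ennreal (inverse (r n) * r n)" using rp by (intro ennreal_mult[symmetric]) auto
        then have a: "ennreal (inverse (r n)) * ennreal (r n) = 1" using rp by simp
        have b: "ennreal (inverse (r n)) * ennreal (\<delta>/2) = ennreal (inverse (r n) * (\<delta>/2))" using rp d by (intro ennreal_mult[symmetric]) auto
        show ?thesis using le unfolding mult.assoc[symmetric] a b by (simp only: mult_1_left divide_inverse mult.commute)
      qed
    qed
    have near: "(\<integral>\<^sup>+ s \<in> {1<..T}. h n s \<partial>lborel) \<le> ennreal (\<delta> / 2 / r n)"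
    proof -
      have "(\<integral>\<^sup>+ s \<in> {1<..T}. h n s \<partial>lborel) \<le> (\<integral>\<^sup>+ s. ennreal (\<delta> / (2 * T) / r n) * indicator {1<..T} s \<partial>lborel)"
      proof (rule nn_integral_mono)
        fix s
        show "h n s * indicator {1<..T} s \<le> ennreal (\<delta> / (2 * T) / r n) * indicator {1<..T} s"
        proof (cases "s \<in> {1<..T}")
          case True
          define y where "y = s powr (-\<alpha>)"
          have s: "s > 1" using True by simp
          have y: "0 < y" "y \<le> 2" using powr_mono[of "-\<alpha>" 0 s] s \<alpha> by (auto simp: y_def)
          have "y powr (-1/\<alpha>) = s" using s \<alpha> by (simp add: y_def powr_powr)
          then have l: "\<bar>real n * F (u n * s) - real (k n) * y\<bar> \<le> \<delta> / (2 * T) * r n"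
            using elim(2)[rule_format, of y] y by simp
          have kr: "real (k n) = r n * r n" by simp
          have "real n / real (k n) * F (u n * s) - y = (real n * F (u n * s) - real (k n) * y) / real (k n)"
            using elim(3) by (simp add: field_simps)
          then have "\<bar>real n / real (k n) * F (u n * s) - y\<bar> = \<bar>real n * F (u n * s) - real (k n) * y\<bar> / real (k n)"
            by simp
          also have "\<dots> \<le> \<delta> / (2 * T) * r n / real (k n)" using l by (intro divide_right_mono) auto
          also have "\<dots> = \<delta> / (2 * T) / r n" 
          proof -
            have "a * x / (x * x) = a / x" if "x > 0" for a x :: real using that by simp
            from this[OF rp] show ?thesis unfolding kr[symmetric] .
          qed
          finally have a: "\<bar>real n / real (k n) * F (u n * s) - y\<bar> \<le> \<delta> / (2 * T) / r n" .
          have "\<bar>real n / real (k n) * F (u n * s) - y\<bar> / s \<le> \<bar>real n / real (k n) * F (u n * s) - y\<bar> / 1"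
            using s by (intro divide_left_mono) auto
          then show ?thesis using True a unfolding h_def y_def by (auto intro!: ennreal_leI)
        qed simp
      qed
      also have "\<dots> = ennreal (\<delta> / (2 * T) / r n) * ennreal (T - 1)"
        using T by (subst nn_integral_cmult_indicator) auto
      also have "\<dots> = ennreal (\<delta> / (2 * T) / r n * (T - 1))" using T d rp by (intro ennreal_mult[symmetric]) auto
      also have "\<dots> \<le> ennreal (\<delta> / 2 / r n)"
      proof (rule ennreal_leI)
        have "\<delta> / (2 * T) / r n * (T - 1) \<le> \<delta> / (2 * T) / r n * T" using d T rp by (intro mult_left_mono) auto
        then show "\<delta> / (2 * T) / r n * (T - 1) \<le> \<delta> / 2 / r n" using T by simp
      qed
      finally show ?thesis .
    qed
    have "(\<integral>\<^sup>+ s \<in> {1<..}. h n s \<partial>lborel) = (\<integral>\<^sup>+ s \<in> {1<..T}. h n s \<partial>lborel) + (\<integral>\<^sup>+ s \<in> {T<..}. h n s \<partial>lborel)"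
    proof -
      have eq: "{1<..} = {1<..T} \<union> {T<..}" using T by auto
      show ?thesis unfolding eq
      proof (rule nn_integral_disjoint_pair)
        show "h n \<in> borel_measurable lborel" by measurable
      qed auto
    qed
    also have "\<dots> \<le> ennreal (\<delta> / 2 / r n) + ennreal (\<delta> / 2 / r n)" by (intro add_mono near far)
    also have "\<dots> = ennreal (\<delta> / r n)" using d rp by (simp flip: ennreal_plus)
    finally show ?case .
  qed
qed

end

section \<open>Score and counting functions at an intermediate threshold\<close>

context intermediate_sequence
begin

definition E0 where "E0 n = (\<integral>\<omega>. of_bool (u n < Y \<omega> \<and> Y \<omega> \<le> c n) \<partial>P)"
definition E1 where "E1 n = (\<integral>\<omega>. of_bool (u n < Y \<omega> \<and> Y \<omega> \<le> c n) * ln (Y \<omega> / u n) \<partial>P)"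
definition E2 where "E2 n = (\<integral>\<omega>. of_bool (u n < Y \<omega> \<and> Y \<omega> \<le> c n) * (ln (Y \<omega> / u n))\<^sup>2 \<partial>P)"

lemma c_le_M: "c n \<le> M n"
  using \<gamma> M_pos[of n] mult_right_mono[of \<gamma> 1 "M n"] by (simp add: c_def)

lemma prob_between: "s \<le> t \<Longrightarrow> (\<integral>\<omega>. of_bool (s < Y \<omega> \<and> Y \<omega> \<le> t) \<partial>P) = F s - F t"
proof -
  interpret prob_space P by (rule prob)
  note [measurable] = Y
  assume "s \<le> t"
  then show ?thesis using tail_diff[OF prob Y, of s t] 
    by (subst integral_of_bool) (auto simp: finite_measure_axioms)
qed

lemma E0_lim: "(\<lambda>n. real n * E0 n / r n - r n) \<longlonglongrightarrow> 0"
proof -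
  have "(\<lambda>n. (real n * F (u n) - real (k n)) / r n - real n * q n / r n) \<longlonglongrightarrow> 0 - 0"
    by (intro tendsto_diff F_u nq_over_r)
  moreover have "eventually (\<lambda>n. (real n * F (u n) - real (k n)) / r n - real n * q n / r n = real n * E0 n / r n - r n) sequentially"
    using eventually_window
  proof eventually_elim
    case (elim n)
    then have "E0 n = F (u n) - q n" unfolding E0_def q_def c_def by (intro prob_between) simp
    moreover have "real (k n) / r n = r n" using elim by (simp add: real_div_sqrt)
    ultimately show ?case by (simp add: diff_divide_distrib right_diff_distrib)
  qed
  ultimately show ?thesis using Lim_transform_eventually by force
qed

lemma E1_lim: "(\<lambda>n. r n * (real n / real (k n) * E1 n - 1 / \<alpha>)) \<longlonglongrightarrow> 0"
proof (rule tendsto_0_if_le_add)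
  have "(\<lambda>n. r n * b n powr (-\<alpha>) / \<alpha> + real n * q n * ln (M n) / r n) \<longlonglongrightarrow> 0 / \<alpha> + 0"
    using \<alpha> by (intro tendsto_add tendsto_divide b_powr tendsto_const nq_ln_over_r) auto
  then show "(\<lambda>n. r n * b n powr (-\<alpha>) / \<alpha> + real n * q n * ln (M n) / r n) \<longlonglongrightarrow> 0" by simp
  fix \<delta> :: real assume \<delta>: "\<delta> > 0"
  show "eventually (\<lambda>n. \<bar>r n * (real n / real (k n) * E1 n - 1 / \<alpha>)\<bar> \<le> \<delta> * 1 + (r n * b n powr (-\<alpha>) / \<alpha> + real n * q n * ln (M n) / r n)) sequentially"
    using eventually_window tail_integral[OF \<delta>]
  proof eventually_elim
    case (elim n)
    have rp: "r n > 0" using elim by simp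
    have c: "c n = u n * b n" using elim by (simp add: c_def)
    have le: "\<bar>real n / real (k n) * E1 n - 1 / \<alpha>\<bar> \<le> \<delta> / r n + b n powr (-\<alpha>) / \<alpha> + real n / real (k n) * F (u n * b n) * ln (b n)"
      unfolding E1_def c
      by (rule truncated_log_moment[OF prob Y _ _ \<alpha> _ _ elim(2)]) (use elim \<delta> in auto)
    have "\<bar>r n * (real n / real (k n) * E1 n - 1 / \<alpha>)\<bar> = r n * \<bar>real n / real (k n) * E1 n - 1 / \<alpha>\<bar>"
      using rp by (simp add: abs_mult)
    also have "\<dots> \<le> r n * (\<delta> / r n + b n powr (-\<alpha>) / \<alpha> + real n / real (k n) * F (u n * b n) * ln (b n))"
      using le rp by (intro mult_left_mono) auto
    also have "\<dots> = \<delta> + r n * b n powr (-\<alpha>) / \<alpha> + real n * q n * ln (b n) * (r n / real (k n))"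
      using elim(1) rp by (simp add: q_def distrib_left)
    also have "r n / real (k n) = 1 / r n" using elim(1) by (simp add: field_simps)
    also have "real n * q n * ln (b n) * (1 / r n) \<le> real n * q n * ln (M n) * (1 / r n)"
      using elim(1) q_pos[of n] by (intro mult_right_mono mult_left_mono) auto
    finally show ?case by simp
  qed
qed (rule tendsto_const)

text \<open>The far tail is controlled through its integrated error only. As the logarithm is at
most \<open>ln M\<close>, the weight \<open>2 ln s\<close> costs a factor \<open>ln M\<close>, and \<open>ln M / sqrt k\<close> vanishes.\<close>

lemma E2_lim: "(\<lambda>n. real n / real (k n) * E2 n) \<longlonglongrightarrow> 2 / \<alpha>\<^sup>2"
proof -
  define g where "g n = 2 * (r n * b n powr (-\<alpha>)) * (ln (M n) / r n / \<alpha> + 1 / \<alpha>\<^sup>2 / r n) + real n * q n * ln (M n) / r n * (ln (M n) / r n)" for n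
  have "(\<lambda>n. 1 / \<alpha>\<^sup>2 / r n) \<longlonglongrightarrow> 0" by (rule real_tendsto_divide_at_top[OF tendsto_const r_lim])
  then have "g \<longlonglongrightarrow> 2 * 0 * (0 / \<alpha> + 0) + 0 * 0"
    unfolding g_def using \<alpha> by (intro tendsto_intros b_powr ln_M_over_r nq_ln_over_r) auto
  then have g: "g \<longlonglongrightarrow> 0" by simp
  have "(\<lambda>n. real n / real (k n) * E2 n - 2 / \<alpha>\<^sup>2) \<longlonglongrightarrow> 0"
  proof (rule tendsto_0_if_le_add[OF _ g])
    show "(\<lambda>n. 2 * (ln (M n) / r n)) \<longlonglongrightarrow> 2 * 0" by (intro tendsto_intros ln_M_over_r)
    fix \<delta> :: real assume \<delta>: "\<delta> > 0"
    show "eventually (\<lambda>n. \<bar>real n / real (k n) * E2 n - 2 / \<alpha>\<^sup>2\<bar> \<le> \<delta> * (2 * (ln (M n) / r n)) + g n) sequentially"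
      using eventually_window tail_integral[OF \<delta>]
    proof eventually_elim
      case (elim n)
      have rp: "r n > 0" using elim by simp
      have c: "c n = u n * b n" using elim by (simp add: c_def)
      have lnb: "0 \<le> ln (b n)" "ln (b n) \<le> ln (M n)" using elim by auto
      have "\<bar>real n / real (k n) * E2 n - 2 / \<alpha>\<^sup>2\<bar> \<le> 2 * ln (b n) * (\<delta> / r n) + 2 * b n powr (-\<alpha>) * (ln (b n) / \<alpha> + 1 / \<alpha>\<^sup>2) + real n / real (k n) * F (u n * b n) * (ln (b n))\<^sup>2"
        unfolding E2_def c
        by (rule truncated_log_square_moment[OF prob Y _ _ \<alpha> _ _ elim(2)]) (use elim \<delta> in auto)
      also have "2 * ln (b n) * (\<delta> / r n) \<le> 2 * ln (M n) * (\<delta> / r n)" using lnb \<delta> rp by (intro mult_right_mono) auto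
      also have "2 * b n powr (-\<alpha>) * (ln (b n) / \<alpha> + 1 / \<alpha>\<^sup>2) \<le> 2 * b n powr (-\<alpha>) * (ln (M n) / \<alpha> + 1 / \<alpha>\<^sup>2)"
        using lnb \<alpha> by (intro mult_left_mono add_right_mono divide_right_mono) auto
      also have "real n / real (k n) * F (u n * b n) * (ln (b n))\<^sup>2 \<le> real n / real (k n) * F (u n * b n) * (ln (M n))\<^sup>2"
        using lnb tail_nonneg[of P Y "u n * b n"] by (intro mult_left_mono power_mono) auto
      also have "real n / real (k n) * F (u n * b n) * (ln (M n))\<^sup>2 = real n * q n * ln (M n) / r n * (ln (M n) / r n)"
        using elim(1) by (simp add: q_def power2_eq_square)
      also have "2 * b n powr (-\<alpha>) * (ln (M n) / \<alpha> + 1 / \<alpha>\<^sup>2) = 2 * (r n * b n powr (-\<alpha>)) * (ln (M n) / r n / \<alpha> + 1 / \<alpha>\<^sup>2 / r n)"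
        using rp by (simp add: distrib_left)
      finally show ?case by (simp add: g_def mult_ac add.assoc)
    qed
  qed
  then show ?thesis by (simp add: LIM_zero_iff)
qed

text \<open>Holds for all large indices. The score is set to \<open>0\<close> for the others, so that it is bounded for
every index.\<close>

definition proper where "proper n \<longleftrightarrow> 1 \<le> u n \<and> u n < c n \<and> 0 < k n \<and> 1 < M n"

lemma eventually_proper: "eventually proper sequentially"
  using eventually_window eventually_greater[OF M_lim, of 1] 
  by eventually_elim (simp add: proper_def c_def)

text \<open>The influence of one observation on the Hill statistic, scaled by \<open>sqrt k\<close>.\<close>

definition score where
  "score n y = (if proper n then of_bool (u n < y \<and> y \<le> c n) * (ln (y / u n) - 1 / \<alpha>) / r n else 0)"

definition score_bound where "score_bound n = (if proper n then (ln (M n) + 1 / \<alpha>) / r n else 0)"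

lemma score_measurable [measurable]: "score n \<in> borel_measurable borel"
  unfolding score_def by measurable

lemma score_above: "y > c n \<Longrightarrow> score n y = 0"
  by (simp add: score_def)

lemma ln_between:
  assumes "proper n" "u n < y" "y \<le> d * M n" "1 \<le> d"
  shows "0 \<le> ln (y / u n)" "ln (y / u n) \<le> ln (d * M n)"
proof -
  have u: "1 \<le> u n" using assms by (simp add: proper_def)
  show "0 \<le> ln (y / u n)" using u assms by simp
  have "y / u n \<le> y / 1" using u assms by (intro divide_left_mono) auto
  then have "y / u n \<le> d * M n" "0 < y / u n" using assms u by auto
  then show "ln (y / u n) \<le> ln (d * M n)" by simp
qed

lemma score_bd: "\<bar>score n y\<bar> \<le> score_bound n"
proof (cases "proper n \<and> u n < y \<and> y \<le> c n")
  case True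
  then have "y \<le> 1 * M n" using c_le_M[of n] by simp
  then have "0 \<le> ln (y / u n)" "ln (y / u n) \<le> ln (M n)" using ln_between[of n y 1] True by auto
  moreover have "1 / \<alpha> > 0" using \<alpha> by simp
  ultimately have "\<bar>ln (y / u n) - 1 / \<alpha>\<bar> \<le> ln (M n) + 1 / \<alpha>" by linarith
  then show ?thesis using True by (simp add: score_def score_bound_def abs_divide divide_right_mono)
next
  case False
  moreover have "0 \<le> score_bound n" using \<alpha> by (auto simp: score_bound_def proper_def)
  ultimately show ?thesis by (auto simp: score_def)
qed

lemma score_bound_lim: "score_bound \<longlonglongrightarrow> 0"
proof -
  have "(\<lambda>n. 1 / \<alpha> / r n) \<longlonglongrightarrow> 0" by (rule real_tendsto_divide_at_top[OF tendsto_const r_lim])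
  from tendsto_add[OF ln_M_over_r this]
  have "(\<lambda>n. ln (M n) / r n + 1 / \<alpha> / r n) \<longlonglongrightarrow> 0" by simp
  moreover have "eventually (\<lambda>n. ln (M n) / r n + 1 / \<alpha> / r n = score_bound n) sequentially"
    using eventually_proper by eventually_elim (simp add: score_bound_def add_divide_distrib)
  ultimately show ?thesis by (rule Lim_transform_eventually)
qed

lemma score_expectations:
  assumes "proper n"
  shows "(\<integral>\<omega>. score n (Y \<omega>) \<partial>P) = (E1 n - E0 n / \<alpha>) / r n"
    and "(\<integral>\<omega>. (score n (Y \<omega>))\<^sup>2 \<partial>P) = (E2 n - 2 * E1 n / \<alpha> + E0 n / \<alpha>\<^sup>2) / real (k n)"
proof -
  interpret prob_space P by (rule prob)
  note [measurable] = Y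
  define I where "I \<omega> = (of_bool (u n < Y \<omega> \<and> Y \<omega> \<le> c n) :: real)" for \<omega>
  define l where "l \<omega> = ln (Y \<omega> / u n)" for \<omega>
  have [measurable]: "I \<in> borel_measurable P" "l \<in> borel_measurable P" unfolding I_def l_def by measurable
  have lb: "\<bar>l \<omega>\<bar> \<le> ln (M n)" if "u n < Y \<omega>" "Y \<omega> \<le> c n" for \<omega>
  proof -
    have "Y \<omega> \<le> 1 * M n" using that(2) c_le_M[of n] by simp
    then show ?thesis using ln_between[of n "Y \<omega>" 1] assms that(1) by (simp add: l_def)
  qed
  have lM: "0 \<le> ln (M n)" using assms by (simp add: proper_def)
  have i0: "integrable P I" by (rule integrable_const_bound[where B=1]) (auto simp: I_def)
  have i1: "integrable P (\<lambda>\<omega>. I \<omega> * l \<omega>)"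
    by (rule integrable_const_bound[where B="ln (M n)"]) (use lb lM in \<open>auto simp: I_def\<close>)
  have i2: "integrable P (\<lambda>\<omega>. I \<omega> * (l \<omega>)\<^sup>2)"
  proof (rule integrable_const_bound[where B="(ln (M n))\<^sup>2"])
    show "AE \<omega> in P. norm (I \<omega> * (l \<omega>)\<^sup>2) \<le> (ln (M n))\<^sup>2"
      using lb lM by (auto simp: I_def power2_le_iff_abs_le intro!: AE_I2)
  qed measurable
  have s1: "score n (Y \<omega>) = (I \<omega> * l \<omega> - I \<omega> / \<alpha>) / r n" for \<omega>
    using assms by (simp add: score_def I_def l_def)
  then show "(\<integral>\<omega>. score n (Y \<omega>) \<partial>P) = (E1 n - E0 n / \<alpha>) / r n"
    using i0 i1 by (simp add: E0_def E1_def flip: I_def l_def)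
  have s2: "(score n (Y \<omega>))\<^sup>2 = (I \<omega> * (l \<omega>)\<^sup>2 - 2 * (I \<omega> * l \<omega>) / \<alpha> + I \<omega> / \<alpha>\<^sup>2) / real (k n)" for \<omega>
    unfolding s1 using \<alpha> by (auto simp: I_def power_divide power2_eq_square field_simps)
  then show "(\<integral>\<omega>. (score n (Y \<omega>))\<^sup>2 \<partial>P) = (E2 n - 2 * E1 n / \<alpha> + E0 n / \<alpha>\<^sup>2) / real (k n)"
    using i0 i1 i2 by (simp add: E0_def E1_def E2_def flip: I_def l_def)
qed

text \<open>The means of \<open>ln (Y / u)\<close> and of \<open>1 / \<alpha>\<close> over \<open>Y > u\<close> agree for an exact power law; what remains is the
bias, which the tail assumptions make smaller than \<open>1 / sqrt k\<close>.\<close>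

lemma score_mean: "(\<lambda>n. real n * (\<integral>\<omega>. score n (Y \<omega>) \<partial>P)) \<longlonglongrightarrow> 0"
proof -
  have "(\<lambda>n. r n * (real n / real (k n) * E1 n - 1 / \<alpha>) - (real n * E0 n / r n - r n) / \<alpha>) \<longlonglongrightarrow> 0 - 0 / \<alpha>"
    using \<alpha> by (intro tendsto_intros E1_lim E0_lim) auto
  moreover have "eventually (\<lambda>n. r n * (real n / real (k n) * E1 n - 1 / \<alpha>) - (real n * E0 n / r n - r n) / \<alpha>
      = real n * (\<integral>\<omega>. score n (Y \<omega>) \<partial>P)) sequentially"
    using eventually_proper
  proof eventually_elim
    case (elim n)
    have "r n > 0" using elim by (simp add: proper_def)
    have "s * (x / (s * s)) = x / s" if "s > 0" for s x :: real using that by simp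
    from this[OF \<open>r n > 0\<close>, of "real n * E1 n"]
    have "r n * (real n / real (k n) * E1 n) = real n * E1 n / r n" by simp
    then show ?case unfolding score_expectations(1)[OF elim]
      by (simp add: right_diff_distrib diff_divide_distrib)
  qed
  ultimately show ?thesis using Lim_transform_eventually by force
qed

lemma E0_ratio: "(\<lambda>n. real n / real (k n) * E0 n) \<longlonglongrightarrow> 1"
proof -
  have "(\<lambda>n. (real n * E0 n / r n - r n) / r n) \<longlonglongrightarrow> 0"
    by (rule real_tendsto_divide_at_top[OF E0_lim r_lim])
  moreover have "eventually (\<lambda>n. (real n * E0 n / r n - r n) / r n = real n / real (k n) * E0 n - 1) sequentially"
    using k_pos by eventually_elim (simp add: diff_divide_distrib)
  ultimately have "(\<lambda>n. real n / real (k n) * E0 n - 1) \<longlonglongrightarrow> 0" by (rule Lim_transform_eventually)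
  then show ?thesis by (simp add: LIM_zero_iff)
qed

text \<open>For an exact power law, \<open>ln (Y / u)\<close> given \<open>Y > u\<close> is exponential with rate \<open>\<alpha>\<close>, and
\<open>2 / \<alpha>\<^sup>2 - 2 / \<alpha>\<^sup>2 + 1 / \<alpha>\<^sup>2 = 1 / \<alpha>\<^sup>2\<close>.\<close>

lemma score_variance: "(\<lambda>n. real n * (\<integral>\<omega>. (score n (Y \<omega>))\<^sup>2 \<partial>P)) \<longlonglongrightarrow> 1 / \<alpha>\<^sup>2"
proof -
  have "(\<lambda>n. r n * (real n / real (k n) * E1 n - 1 / \<alpha>) / r n) \<longlonglongrightarrow> 0"
    by (rule real_tendsto_divide_at_top[OF E1_lim r_lim])
  moreover have "eventually (\<lambda>n. r n * (real n / real (k n) * E1 n - 1 / \<alpha>) / r n = real n / real (k n) * E1 n - 1 / \<alpha>) sequentially"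
    using k_pos by eventually_elim simp
  ultimately have "(\<lambda>n. real n / real (k n) * E1 n - 1 / \<alpha>) \<longlonglongrightarrow> 0" by (rule Lim_transform_eventually)
  then have e1: "(\<lambda>n. real n / real (k n) * E1 n) \<longlonglongrightarrow> 1 / \<alpha>" by (simp add: LIM_zero_iff)
  have "(\<lambda>n. real n / real (k n) * E2 n - 2 * (real n / real (k n) * E1 n) / \<alpha> + real n / real (k n) * E0 n / \<alpha>\<^sup>2)
     \<longlonglongrightarrow> 2 / \<alpha>\<^sup>2 - 2 * (1 / \<alpha>) / \<alpha> + 1 / \<alpha>\<^sup>2"
    using \<alpha> by (intro tendsto_intros E0_ratio e1 E2_lim) auto
  moreover have "2 / \<alpha>\<^sup>2 - 2 * (1 / \<alpha>) / \<alpha> + 1 / \<alpha>\<^sup>2 = 1 / \<alpha>\<^sup>2" by (simp add: power2_eq_square)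
  moreover have "eventually (\<lambda>n. real n / real (k n) * E2 n - 2 * (real n / real (k n) * E1 n) / \<alpha> + real n / real (k n) * E0 n / \<alpha>\<^sup>2
     = real n * (\<integral>\<omega>. (score n (Y \<omega>))\<^sup>2 \<partial>P)) sequentially"
    using eventually_proper by eventually_elim (simp add: score_expectations(2) diff_divide_distrib add_divide_distrib algebra_simps)
  ultimately show ?thesis using Lim_transform_eventually by force
qed

definition level where "level y n = u n * exp (y / r n)"
definition count_diff where
  "count_diff y n h = (of_bool (u n < h \<and> h \<le> c n) - of_bool (level y n < h \<and> h \<le> c n)) / r n"

lemma count_diff_measurable [measurable]: "count_diff y n \<in> borel_measurable borel"
  unfolding count_diff_def by measurable

lemma level_less: "eventually (\<lambda>n. level y n < c n) sequentially"
proof -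
  have "(\<lambda>n. (real n * F (level y n) - real (k n)) / r n / r n) \<longlonglongrightarrow> 0"
    unfolding level_def by (rule real_tendsto_divide_at_top[OF F_local r_lim])
  moreover have "(\<lambda>n. real n * q n / r n / r n) \<longlonglongrightarrow> 0"
    by (rule real_tendsto_divide_at_top[OF nq_over_r r_lim])
  ultimately have "(\<lambda>n. (real n * F (level y n) - real (k n)) / r n / r n - real n * q n / r n / r n + 1) \<longlonglongrightarrow> 0 - 0 + 1"
    by (intro tendsto_intros)
  then have "eventually (\<lambda>n. (real n * F (level y n) - real (k n)) / r n / r n - real n * q n / r n / r n + 1 > 0) sequentially"
    by (intro order_tendstoD(1)) auto
  then show ?thesis using k_pos n_pos
  proof eventually_elim
    case (elim n)
    have "(real n * F (level y n) - real (k n)) / r n / r n - real n * q n / r n / r n + 1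
      = real n * (F (level y n) - q n) / real (k n)" using elim(2) by (simp add: field_simps)
    then have "q n < F (level y n)" using elim by (simp add: zero_less_divide_iff zero_less_mult_iff)
    then show ?case using F_mono[of "c n" "level y n"] unfolding q_def c_def by linarith
  qed
qed

lemma count_diff_mean: "(\<lambda>n. real n * (\<integral>\<omega>. count_diff y n (Y \<omega>) \<partial>P) - \<alpha> * y) \<longlonglongrightarrow> 0"
proof -
  interpret prob_space P by (rule prob)
  note [measurable] = Y
  have int: "integrable P (\<lambda>\<omega>. of_bool (a < Y \<omega> \<and> Y \<omega> \<le> d) :: real)" for a d
    by (rule integrable_const_bound[where B=1]) auto
  have "(\<lambda>n. (real n * F (u n) - real (k n)) / r n - (real n * F (level y n) - real (k n)) / r n - \<alpha> * y) \<longlonglongrightarrow> 0 - (- \<alpha> * y) - \<alpha> * y"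
    unfolding level_def by (intro tendsto_intros F_local F_u)
  moreover have "eventually (\<lambda>n. (real n * F (u n) - real (k n)) / r n - (real n * F (level y n) - real (k n)) / r n - \<alpha> * y
     = real n * (\<integral>\<omega>. count_diff y n (Y \<omega>) \<partial>P) - \<alpha> * y) sequentially"
    using eventually_proper level_less[of y]
  proof eventually_elim
    case (elim n)
    have "(\<integral>\<omega>. count_diff y n (Y \<omega>) \<partial>P) = (F (u n) - F (level y n)) / r n"
      unfolding count_diff_def using elim int by (simp add: prob_between proper_def)
    then show ?case by (simp add: diff_divide_distrib right_diff_distrib)
  qed
  ultimately show ?thesis using Lim_transform_eventually by force
qed

text \<open>Up to a fixed sign, \<open>count_diff\<close> is an indicator divided by \<open>r\<close>, so its square is itself divided
by \<open>r\<close>: increments of the count over distances of order \<open>1 / r\<close> are asymptotically deterministic.\<close>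

lemma count_diff_square: "(\<lambda>n. real n * (\<integral>\<omega>. (count_diff y n (Y \<omega>))\<^sup>2 \<partial>P)) \<longlonglongrightarrow> 0"
proof -
  have "(\<lambda>n. real n * (\<integral>\<omega>. count_diff y n (Y \<omega>) \<partial>P)) \<longlonglongrightarrow> \<alpha> * y"
    using count_diff_mean[of y] by (simp add: LIM_zero_iff)
  from tendsto_mult[OF tendsto_const[of "if y \<ge> 0 then 1 else -1"] real_tendsto_divide_at_top[OF this r_lim]]
  have "(\<lambda>n. (if y \<ge> 0 then 1 else -1) * (real n * (\<integral>\<omega>. count_diff y n (Y \<omega>) \<partial>P) / r n)) \<longlonglongrightarrow> 0" by simp
  moreover have "eventually (\<lambda>n. (if y \<ge> 0 then 1 else -1) * (real n * (\<integral>\<omega>. count_diff y n (Y \<omega>) \<partial>P) / r n)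
      = real n * (\<integral>\<omega>. (count_diff y n (Y \<omega>))\<^sup>2 \<partial>P)) sequentially"
    using eventually_proper
  proof eventually_elim
    case (elim n)
    have rp: "r n > 0" "u n > 0" using elim by (auto simp: proper_def)
    have lev: "if y \<ge> 0 then u n \<le> level y n else level y n \<le> u n"
      using rp by (auto simp: level_def divide_le_0_iff)
    have "(count_diff y n h)\<^sup>2 = (if y \<ge> 0 then 1 else -1) / r n * count_diff y n h" for h
      using lev rp by (auto simp: count_diff_def power2_eq_square split: if_splits)
    then show ?case by simp
  qed
  ultimately show ?thesis by (rule Lim_transform_eventually)
qed

lemma rq: "(\<lambda>n. r n * q n) \<longlonglongrightarrow> 0"
proof (rule tendsto_sandwich[OF _ _ tendsto_const nq_over_r])
  show "eventually (\<lambda>n. 0 \<le> r n * q n) sequentially" using q_pos by (simp add: less_imp_le)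
  have "eventually (\<lambda>n. real (k n) / real n < 1) sequentially" using k_over_n by (intro order_tendstoD(2)) auto
  then show "eventually (\<lambda>n. r n * q n \<le> real n * q n / r n) sequentially" using k_pos n_pos
  proof eventually_elim
    case (elim n)
    have "real (k n) * q n \<le> real n * q n" using elim q_pos[of n] by (intro mult_right_mono) auto
    also have "real (k n) * q n = (r n * r n) * q n" by simp
    also have "\<dots> = r n * q n * r n" by (simp only: mult_ac)
    finally have "r n * q n * r n \<le> real n * q n" .
    then show ?case using elim by (simp add: pos_le_divide_eq)
  qed
qed

definition count where "count n h = of_bool (u n < h \<and> h \<le> c n) / r n"

lemma count_measurable [measurable]: "count n \<in> borel_measurable borel"
  unfolding count_def by measurable

lemma count_expectations:
  "(\<integral>\<omega>. count n (Y \<omega>) \<partial>P) = E0 n / r n" "(\<integral>\<omega>. (count n (Y \<omega>))\<^sup>2 \<partial>P) = E0 n / real (k n)"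
proof -
  show "(\<integral>\<omega>. count n (Y \<omega>) \<partial>P) = E0 n / r n" by (simp add: count_def E0_def)
  have "(count n h)\<^sup>2 = of_bool (u n < h \<and> h \<le> c n) / real (k n)" for h
    by (simp add: count_def power_divide)
  then show "(\<integral>\<omega>. (count n (Y \<omega>))\<^sup>2 \<partial>P) = E0 n / real (k n)" by (simp add: E0_def)
qed

lemma exceedances_split:
  assumes m: "exceedances h n (c n) = m" and s: "s < c n"
    and x: "\<And>j. j \<in> {1..n} \<Longrightarrow> (if h j \<le> c n then x j = h j else c n < x j)"
  shows "real (exceedances x n s) = (\<Sum>j=1..n. of_bool (s < h j \<and> h j \<le> c n)) + real m"
proof -
  have "real (exceedances x n s) = (\<Sum>j=1..n. of_bool (s < h j \<and> h j \<le> c n) + (if h j > c n then 1 else 0))"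
    unfolding exceedances_eq_sum
  proof (rule sum.cong[OF refl])
    fix j assume "j \<in> {1..n}"
    from x[OF this] s show "(if s < x j then 1 else 0) = (of_bool (s < h j \<and> h j \<le> c n) + (if h j > c n then 1 else 0) :: real)"
      by (auto split: if_splits)
  qed
  then show ?thesis using m unfolding sum.distrib exceedances_eq_sum[symmetric] by simp
qed

text \<open>A sample \<open>x\<close> that agrees with \<open>h\<close> up to level \<open>c\<close>. The \<open>m\<close> values above \<open>c\<close> shift all counts by the same
\<open>m\<close>, which cancels in the differences, and add at most \<open>m (ln (2 M) + 1 / \<alpha>)\<close> to the scores.\<close>

lemma hill_score:
  assumes proper: "proper n" and k: "k n \<le> n" and e: "e > 0"
    and m: "exceedances h n (c n) = m" 
    and x: "\<And>j. j \<in> {1..n} \<Longrightarrow> (if h j \<le> c n then x j = h j else c n < x j \<and> x j \<le> 2 * M n)"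
    and cnt: "\<bar>(\<Sum>j=1..n. count n (h j)) - r n\<bar> \<le> \<alpha> * (real R - 3) * e" and me: "real m \<le> \<alpha> * e * r n"
    and grid: "\<And>i::int. \<bar>i\<bar> \<le> int R \<Longrightarrow> \<bar>(\<Sum>j=1..n. count_diff (of_int i * e) n (h j)) - \<alpha> * (of_int i * e)\<bar> \<le> \<alpha> * e / 2"
    and lev: "\<And>i::int. \<bar>i\<bar> \<le> int R \<Longrightarrow> level (of_int i * e) n < c n"
    and small: "real m * (ln (2 * M n) + 1 / \<alpha>) / r n + 3 * \<alpha> * (real R * e)\<^sup>2 / r n \<le> e"
  shows "\<bar>r n * (hill x (k n) n - 1 / \<alpha>) - (\<Sum>j=1..n. score n (h j))\<bar> \<le> 3 * e"
proof -
  have rp: "r n > 0" and uc: "u n < c n" and u1: "1 \<le> u n" and kp: "1 \<le> k n" using proper by (auto simp: proper_def)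
  have rr: "r n * (r n * z) = real (k n) * z" for z by (simp flip: mult.assoc)
  have x': "if h j \<le> c n then x j = h j else c n < x j" if "j \<in> {1..n}" for j
    using x[OF that] by (auto split: if_splits)
  note split = exceedances_split[OF m _ x']
  define N where "N = real (exceedances x n (u n))"
  have N: "N = r n * (\<Sum>j=1..n. count n (h j)) + real m"
    unfolding N_def count_def sum_divide_distrib[symmetric] using rp split[OF uc]
    by (simp del: sum_of_bool_eq One_nat_def)
  have Nk: "\<bar>N - real (k n)\<bar> \<le> \<alpha> * (real R - 2) * e * r n"
  proof -
    have "N - real (k n) = r n * ((\<Sum>j=1..n. count n (h j)) - r n) + real m"
      unfolding N by (simp add: algebra_simps)
    then have "\<bar>N - real (k n)\<bar> \<le> r n * \<bar>(\<Sum>j=1..n. count n (h j)) - r n\<bar> + real m"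
      using rp abs_triangle_ineq[of "r n * ((\<Sum>j=1..n. count n (h j)) - r n)" "real m"] by (simp add: abs_mult)
    also have "\<dots> \<le> r n * (\<alpha> * (real R - 3) * e) + \<alpha> * e * r n"
      using cnt me rp by (intro add_mono mult_left_mono) auto
    finally show ?thesis by (simp add: algebra_simps)
  qed
  have lin: "\<bar>real (k n) * hill x (k n) n - real (k n) / \<alpha> - (log_excess x n (u n) - N / \<alpha>)\<bar>
      \<le> 2 * e * r n + 3 * \<alpha> * (real R * e)\<^sup>2"
    unfolding N_def
  proof (rule hill_linearization[OF kp k _ \<alpha> e])
    show "0 < u n" using u1 by simp
    show "\<bar>real (exceedances x n (u n)) - real (k n)\<bar> \<le> \<alpha> * (real R - 2) * e * r n" using Nk by (simp add: N_def)
    fix i :: int assume i: "\<bar>i\<bar> \<le> int R"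
    have "N - real (exceedances x n (level (of_int i * e) n)) = r n * (\<Sum>j=1..n. count_diff (of_int i * e) n (h j))"
      unfolding N_def count_diff_def sum_divide_distrib[symmetric] sum_subtractf
      using rp split[OF uc] split[OF lev[OF i]] by (simp del: sum_of_bool_eq One_nat_def)
    then have "real (exceedances x n (level (of_int i * e) n)) - N + \<alpha> * (of_int i * e) * r n
       = - (r n * ((\<Sum>j=1..n. count_diff (of_int i * e) n (h j)) - \<alpha> * (of_int i * e)))"
      by (simp add: algebra_simps)
    then have "\<bar>real (exceedances x n (level (of_int i * e) n)) - N + \<alpha> * (of_int i * e) * r n\<bar>
       = r n * \<bar>(\<Sum>j=1..n. count_diff (of_int i * e) n (h j)) - \<alpha> * (of_int i * e)\<bar>"
      using rp by (simp add: abs_mult)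
    also have "\<dots> \<le> r n * (\<alpha> * e / 2)" using grid[OF i] rp by (intro mult_left_mono) auto
    finally show "\<bar>real (exceedances x n (u n * exp (of_int i * e / r n))) - real (exceedances x n (u n)) + \<alpha> * (of_int i * e) * r n\<bar> \<le> \<alpha> * e / 2 * r n"
      by (simp add: level_def N_def mult.commute)
  qed
  define E where "E = (\<Sum>j=1..n. if h j > c n then ln (x j / u n) - 1 / \<alpha> else 0)"
  have LE: "log_excess x n (u n) - N / \<alpha> = r n * (\<Sum>j=1..n. score n (h j)) + E"
  proof -
    have "log_excess x n (u n) - N / \<alpha> = (\<Sum>j=1..n. (if x j > u n then ln (x j / u n) else 0) - (if x j > u n then 1 else 0) / \<alpha>)"
      unfolding N_def exceedances_eq_sum log_excess_def sum_subtractf sum_divide_distrib by simp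
    also have "\<dots> = (\<Sum>j=1..n. r n * score n (h j) + (if h j > c n then ln (x j / u n) - 1 / \<alpha> else 0))"
    proof (rule sum.cong[OF refl])
      fix j assume j: "j \<in> {1..n}"
      show "(if x j > u n then ln (x j / u n) else 0) - (if x j > u n then 1 else 0) / \<alpha> = r n * score n (h j) + (if h j > c n then ln (x j / u n) - 1 / \<alpha> else 0)"
        using x'[OF j] uc rp proper by (auto simp: score_def split: if_splits)
    qed
    finally show ?thesis by (simp add: E_def sum.distrib sum_distrib_left)
  qed
  have Eb: "\<bar>E\<bar> \<le> real m * (ln (2 * M n) + 1 / \<alpha>)"
  proof -
    have "\<bar>E\<bar> \<le> (\<Sum>j=1..n. \<bar>if h j > c n then ln (x j / u n) - 1 / \<alpha> else 0\<bar>)" unfolding E_def by (rule sum_abs)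
    also have "\<dots> \<le> (\<Sum>j=1..n. (if h j > c n then 1 else 0) * (ln (2 * M n) + 1 / \<alpha>))"
    proof (rule sum_mono)
      fix j assume j: "j \<in> {1..n}"
      show "\<bar>if h j > c n then ln (x j / u n) - 1 / \<alpha> else 0\<bar> \<le> (if h j > c n then 1 else 0) * (ln (2 * M n) + 1 / \<alpha>)"
      proof (cases "h j > c n")
        case True
        then have "u n < x j" "x j \<le> 2 * M n" using x[OF j] uc by auto
        then have "0 \<le> ln (x j / u n)" "ln (x j / u n) \<le> ln (2 * M n)" using ln_between[of n "x j" 2] proper by auto
        moreover have "1 / \<alpha> > 0" using \<alpha> by simp
        ultimately have "\<bar>ln (x j / u n) - 1 / \<alpha>\<bar> \<le> ln (2 * M n) + 1 / \<alpha>" by linarith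
        then show ?thesis using True by simp
      qed simp
    qed
    also have "\<dots> = real m * (ln (2 * M n) + 1 / \<alpha>)"
      using m by (simp only: sum_distrib_right[symmetric] exceedances_eq_sum[symmetric])
    finally show ?thesis .
  qed
  have "r n * (r n * (hill x (k n) n - 1 / \<alpha>) - (\<Sum>j=1..n. score n (h j))) =
      (real (k n) * hill x (k n) n - real (k n) / \<alpha> - (log_excess x n (u n) - N / \<alpha>)) + E"
    unfolding LE by (simp add: right_diff_distrib rr)
  then have "\<bar>r n * (r n * (hill x (k n) n - 1 / \<alpha>) - (\<Sum>j=1..n. score n (h j)))\<bar> \<le>
      2 * e * r n + 3 * \<alpha> * (real R * e)\<^sup>2 + real m * (ln (2 * M n) + 1 / \<alpha>)"
    using lin Eb by linarith
  also have "real m * (ln (2 * M n) + 1 / \<alpha>) = e * r n - 3 * \<alpha> * (real R * e)\<^sup>2 -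
      (e - (real m * (ln (2 * M n) + 1 / \<alpha>) / r n + 3 * \<alpha> * (real R * e)\<^sup>2 / r n)) * r n"
    using rp by (simp add: left_diff_distrib distrib_right)
  also have "2 * e * r n + 3 * \<alpha> * (real R * e)\<^sup>2 + \<dots> \<le> 2 * e * r n + e * r n"
    using mult_nonneg_nonneg[of "e - (real m * (ln (2 * M n) + 1 / \<alpha>) / r n + 3 * \<alpha> * (real R * e)\<^sup>2 / r n)" "r n"]
      small rp by linarith
  finally have "r n * \<bar>r n * (hill x (k n) n - 1 / \<alpha>) - (\<Sum>j=1..n. score n (h j))\<bar> \<le> 2 * e * r n + e * r n"
    using rp by (simp only: abs_mult abs_of_pos)
  also have "\<dots> = r n * (3 * e)" by simp
  finally show ?thesis using rp by (simp only: mult_le_cancel_left_pos)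
qed

end

text \<open>One value \<open>m n\<close> of the number of exceedances is singled out for every \<open>n\<close>; \<open>k n\<close> may depend on it.\<close>

locale conditioned_hill = intermediate_sequence P "H 0" M \<alpha> \<beta> \<gamma> k
  for P :: "'a measure" and H :: "nat \<Rightarrow> 'a \<Rightarrow> real" and M \<alpha> \<beta> \<gamma> k +
  fixes m :: "nat \<Rightarrow> nat"
  assumes iid: "iid P H" and m: "(\<lambda>n. real (m n) / (real n * q n)) \<longlonglongrightarrow> 1"
begin

abbreviation n_top where "n_top n \<omega> \<equiv> exceedances (\<lambda>j. H j \<omega>) n (c n)"

lemma q_c: "tail P (H 0) (c n) = q n" by (simp add: q_def c_def)

lemma m_over_n: "(\<lambda>n. real (m n) / real n) \<longlonglongrightarrow> 0"
proof -
  have "(\<lambda>n. real (m n) / (real n * q n) * q n) \<longlonglongrightarrow> 1 * 0" by (intro tendsto_intros m q_lim)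
  moreover have "real (m n) / (real n * q n) * q n = real (m n) / real n" for n using q_pos[of n] by simp
  ultimately show ?thesis by simp
qed

lemma m_times: assumes "(\<lambda>n. real n * q n * g n) \<longlonglongrightarrow> 0" shows "(\<lambda>n. real (m n) * g n) \<longlonglongrightarrow> 0"
proof -
  have "(\<lambda>n. real (m n) / (real n * q n) * (real n * q n * g n)) \<longlonglongrightarrow> 1 * 0" by (intro tendsto_intros m assms)
  moreover have "eventually (\<lambda>n. real (m n) / (real n * q n) * (real n * q n * g n) = real (m n) * g n) sequentially"
    using n_pos
  proof eventually_elim
    case (elim n)
    then have "real n * q n \<noteq> 0" using q_pos[of n] by simp
    then show ?case by simp
  qed
  ultimately show ?thesis using Lim_transform_eventually by force
qed

lemma m_over_r: "(\<lambda>n. real (m n) / r n) \<longlonglongrightarrow> 0"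
  using m_times[of "\<lambda>n. 1 / r n"] nq_over_r by simp

lemma m_ln_over_r: "(\<lambda>n. real (m n) * (ln (2 * M n) + 1 / \<alpha>) / r n) \<longlonglongrightarrow> 0"
proof -
  have "(\<lambda>n. real (m n) * (ln (M n) / r n)) \<longlonglongrightarrow> 0"
    using m_times[of "\<lambda>n. ln (M n) / r n"] nq_ln_over_r by simp
  then have "(\<lambda>n. real (m n) * (ln (M n) / r n) + real (m n) / r n * (ln 2 + 1 / \<alpha>)) \<longlonglongrightarrow> 0 + 0 * (ln 2 + 1 / \<alpha>)"
    by (intro tendsto_intros m_over_r)
  moreover have "real (m n) * (ln (M n) / r n) + real (m n) / r n * (ln 2 + 1 / \<alpha>) = real (m n) * (ln (2 * M n) + 1 / \<alpha>) / r n" for n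
    using M_pos[of n] by (simp add: ln_mult add_divide_distrib distrib_left)
  ultimately show ?thesis by simp
qed

lemma mr_over_n: "(\<lambda>n. r n * (real (m n) / real n)) \<longlonglongrightarrow> 0"
proof -
  have "(\<lambda>n. real (m n) * (r n / real n)) \<longlonglongrightarrow> 0"
  proof (rule m_times)
    have "eventually (\<lambda>n. r n * q n = real n * q n * (r n / real n)) sequentially"
      using n_pos by eventually_elim simp
    with rq show "(\<lambda>n. real n * q n * (r n / real n)) \<longlonglongrightarrow> 0" by (rule Lim_transform_eventually)
  qed
  then show ?thesis by (simp add: mult.commute)
qed

lemma tendsto_mult_bounded:
  assumes "(\<lambda>n. f n - L n) \<longlonglongrightarrow> 0" "(\<lambda>n. L n * g n) \<longlonglongrightarrow> 0" "g \<longlonglongrightarrow> 0"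
  shows "(\<lambda>n. f n * g n :: real) \<longlonglongrightarrow> 0"
proof -
  have "(\<lambda>n. (f n - L n) * g n + L n * g n) \<longlonglongrightarrow> 0 * 0 + 0" using assms by (intro tendsto_intros)
  then show ?thesis by (simp add: algebra_simps)
qed

lemma count_concentration:
  assumes a: "a > 0" "1 < \<delta> * a\<^sup>2"
  shows "eventually (\<lambda>n. measure P {\<omega> \<in> space P. n_top n \<omega> = m n \<and> \<bar>(\<Sum>j=1..n. count n (H j \<omega>)) - r n\<bar> \<ge> 2 * a}
     \<le> \<delta> * measure P {\<omega> \<in> space P. n_top n \<omega> = m n}) sequentially"
proof (rule conditional_concentration[OF prob iid count_measurable _ _ _ m_over_n _ _ _ _ a])
  show "\<bar>count n y\<bar> \<le> 1 / r n" for n y by (auto simp: count_def)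
  show "y > c n \<Longrightarrow> count n y = 0" for n y by (simp add: count_def)
  show "(\<lambda>n. tail P (H 0) (c n)) \<longlonglongrightarrow> 0" using q_lim by (simp add: q_c)
  show L: "(\<lambda>n. real n * (\<integral>\<omega>. count n (H 0 \<omega>) \<partial>P) - r n) \<longlonglongrightarrow> 0"
    using E0_lim by (simp add: count_expectations)
  show "(\<lambda>n. real n * (\<integral>\<omega>. count n (H 0 \<omega>) \<partial>P) * tail P (H 0) (c n)) \<longlonglongrightarrow> 0"
    unfolding q_c by (rule tendsto_mult_bounded[OF L rq q_lim])
  show "(\<lambda>n. real n * (\<integral>\<omega>. count n (H 0 \<omega>) \<partial>P) * (real (m n) / real n)) \<longlonglongrightarrow> 0"
    by (rule tendsto_mult_bounded[OF L mr_over_n m_over_n])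
  show "(\<lambda>n. real n * (\<integral>\<omega>. (count n (H 0 \<omega>))\<^sup>2 \<partial>P)) \<longlonglongrightarrow> 1"
    using E0_ratio by (simp add: count_expectations)
qed

lemma count_diff_concentration:
  assumes a: "a > 0" and d: "\<delta> > 0"
  shows "eventually (\<lambda>n. measure P {\<omega> \<in> space P. n_top n \<omega> = m n \<and> \<bar>(\<Sum>j=1..n. count_diff y n (H j \<omega>)) - \<alpha> * y\<bar> \<ge> 2 * a}
     \<le> \<delta> * measure P {\<omega> \<in> space P. n_top n \<omega> = m n}) sequentially"
proof (rule conditional_concentration[OF prob iid count_diff_measurable _ _ _ m_over_n _ _ _ _ a])
  show "\<bar>count_diff y n h\<bar> \<le> 1 / r n" for n h by (auto simp: count_diff_def)
  show "h > c n \<Longrightarrow> count_diff y n h = 0" for n h by (simp add: count_diff_def)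
  show "(\<lambda>n. tail P (H 0) (c n)) \<longlonglongrightarrow> 0" using q_lim by (simp add: q_c)
  show L: "(\<lambda>n. real n * (\<integral>\<omega>. count_diff y n (H 0 \<omega>) \<partial>P) - \<alpha> * y) \<longlonglongrightarrow> 0"
    by (rule count_diff_mean)
  have t: "(\<lambda>n. \<alpha> * y * g n) \<longlonglongrightarrow> 0" if "g \<longlonglongrightarrow> 0" for g
    using tendsto_mult[OF tendsto_const that, of "\<alpha> * y"] by simp
  show "(\<lambda>n. real n * (\<integral>\<omega>. count_diff y n (H 0 \<omega>) \<partial>P) * tail P (H 0) (c n)) \<longlonglongrightarrow> 0"
    unfolding q_c by (rule tendsto_mult_bounded[OF L t[OF q_lim] q_lim])
  show "(\<lambda>n. real n * (\<integral>\<omega>. count_diff y n (H 0 \<omega>) \<partial>P) * (real (m n) / real n)) \<longlonglongrightarrow> 0"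
    by (rule tendsto_mult_bounded[OF L t[OF m_over_n] m_over_n])
  show "(\<lambda>n. real n * (\<integral>\<omega>. (count_diff y n (H 0 \<omega>))\<^sup>2 \<partial>P)) \<longlonglongrightarrow> 0"
    by (rule count_diff_square)
  show "0 < \<delta> * a\<^sup>2" using a d by simp
qed

lemma score_clt:
  assumes "\<delta> > 0"
  shows "eventually (\<lambda>n. norm ((\<integral>\<omega>. of_bool (n_top n \<omega> = m n) * iexp (t * (\<Sum>j=1..n. score n (H j \<omega>))) \<partial>P)
        - of_real (measure P {\<omega> \<in> space P. n_top n \<omega> = m n} * exp (- t\<^sup>2 * (1 / \<alpha>\<^sup>2) / 2)))
     \<le> \<delta> * measure P {\<omega> \<in> space P. n_top n \<omega> = m n}) sequentially"
  by (rule conditional_clt[OF prob iid score_measurable score_bd score_above _ m_over_n score_bound_lim score_mean score_variance assms])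
     (use q_lim in \<open>simp_all add: q_c\<close>)

text \<open>Stated for every sample \<open>X\<close> that follows \<open>H\<close> up to level \<open>c\<close> on an event \<open>G\<close>, so that the truncation
scheme stays abstract. All errors are proportional to the probability of \<open>m n\<close> exceedances,
except for the part of that event outside \<open>G\<close>.\<close>

lemma conditional_char_limit:
  assumes \<delta>: "\<delta> > 0"
  shows "eventually (\<lambda>n. \<forall>G X. G \<in> sets P \<longrightarrow> (\<lambda>\<omega>. hill (X \<omega>) (k n) n) \<in> borel_measurable P \<longrightarrow>
     (\<forall>\<omega>\<in>G. \<forall>j\<in>{1..n}. if H j \<omega> \<le> c n then X \<omega> j = H j \<omega> else c n < X \<omega> j \<and> X \<omega> j \<le> 2 * M n) \<longrightarrow>
     norm (\<integral>\<omega>. of_bool (n_top n \<omega> = m n) * (iexp (t * (r n * (hill (X \<omega>) (k n) n - 1 / \<alpha>))) - of_real (exp (- t\<^sup>2 * (1 / \<alpha>\<^sup>2) / 2))) \<partial>P)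
      \<le> \<delta> * measure P {\<omega> \<in> space P. n_top n \<omega> = m n} + 2 * measure P ({\<omega> \<in> space P. n_top n \<omega> = m n} - G)) sequentially"
proof -
  interpret prob_space P by (rule prob)
  have [measurable]: "H i \<in> borel_measurable P" for i by (rule iid_measurable[OF prob iid])
  have [measurable]: "n_top n \<in> measurable P (count_space UNIV)" for n by measurable
  \<comment> \<open>The linearization error is at most \<open>3 e\<close>, which changes the characteristic function by at most \<open>\<delta> / 4\<close>.\<close>
  define e where "e = \<delta> / (12 * (\<bar>t\<bar> + 1))"
  have e: "e > 0" using \<delta> by (simp add: e_def)
  have te: "\<bar>t\<bar> * (3 * e) \<le> \<delta> / 4"
  proof -
    have "\<bar>t\<bar> * (3 * e) \<le> (\<bar>t\<bar> + 1) * (3 * e)" using e by (intro mult_right_mono) auto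
    also have "\<dots> = \<delta> / 4" by (simp add: e_def field_simps)
    finally show ?thesis .
  qed
  define \<delta>1 where "\<delta>1 = \<delta> / 8"
  have \<delta>1: "\<delta>1 > 0" using \<delta> by (simp add: \<delta>1_def)
  \<comment> \<open>Any \<open>x0\<close> with \<open>1 < \<delta>1 * x0\<^sup>2\<close> makes the count tight; the grid must then reach beyond \<open>2 * x0\<close>.\<close>
  define x0 where "x0 = 1 / \<delta>1 + 1"
  have x0: "x0 > 1" "1 < \<delta>1 * x0\<^sup>2"
  proof -
    show "x0 > 1" using \<delta>1 by (simp add: x0_def)
    then have "x0 * 1 < x0 * x0" by (intro mult_strict_left_mono) auto
    then have "\<delta>1 * x0 < \<delta>1 * x0\<^sup>2" using \<delta>1 by (simp add: power2_eq_square)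
    moreover have "1 < \<delta>1 * x0" using \<delta>1 by (simp add: x0_def field_simps)
    ultimately show "1 < \<delta>1 * x0\<^sup>2" by linarith
  qed
  obtain R :: nat where "real R > 3 + 2 * x0 / (\<alpha> * e)" using reals_Archimedean2 by blast
  then have R: "\<alpha> * (real R - 3) * e > 2 * x0" using \<alpha> e by (simp add: field_simps)
  define I where "I = {i::int. \<bar>i\<bar> \<le> int R}"
  have finI: "finite I" unfolding I_def by (rule finite_subset[of _ "{- int R..int R}"]) auto
  have cI: "card I > 0" using finI by (auto simp: card_gt_0_iff I_def intro!: exI[of _ 0])
  \<comment> \<open>All grid levels together may fail with conditional probability \<open>\<delta> / 8\<close>.\<close>
  define \<delta>2 where "\<delta>2 = \<delta> / (8 * real (card I))"
  have \<delta>2: "\<delta>2 > 0" using \<delta> cI by (simp add: \<delta>2_def)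
  define p where "p n = measure P {\<omega> \<in> space P. n_top n \<omega> = m n}" for n
  define BN where "BN n = {\<omega> \<in> space P. n_top n \<omega> = m n \<and> \<bar>(\<Sum>j=1..n. count n (H j \<omega>)) - r n\<bar> \<ge> 2 * x0}" for n
  define BI where "BI i n = {\<omega> \<in> space P. n_top n \<omega> = m n \<and> \<bar>(\<Sum>j=1..n. count_diff (of_int i * e) n (H j \<omega>)) - \<alpha> * (of_int i * e)\<bar> \<ge> 2 * (\<alpha> * e / 4)}" for i :: int and n
  have evN: "eventually (\<lambda>n. measure P (BN n) \<le> \<delta>1 * p n) sequentially"
    unfolding BN_def p_def by (rule count_concentration) (use x0 in auto)
  have evI: "eventually (\<lambda>n. \<forall>i\<in>I. measure P (BI i n) \<le> \<delta>2 * p n \<and> level (of_int i * e) n < c n) sequentially"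
    using finI
  proof (rule eventually_ball_finite, intro ballI)
    fix i assume "i \<in> I"
    show "eventually (\<lambda>n. measure P (BI i n) \<le> \<delta>2 * p n \<and> level (of_int i * e) n < c n) sequentially"
      unfolding BI_def p_def using \<alpha> e \<delta>2 by (intro eventually_conj count_diff_concentration level_less) auto
  qed
  have "\<delta> / 4 > 0" using \<delta> by simp
  note evC = score_clt[OF this, of t]
  have "(\<lambda>n. real (m n) * (ln (2 * M n) + 1 / \<alpha>) / r n + 3 * \<alpha> * (real R * e)\<^sup>2 / r n) \<longlonglongrightarrow> 0 + 0"
    by (intro tendsto_add m_ln_over_r real_tendsto_divide_at_top[OF tendsto_const r_lim])
  then have evS: "eventually (\<lambda>n. real (m n) * (ln (2 * M n) + 1 / \<alpha>) / r n + 3 * \<alpha> * (real R * e)\<^sup>2 / r n < e) sequentially"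
    using e by (intro order_tendstoD(2)) auto
  have evM: "eventually (\<lambda>n. real (m n) / r n < \<alpha> * e) sequentially"
    using m_over_r \<alpha> e by (intro order_tendstoD(2)) auto
  have evk: "eventually (\<lambda>n. real (k n) / real n < 1) sequentially" using k_over_n by (intro order_tendstoD(2)) auto
  show ?thesis
    using evN evI evC evS evM evk eventually_proper n_pos
  proof eventually_elim
    case (elim n)
    have rp: "r n > 0" using elim by (simp add: proper_def)
    show ?case
    proof (intro allI impI)
      fix G X
      assume G: "G \<in> sets P" and hm [measurable]: "(\<lambda>\<omega>. hill (X \<omega>) (k n) n) \<in> borel_measurable P"
        and X: "\<forall>\<omega>\<in>G. \<forall>j\<in>{1..n}. if H j \<omega> \<le> c n then X \<omega> j = H j \<omega> else c n < X \<omega> j \<and> X \<omega> j \<le> 2 * M n"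
      define W where "W \<omega> = r n * (hill (X \<omega>) (k n) n - 1 / \<alpha>)" for \<omega>
      define Z where "Z \<omega> = (\<Sum>j=1..n. score n (H j \<omega>))" for \<omega>
      have [measurable]: "W \<in> borel_measurable P" "Z \<in> borel_measurable P" unfolding W_def Z_def by measurable
      define A where "A = {\<omega> \<in> space P. n_top n \<omega> = m n}"
      have A [measurable]: "A \<in> sets P" unfolding A_def by measurable
      define Bad where "Bad = BN n \<union> (\<Union>i\<in>I. BI i n)"
      have [measurable]: "BN n \<in> sets P" "BI i n \<in> sets P" for i unfolding BN_def BI_def by measurable
      have Bad: "Bad \<in> sets P" unfolding Bad_def using finI by measurable
      have pBad: "measure P Bad \<le> \<delta> / 4 * p n"
      proof -
        have "measure P Bad \<le> measure P (BN n) + measure P (\<Union>i\<in>I. BI i n)"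
          unfolding Bad_def by (rule measure_Un_le) (use finI in measurable)
        also have "measure P (\<Union>i\<in>I. BI i n) \<le> (\<Sum>i\<in>I. measure P (BI i n))"
          using finI by (intro measure_UNION_le) auto
        also have "\<dots> \<le> (\<Sum>i\<in>I. \<delta>2 * p n)" using elim(2) by (intro sum_mono) auto
        also have "\<dots> = \<delta> / 8 * p n" using cI by (simp add: \<delta>2_def)
        finally show ?thesis using elim(1) by (simp add: \<delta>1_def)
      qed
      have close: "\<bar>W \<omega> - Z \<omega>\<bar> \<le> 3 * e" if w: "\<omega> \<in> A" "\<omega> \<in> G" "\<omega> \<notin> Bad" for \<omega>
        unfolding W_def Z_def
      proof (rule hill_score[where R=R and m="m n"])
        show "proper n" "e > 0" by (fact elim e)+
        show "k n \<le> n" using elim(6) elim(8) by simp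
        show "n_top n \<omega> = m n" using w by (simp add: A_def)
        show "if H j \<omega> \<le> c n then X \<omega> j = H j \<omega> else c n < X \<omega> j \<and> X \<omega> j \<le> 2 * M n" if "j \<in> {1..n}" for j
          using X w that by blast
        have "\<omega> \<notin> BN n" using w by (simp add: Bad_def)
        then show "\<bar>(\<Sum>j=1..n. count n (H j \<omega>)) - r n\<bar> \<le> \<alpha> * (real R - 3) * e"
          using w(1) R unfolding BN_def A_def by auto
        show "real (m n) \<le> \<alpha> * e * r n" using elim(5) rp by (simp add: pos_divide_less_eq)
        show "\<bar>(\<Sum>j=1..n. count_diff (of_int i * e) n (H j \<omega>)) - \<alpha> * (of_int i * e)\<bar> \<le> \<alpha> * e / 2" if "\<bar>i\<bar> \<le> int R" for i
        proof -
          have "\<omega> \<notin> BI i n" using w that by (auto simp: Bad_def I_def)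
          then show ?thesis using w(1) unfolding BI_def A_def by auto
        qed
        show "level (of_int i * e) n < c n" if "\<bar>i\<bar> \<le> int R" for i using elim(2) that by (auto simp: I_def)
        show "real (m n) * (ln (2 * M n) + 1 / \<alpha>) / r n + 3 * \<alpha> * (real R * e)\<^sup>2 / r n \<le> e" using elim(4) by simp
      qed
      define \<psi> where "\<psi> = exp (- t\<^sup>2 * (1 / \<alpha>\<^sup>2) / 2)"
      have obA: "of_bool (n_top n \<omega> = m n) = (indicator A \<omega> :: complex)" if "\<omega> \<in> space P" for \<omega>
        using that by (auto simp: A_def indicator_def)
      have iW: "integrable P (\<lambda>\<omega>. indicator A \<omega> * iexp (t * W \<omega>))"
        by (rule integrable_const_bound[where B=1]) (auto simp: norm_mult indicator_def)
      have iZ: "integrable P (\<lambda>\<omega>. indicator A \<omega> * iexp (t * Z \<omega>))"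
        by (rule integrable_const_bound[where B=1]) (auto simp: norm_mult indicator_def)
      have iA: "integrable P (\<lambda>\<omega>. indicator A \<omega> * complex_of_real \<psi>)"
        by (rule integrable_const_bound[where B="\<bar>\<psi>\<bar>"]) (auto simp: norm_mult indicator_def)
      have EA: "(\<integral>\<omega>. indicator A \<omega> * complex_of_real \<psi> \<partial>P) = of_real (p n * \<psi>)"
      proof -
        have "(\<integral>\<omega>. indicator A \<omega> * complex_of_real \<psi> \<partial>P) = (\<integral>\<omega>. complex_of_real (indicator A \<omega> * \<psi>) \<partial>P)"
          by (intro Bochner_Integration.integral_cong) (auto simp: indicator_def)
        also have "\<dots> = of_real (p n * \<psi>)" by (simp add: p_def A_def)
        finally show ?thesis .
      qed
      have "(\<integral>\<omega>. of_bool (n_top n \<omega> = m n) * (iexp (t * W \<omega>) - of_real \<psi>) \<partial>P) =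
         (\<integral>\<omega>. indicator A \<omega> * iexp (t * W \<omega>) - indicator A \<omega> * complex_of_real \<psi> \<partial>P)"
        using obA by (intro Bochner_Integration.integral_cong) (auto simp: right_diff_distrib)
      also have "\<dots> = (\<integral>\<omega>. indicator A \<omega> * iexp (t * W \<omega>) \<partial>P) - of_real (p n * \<psi>)"
        by (simp only: Bochner_Integration.integral_diff[OF iW iA] EA)
      also have "\<dots> = (\<integral>\<omega>. indicator A \<omega> * iexp (t * W \<omega>) - indicator A \<omega> * iexp (t * Z \<omega>) \<partial>P)
          + ((\<integral>\<omega>. indicator A \<omega> * iexp (t * Z \<omega>) \<partial>P) - of_real (p n * \<psi>))"
        using iW iZ by simp
      finally have eq: "(\<integral>\<omega>. of_bool (n_top n \<omega> = m n) * (iexp (t * W \<omega>) - of_real \<psi>) \<partial>P) = \<dots>" .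
      have n1: "norm (\<integral>\<omega>. indicator A \<omega> * iexp (t * W \<omega>) - indicator A \<omega> * iexp (t * Z \<omega>) \<partial>P) \<le>
          (\<integral>\<omega>. \<delta> / 4 * indicator A \<omega> + 2 * indicator Bad \<omega> + 2 * indicator (A - G) \<omega> \<partial>P)"
      proof (rule order_trans[OF integral_norm_bound integral_mono])
        show "integrable P (\<lambda>\<omega>. norm (indicator A \<omega> * iexp (t * W \<omega>) - indicator A \<omega> * iexp (t * Z \<omega>)))"
          using iW iZ by (intro integrable_norm Bochner_Integration.integrable_diff)
        show "integrable P (\<lambda>\<omega>. \<delta> / 4 * indicator A \<omega> + 2 * indicator Bad \<omega> + 2 * indicator (A - G) \<omega>)"
          using A Bad G by (intro Bochner_Integration.integrable_add integrable_mult_right integrable_real_indicator) (auto simp: emeasure_eq_measure)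
        fix \<omega>
        show "norm (indicator A \<omega> * iexp (t * W \<omega>) - indicator A \<omega> * iexp (t * Z \<omega>)) \<le> \<delta> / 4 * indicator A \<omega> + 2 * indicator Bad \<omega> + 2 * indicator (A - G) \<omega>"
        proof (cases "\<omega> \<in> A")
          case True
          have le2: "norm (iexp (t * W \<omega>) - iexp (t * Z \<omega>)) \<le> 2"
            using norm_triangle_ineq4[of "iexp (t * W \<omega>)" "iexp (t * Z \<omega>)"] by simp
          show ?thesis
          proof (cases "\<omega> \<in> G \<and> \<omega> \<notin> Bad")
            case t: True
            have "norm (iexp (t * W \<omega>) - iexp (t * Z \<omega>)) \<le> \<bar>t * W \<omega> - t * Z \<omega>\<bar>" by (rule norm_iexp_diff)
            also have "\<dots> = \<bar>t\<bar> * \<bar>W \<omega> - Z \<omega>\<bar>" by (simp add: abs_mult flip: right_diff_distrib)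
            also have "\<dots> \<le> \<bar>t\<bar> * (3 * e)" using close True t by (intro mult_left_mono) auto
            also have "\<dots> \<le> \<delta> / 4" by (rule te)
            finally show ?thesis using True t by simp
          next
            case False
            then have "2 \<le> 2 * indicator Bad \<omega> + 2 * (indicator (A - G) \<omega> :: real)" using True by (auto simp: indicator_def)
            then show ?thesis using le2 True \<delta> by simp
          qed
        qed simp
      qed
      also have "(\<integral>\<omega>. \<delta> / 4 * indicator A \<omega> + 2 * indicator Bad \<omega> + 2 * indicator (A - G) \<omega> \<partial>P) =
          \<delta> / 4 * measure P A + 2 * measure P Bad + 2 * measure P (A - G)"
        using A Bad G by (simp add: emeasure_eq_measure)
      finally have n1': "norm (\<integral>\<omega>. indicator A \<omega> * iexp (t * W \<omega>) - indicator A \<omega> * iexp (t * Z \<omega>) \<partial>P)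
          \<le> \<delta> / 4 * p n + 2 * (\<delta> / 4 * p n) + 2 * measure P (A - G)"
        using pBad by (simp add: p_def A_def)
      have eqZ: "(\<integral>\<omega>. indicator A \<omega> * iexp (t * Z \<omega>) \<partial>P) = (\<integral>\<omega>. of_bool (n_top n \<omega> = m n) * iexp (t * (\<Sum>j=1..n. score n (H j \<omega>))) \<partial>P)"
        using obA by (intro Bochner_Integration.integral_cong) (auto simp: Z_def)
      have n2: "norm ((\<integral>\<omega>. indicator A \<omega> * iexp (t * Z \<omega>) \<partial>P) - of_real (p n * \<psi>)) \<le> \<delta> / 4 * p n"
        using elim(3) unfolding eqZ p_def \<psi>_def .
      show "norm (\<integral>\<omega>. of_bool (n_top n \<omega> = m n) * (iexp (t * (r n * (hill (X \<omega>) (k n) n - 1 / \<alpha>))) - of_real (exp (- t\<^sup>2 * (1 / \<alpha>\<^sup>2) / 2))) \<partial>P)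
        \<le> \<delta> * measure P {\<omega> \<in> space P. n_top n \<omega> = m n} + 2 * measure P ({\<omega> \<in> space P. n_top n \<omega> = m n} - G)"
        unfolding W_def[symmetric] \<psi>_def[symmetric] eq A_def[symmetric]
        using norm_triangle_ineq[of "\<integral>\<omega>. indicator A \<omega> * iexp (t * W \<omega>) - indicator A \<omega> * iexp (t * Z \<omega>) \<partial>P"
            "(\<integral>\<omega>. indicator A \<omega> * iexp (t * Z \<omega>) \<partial>P) - of_real (p n * \<psi>)"] n1' n2
        unfolding p_def A_def[symmetric] by linarith
    qed
  qed
qed

end

section \<open>Deviations, measurability and the normal characteristic function\<close>

lemma iid_second_moment:
  fixes \<phi> :: "real \<Rightarrow> real"
  assumes P: "prob_space P" and Y: "iid P Y" and \<phi> [measurable]: "\<phi> \<in> borel_measurable borel"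
    and bd: "\<And>y. \<bar>\<phi> y\<bar> \<le> B" and mean: "(\<integral>\<omega>. \<phi> (Y 0 \<omega>) \<partial>P) = 0"
  shows "(\<integral>\<omega>. (\<Sum>j=1..n. \<phi> (Y j \<omega>))\<^sup>2 \<partial>P) = real n * (\<integral>\<omega>. (\<phi> (Y 0 \<omega>))\<^sup>2 \<partial>P)"
proof -
  interpret prob_space P by fact
  have [measurable]: "Y i \<in> borel_measurable P" for i by (rule iid_measurable[OF P Y])
  have B0: "B \<ge> 0" using bd[of 0] by linarith
  have i1: "integrable P (\<lambda>\<omega>. \<phi> (Y j \<omega>))" for j by (rule integrable_const_bound[where B=B]) (use bd in auto)
  have i2: "integrable P (\<lambda>\<omega>. \<phi> (Y i \<omega>) * \<phi> (Y j \<omega>))" for i j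
    by (rule integrable_const_bound[where B="B * B"]) (use bd B0 in \<open>auto simp: abs_mult intro!: mult_mono\<close>)
  have off: "(\<integral>\<omega>. \<phi> (Y i \<omega>) * \<phi> (Y j \<omega>) \<partial>P) = 0" if "i \<noteq> j" for i j
  proof -
    have "indep_vars (\<lambda>_. borel) Y {i, j}" 
      using Y indep_vars_subset[of "\<lambda>_. borel" Y UNIV "{i,j}"] by (simp add: iid_def)
    then have "indep_vars (\<lambda>_. borel) (\<lambda>l \<omega>. \<phi> (Y l \<omega>)) {i, j}" by (rule indep_vars_compose2) simp
    then have "(\<integral>\<omega>. (\<Prod>l\<in>{i,j}. \<phi> (Y l \<omega>)) \<partial>P) = (\<Prod>l\<in>{i,j}. \<integral>\<omega>. \<phi> (Y l \<omega>) \<partial>P)"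
      by (intro indep_vars_lebesgue_integral i1) auto
    then show ?thesis using that iid_integral[OF P Y \<phi>, of i] mean by simp
  qed
  have diag: "(\<integral>\<omega>. \<phi> (Y i \<omega>) * \<phi> (Y i \<omega>) \<partial>P) = (\<integral>\<omega>. (\<phi> (Y 0 \<omega>))\<^sup>2 \<partial>P)" for i
    using iid_integral[OF P Y, of "\<lambda>y. (\<phi> y)\<^sup>2" i] by (simp add: power2_eq_square)
  have "(\<integral>\<omega>. (\<Sum>j=1..n. \<phi> (Y j \<omega>))\<^sup>2 \<partial>P) = (\<Sum>i=1..n. \<Sum>j=1..n. \<integral>\<omega>. \<phi> (Y i \<omega>) * \<phi> (Y j \<omega>) \<partial>P)"
    unfolding power2_eq_square sum_product
    by (subst Bochner_Integration.integral_sum, intro Bochner_Integration.integrable_sum i2,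
        intro sum.cong refl Bochner_Integration.integral_sum i2)
  also have "\<dots> = (\<Sum>i=1..n. \<Sum>j=1..n. if i = j then (\<integral>\<omega>. (\<phi> (Y 0 \<omega>))\<^sup>2 \<partial>P) else 0)"
    using off diag by (intro sum.cong) auto
  also have "\<dots> = real n * (\<integral>\<omega>. (\<phi> (Y 0 \<omega>))\<^sup>2 \<partial>P)" by simp
  finally show ?thesis .
qed

lemma prob_exceedances_deviation:
  assumes P: "prob_space P" and Y: "iid P Y" and a: "a > 0"
  shows "measure P {\<omega> \<in> space P. a \<le> \<bar>real (exceedances (\<lambda>j. Y j \<omega>) n c) - real n * tail P (Y 0) c\<bar>}
     \<le> real n * tail P (Y 0) c / a\<^sup>2"
proof -
  interpret prob_space P by fact
  have [measurable]: "Y i \<in> borel_measurable P" for i by (rule iid_measurable[OF P Y])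
  define q where "q = tail P (Y 0) c"
  have q: "0 \<le> q" "q \<le> 1" unfolding q_def using tail_nonneg tail_le_1[OF P] by auto
  define \<phi> where "\<phi> y = of_bool (y > c) - q" for y
  have [measurable]: "\<phi> \<in> borel_measurable borel" unfolding \<phi>_def by measurable
  have bd: "\<bar>\<phi> y\<bar> \<le> 1" for y using q by (auto simp: \<phi>_def)
  have E: "(\<integral>\<omega>. of_bool (Y 0 \<omega> > c) \<partial>P) = q" unfolding q_def tail_def
    by (subst integral_of_bool) (auto simp: finite_measure_axioms)
  have i: "integrable P (\<lambda>\<omega>. of_bool (Y 0 \<omega> > c) :: real)" by (rule integrable_const_bound[where B=1]) auto
  have mean: "(\<integral>\<omega>. \<phi> (Y 0 \<omega>) \<partial>P) = 0" unfolding \<phi>_def using i by (simp add: E prob_space)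
  have "(\<phi> y)\<^sup>2 = (1 - 2 * q) * of_bool (y > c) + q\<^sup>2" for y by (auto simp: \<phi>_def power2_eq_square algebra_simps)
  then have "(\<integral>\<omega>. (\<phi> (Y 0 \<omega>))\<^sup>2 \<partial>P) = (1 - 2 * q) * q + q\<^sup>2" using i by (simp add: E prob_space)
  also have "\<dots> \<le> q" using q by (simp add: power2_eq_square algebra_simps)
  finally have var: "(\<integral>\<omega>. (\<phi> (Y 0 \<omega>))\<^sup>2 \<partial>P) \<le> q" .
  define S where "S \<omega> = (\<Sum>j=1..n. \<phi> (Y j \<omega>))" for \<omega>
  have [measurable]: "S \<in> borel_measurable P" unfolding S_def by measurable
  have S: "S \<omega> = real (exceedances (\<lambda>j. Y j \<omega>) n c) - real n * q" for \<omega>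
  proof -
    have "S \<omega> = (\<Sum>j=1..n. (if Y j \<omega> > c then 1 else 0) - q)" unfolding S_def \<phi>_def by (intro sum.cong) auto
    then show ?thesis unfolding exceedances_eq_sum by (simp add: sum_subtractf)
  qed
  have iS: "integrable P (\<lambda>\<omega>. (S \<omega>)\<^sup>2)"
  proof (rule integrable_const_bound[where B="(real n)\<^sup>2"])
    have "\<bar>S \<omega>\<bar> \<le> real n" for \<omega>
      unfolding S_def using sum_norm_bound[of "{1..n}" "\<lambda>j. \<phi> (Y j \<omega>)" 1] bd by simp
    then show "AE \<omega> in P. norm ((S \<omega>)\<^sup>2) \<le> (real n)\<^sup>2" by (auto simp: power2_le_iff_abs_le)
  qed measurable
  define A where "A = {\<omega> \<in> space P. a \<le> \<bar>S \<omega>\<bar>}"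
  have A: "A \<in> sets P" unfolding A_def by measurable
  have "a\<^sup>2 * measure P A = (\<integral>\<omega>. a\<^sup>2 * indicator A \<omega> \<partial>P)" using A by simp
  also have "\<dots> \<le> (\<integral>\<omega>. (S \<omega>)\<^sup>2 \<partial>P)"
  proof (rule integral_mono[OF _ iS])
    show "integrable P (\<lambda>\<omega>. a\<^sup>2 * indicator A \<omega>)" using A by (simp add: emeasure_eq_measure)
    show "a\<^sup>2 * indicator A \<omega> \<le> (S \<omega>)\<^sup>2" for \<omega>
      using a power_mono[of a "\<bar>S \<omega>\<bar>" 2] by (auto simp: A_def indicator_def)
  qed
  also have "\<dots> = real n * (\<integral>\<omega>. (\<phi> (Y 0 \<omega>))\<^sup>2 \<partial>P)" unfolding S_def by (rule iid_second_moment[OF P Y _ bd mean]) measurable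
  also have "\<dots> \<le> real n * q" using var by (intro mult_left_mono) auto
  finally have "measure P A \<le> real n * q / a\<^sup>2" by (subst pos_le_divide_eq) (use a in \<open>auto simp: mult.commute\<close>)
  then show ?thesis by (simp add: A_def S q_def)
qed

lemma order_stat_measurable:
  assumes X: "\<And>j. (\<lambda>\<omega>. X \<omega> j) \<in> borel_measurable P" and i: "1 \<le> i" "i \<le> n"
  shows "(\<lambda>\<omega>. order_stat (X \<omega>) n i) \<in> borel_measurable P"
  unfolding borel_measurable_iff_greater
proof
  fix a
  note [measurable] = X
  have "(\<lambda>\<omega>. exceedances (\<lambda>j. X \<omega> j) n a) \<in> measurable P (count_space UNIV)"
    by (rule exceedances_measurable) measurable
  then have "{\<omega> \<in> space P. i \<le> exceedances (X \<omega>) n a} \<in> sets P" by simp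
  then show "{\<omega> \<in> space P. a < order_stat (X \<omega>) n i} \<in> sets P" by (simp add: order_stat_gt_iff[OF i])
qed

lemma hill_measurable:
  assumes X: "\<And>j. (\<lambda>\<omega>. X \<omega> j) \<in> borel_measurable P" and k: "k \<le> n"
  shows "(\<lambda>\<omega>. hill (X \<omega>) k n) \<in> borel_measurable P"
proof (cases "k = 0")
  case False
  have o: "(\<lambda>\<omega>. order_stat (X \<omega>) n i) \<in> borel_measurable P" if "i \<in> {1..k}" for i
    by (rule order_stat_measurable[OF X]) (use that k in auto)
  have [measurable]: "(\<lambda>\<omega>. order_stat (X \<omega>) n k) \<in> borel_measurable P" using o False by auto
  show ?thesis unfolding hill_def
    by (intro borel_measurable_times borel_measurable_const borel_measurable_sum)
       (measurable, auto intro: o)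
qed (simp add: hill_def)

text \<open>The value of \<open>k_hat\<close> when \<open>m\<close> observations exceed \<open>\<gamma>\<close> times the maximum.\<close>

definition k_of :: "real \<Rightarrow> nat \<Rightarrow> nat \<Rightarrow> nat" where
  "k_of \<beta> n m = nat \<lfloor>real n * (1 / real n * real m) powr \<beta>\<rfloor>"

lemma k_of_le:
  assumes "m \<le> n" "\<beta> > 0"
  shows "k_of \<beta> n m \<le> n"
proof (cases "n = 0")
  case False
  have "(1 / real n * real m) powr \<beta> \<le> 1" using assms False by (intro powr_le1) auto
  then have "real n * (1 / real n * real m) powr \<beta> \<le> real n" using mult_left_mono[of _ 1 "real n"] by simp
  then show ?thesis unfolding k_of_def by linarith
qed (simp add: k_of_def)

lemma k_hat_eq: "k_hat \<beta> \<gamma> x n = k_of \<beta> n (exceedances x n (\<gamma> * order_stat x n 1))"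
proof -
  have "(\<Sum>j=1..n. of_bool (x j > s)) = real (exceedances x n s)" for s
    unfolding exceedances_eq_sum by (intro sum.cong) auto
  then show ?thesis by (simp only: k_hat_def k_of_def)
qed

lemma exceedances_le: "exceedances x n s \<le> n"
proof -
  have "{j \<in> {1..n}. x j > s} \<subseteq> {1..n}" by auto
  from card_mono[OF _ this] show ?thesis by (simp add: exceedances_def)
qed

lemma k_hat_le: "\<beta> > 0 \<Longrightarrow> k_hat \<beta> \<gamma> x n \<le> n"
  unfolding k_hat_eq by (intro k_of_le exceedances_le)

lemma k_hat_measurable:
  assumes X: "\<And>j. (\<lambda>\<omega>. X \<omega> j) \<in> borel_measurable P"
  shows "(\<lambda>\<omega>. k_hat \<beta> \<gamma> (X \<omega>) n) \<in> measurable P (count_space UNIV)"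
proof (cases "n = 0")
  case False
  note [measurable] = X
  have [measurable]: "(\<lambda>\<omega>. order_stat (X \<omega>) n 1) \<in> borel_measurable P"
    by (rule order_stat_measurable[OF X]) (use False in auto)
  show ?thesis unfolding k_hat_def by measurable
qed (simp add: k_hat_def)

text \<open>As \<open>K\<close> takes countably many values, only fixed values of \<open>K\<close> matter; they are capped at \<open>n\<close> because
\<open>order_stat\<close> is meaningful only up to this index.\<close>

lemma hill_random_measurable:
  assumes X: "\<And>j. (\<lambda>\<omega>. X \<omega> j) \<in> borel_measurable P" and K: "K \<in> measurable P (count_space UNIV)"
    and le: "\<And>\<omega>. K \<omega> \<le> n"
  shows "(\<lambda>\<omega>. sqrt (real (K \<omega>)) * (hill (X \<omega>) (K \<omega>) n - a)) \<in> borel_measurable P"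
proof -
  have "(\<lambda>\<omega>. sqrt (real (min (K \<omega>) n)) * (hill (X \<omega>) (min (K \<omega>) n) n - a)) \<in> borel_measurable P"
  proof (rule measurable_compose_countable[OF _ K])
    fix i
    have [measurable]: "(\<lambda>\<omega>. hill (X \<omega>) (min i n) n) \<in> borel_measurable P" by (rule hill_measurable[OF X]) simp
    show "(\<lambda>\<omega>. sqrt (real (min i n)) * (hill (X \<omega>) (min i n) n - a)) \<in> borel_measurable P" by measurable
  qed
  then show ?thesis using le by (simp add: min_absorb1)
qed

text \<open>A centred normal law is a scaled standard one.\<close>

lemma char_normal_distribution:
  assumes \<sigma>: "\<sigma> > 0"
  shows "real_distribution (density lborel (\<lambda>x. ennreal (normal_density 0 \<sigma> x)))"
    and "char (density lborel (\<lambda>x. ennreal (normal_density 0 \<sigma> x))) t = of_real (exp (- ((\<sigma> * t)\<^sup>2) / 2))"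
proof -
  interpret S: prob_space std_normal_distribution by (rule prob_space_normal_density) simp
  have "distributed std_normal_distribution lborel (\<lambda>x. x) (\<lambda>x. ennreal (std_normal_density x))"
    unfolding distributed_def by (simp add: distr_id2[of lborel std_normal_distribution])
  from S.normal_density_affine[OF this, of \<sigma> 0] \<sigma>
  have d: "distributed std_normal_distribution lborel (\<lambda>x. \<sigma> * x) (\<lambda>x. ennreal (normal_density 0 \<sigma> x))"
    by simp
  have eq: "density lborel (\<lambda>x. ennreal (normal_density 0 \<sigma> x)) = distr std_normal_distribution borel (\<lambda>x. \<sigma> * x)"
    using d unfolding distributed_def by (metis (no_types, lifting) distr_cong sets_lborel)
  have m: "(\<lambda>x. \<sigma> * x) \<in> measurable std_normal_distribution borel" by simp
  show "real_distribution (density lborel (\<lambda>x. ennreal (normal_density 0 \<sigma> x)))"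
    unfolding eq by (rule S.real_distribution_distr[OF m])
  have "char (density lborel (\<lambda>x. ennreal (normal_density 0 \<sigma> x))) t = char std_normal_distribution (\<sigma> * t)"
    unfolding eq char_def by (subst integral_distr[OF m]) (auto simp: mult_ac)
  then show "char (density lborel (\<lambda>x. ennreal (normal_density 0 \<sigma> x))) t = of_real (exp (- ((\<sigma> * t)\<^sup>2) / 2))"
    by (simp add: char_std_normal_distribution)
qed

section \<open>The truncated sample\<close>

locale truncated_hill = tail_asymptotics P "H 0" M \<alpha> \<beta> \<gamma>
  for P :: "'a measure" and H :: "nat \<Rightarrow> 'a \<Rightarrow> real" and M \<alpha> \<beta> \<gamma> +
  fixes L :: "nat \<Rightarrow> 'a \<Rightarrow> real"
  assumes H: "iid P H" and L: "iid P L" and L_pos: "\<And>j. AE \<omega> in P. L j \<omega> > 0"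
    and indep: "prob_space.indep_var P (PiM UNIV (\<lambda>_. borel)) (\<lambda>\<omega> j. H j \<omega>)
                                (PiM UNIV (\<lambda>_. borel)) (\<lambda>\<omega> j. L j \<omega>)"
    and A: "assumption_A P (H 0) (L 0) M \<alpha> \<beta> \<gamma>"
begin

sublocale prob_space P by (rule prob)

lemma H_measurable [measurable]: "H j \<in> borel_measurable P" by (rule iid_measurable[OF prob H])
lemma L_measurable [measurable]: "L j \<in> borel_measurable P" by (rule iid_measurable[OF prob L])

abbreviation X where "X n \<omega> j \<equiv> trunc_obs H L M n j \<omega>"
definition N where "N n \<omega> = exceedances (\<lambda>j. H j \<omega>) n (c n)"

lemma X_measurable [measurable]: "(\<lambda>\<omega>. X n \<omega> j) \<in> borel_measurable P"
  unfolding trunc_obs_def by measurable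

lemma N_measurable [measurable]: "N n \<in> measurable P (count_space UNIV)"
  unfolding N_def by measurable

lemma c_less_M: "c n < M n"
  using \<gamma> M_pos[of n] by (simp add: c_def)

text \<open>The order of the expected number of observations by which the count that defines \<open>k\<close> could differ
from the number of exceedances of \<open>c\<close>; see the last term in the bound of \<open>prob_not_good\<close>.\<close>

lemma np_powr: "(\<lambda>n. real n * p n powr (2 - \<beta>)) \<longlonglongrightarrow> 0"
proof (rule tendsto_sandwich[OF _ _ tendsto_const])
  show "(\<lambda>n. real n * p n powr (2 - \<beta>) * (ln (M n))\<^sup>2) \<longlonglongrightarrow> 0"
    using C by (simp add: assumption_C_def p_def)
  show "eventually (\<lambda>n. 0 \<le> real n * p n powr (2 - \<beta>)) sequentially" by simp
  show "eventually (\<lambda>n. real n * p n powr (2 - \<beta>) \<le> real n * p n powr (2 - \<beta>) * (ln (M n))\<^sup>2) sequentially"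
    using eventually_greater[OF ln_M_lim, of 1]
  proof eventually_elim
    case (elim n)
    then have "1 \<le> (ln (M n))\<^sup>2" by (intro one_le_power) auto
    then have "real n * p n powr (2 - \<beta>) * 1 \<le> real n * p n powr (2 - \<beta>) * (ln (M n))\<^sup>2" by (intro mult_left_mono) auto
    then show ?case by simp
  qed
qed

lemma nqp_powr: "(\<lambda>n. real n * q n * p n powr (1 - \<beta>)) \<longlonglongrightarrow> 0"
proof -
  have "(\<lambda>n. q n / p n * (real n * p n powr (2 - \<beta>))) \<longlonglongrightarrow> \<gamma> powr (-\<alpha>) * 0"
    by (intro tendsto_mult q_over_p np_powr)
  moreover have "q n / p n * (real n * p n powr (2 - \<beta>)) = real n * q n * p n powr (1 - \<beta>)" for n
  proof -
    have "p n powr (2 - \<beta>) = p n powr (1 + (1 - \<beta>))" by simp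
    also have "\<dots> = p n * p n powr (1 - \<beta>)" using p_pos[of n] by (subst powr_add) simp
    finally show ?thesis using p_pos[of n] by simp
  qed
  ultimately show ?thesis by simp
qed

text \<open>The event on which the maximum of the sample determines the number of large observations without
error. The interval \<open>{c<..c (1 + \<epsilon>)}\<close> must be free of observations because \<open>\<gamma>\<close> times the maximum lies in it.\<close>

definition good where
  "good \<epsilon> n = {\<omega> \<in> space P. 0 < exceedances (\<lambda>j. H j \<omega>) n (M n) \<and>
     (\<forall>j\<in>{1..n}. 0 < L j \<omega> \<and> \<not> (H j \<omega> > M n \<and> L j \<omega> > \<epsilon> * M n) \<and> \<not> (c n < H j \<omega> \<and> H j \<omega> \<le> c n * (1 + \<epsilon>)))}"

lemma good_measurable [measurable]: "good \<epsilon> n \<in> sets P"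
  unfolding good_def by measurable

lemma prob_not_good:
  assumes "\<epsilon> > 0"
  shows "prob (space P - good \<epsilon> n) \<le> exp (- (real n * p n)) + real n * p n * tail P (L 0) (\<epsilon> * M n)
     + real n * (q n - F (c n * (1 + \<epsilon>)))"
proof -
  define B0 where "B0 = {\<omega> \<in> space P. exceedances (\<lambda>j. H j \<omega>) n (M n) = 0}"
  define B1 where "B1 j = {\<omega> \<in> space P. H j \<omega> > M n \<and> L j \<omega> > \<epsilon> * M n}" for j
  define B2 where "B2 j = {\<omega> \<in> space P. c n < H j \<omega> \<and> H j \<omega> \<le> c n * (1 + \<epsilon>)}" for j
  define B3 where "B3 j = {\<omega> \<in> space P. \<not> 0 < L j \<omega>}" for j
  have [measurable]: "B0 \<in> sets P" "B1 j \<in> sets P" "B2 j \<in> sets P" "B3 j \<in> sets P" for j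
    unfolding B0_def B1_def B2_def B3_def by measurable
  have b0: "prob B0 \<le> exp (- (real n * p n))"
  proof -
    have "prob B0 = (1 - p n) ^ n"
      unfolding B0_def p_def using prob_exceedances_eq[OF prob H, of n "M n" 0] by simp
    also have "\<dots> \<le> exp (- p n) ^ n"
      using tail_le_1[OF prob, of "H 0" "M n"] exp_ge_add_one_self[of "- p n"] by (intro power_mono) (auto simp: p_def)
    finally show ?thesis by (simp flip: exp_of_nat_mult)
  qed
  have tail_eq: "tail P (Z j) s = tail P (Z 0) s" if "iid P Z" for Z :: "nat \<Rightarrow> 'a \<Rightarrow> real" and j s
  proof -
    have [measurable]: "Z i \<in> borel_measurable P" for i by (rule iid_measurable[OF prob that])
    have "(\<integral>\<omega>. of_bool (Z i \<omega> > s) \<partial>P) = tail P (Z i) s" for i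
      unfolding tail_def by (subst integral_of_bool) (auto simp: finite_measure_axioms)
    then show ?thesis using iid_integral[OF prob that, of "\<lambda>y. of_bool (y > s) :: real" j] by simp
  qed
  have b1: "prob (B1 j) = p n * tail P (L 0) (\<epsilon> * M n)" for j
  proof -
    have "indep_var borel ((\<lambda>f. f j) \<circ> (\<lambda>\<omega> j. H j \<omega>)) borel ((\<lambda>f. f j) \<circ> (\<lambda>\<omega> j. L j \<omega>))"
      by (rule indep_var_compose[OF indep]) (auto intro!: measurable_component_singleton)
    then have iv: "indep_var borel (H j) borel (L j)" by (simp add: o_def)
    have "prob (B1 j) = prob {\<omega> \<in> space P. H j \<omega> \<in> {M n<..} \<and> L j \<omega> \<in> {\<epsilon> * M n<..}}" by (simp add: B1_def)
    also have "\<dots> = prob ((\<lambda>\<omega>. (H j \<omega>, L j \<omega>)) -` ({M n<..} \<times> {\<epsilon> * M n<..}) \<inter> space P)"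
      by (rule arg_cong[where f=prob]) auto
    also have "\<dots> = prob (H j -` {M n<..} \<inter> space P) * prob (L j -` {\<epsilon> * M n<..} \<inter> space P)"
      by (rule indep_varD[OF iv]) auto
    also have "\<dots> = tail P (H j) (M n) * tail P (L j) (\<epsilon> * M n)"
      unfolding tail_def by (intro arg_cong2[where f="(*)"] arg_cong[where f=prob]) auto
    finally show ?thesis by (simp add: tail_eq[OF H, of j] tail_eq[OF L, of j] p_def)
  qed
  have b2: "prob (B2 j) = q n - F (c n * (1 + \<epsilon>))" for j
  proof -
    have "c n * 1 \<le> c n * (1 + \<epsilon>)" using assms \<gamma> M_pos[of n] by (intro mult_left_mono) (auto simp: c_def)
    then have "prob (B2 j) = tail P (H j) (c n) - tail P (H j) (c n * (1 + \<epsilon>))"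
      unfolding B2_def by (intro tail_diff prob) auto
    then show ?thesis by (simp add: tail_eq[OF H, of j] q_def c_def)
  qed
  have b3: "prob (B3 j) = 0" for j
  proof -
    have "AE \<omega> in P. \<omega> \<notin> B3 j" using L_pos[of j] by eventually_elim (simp add: B3_def)
    then show ?thesis by (subst measure_eq_0_null_sets) (auto simp: AE_iff_null_sets)
  qed
  have sub: "space P - good \<epsilon> n \<subseteq> B0 \<union> (\<Union>j\<in>{1..n}. B1 j \<union> B2 j \<union> B3 j)"
    unfolding good_def B0_def B1_def B2_def B3_def by auto
  have "prob (space P - good \<epsilon> n) \<le> prob (B0 \<union> (\<Union>j\<in>{1..n}. B1 j \<union> B2 j \<union> B3 j))"
    by (rule finite_measure_mono[OF sub]) measurable
  also have "\<dots> \<le> prob B0 + prob (\<Union>j\<in>{1..n}. B1 j \<union> B2 j \<union> B3 j)" by (rule measure_Un_le) measurable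
  also have "prob (\<Union>j\<in>{1..n}. B1 j \<union> B2 j \<union> B3 j) \<le> (\<Sum>j\<in>{1..n}. prob (B1 j \<union> B2 j \<union> B3 j))"
    by (rule measure_UNION_le) auto
  also have "\<dots> \<le> (\<Sum>j\<in>{1..n}. p n * tail P (L 0) (\<epsilon> * M n) + (q n - F (c n * (1 + \<epsilon>))))"
  proof (rule sum_mono)
    fix j
    have "prob (B1 j \<union> B2 j \<union> B3 j) \<le> prob (B1 j \<union> B2 j) + prob (B3 j)" by (rule measure_Un_le) measurable
    also have "prob (B1 j \<union> B2 j) \<le> prob (B1 j) + prob (B2 j)" by (rule measure_Un_le) measurable
    finally show "prob (B1 j \<union> B2 j \<union> B3 j) \<le> p n * tail P (L 0) (\<epsilon> * M n) + (q n - F (c n * (1 + \<epsilon>)))"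
      by (simp add: b1 b2 b3)
  qed
  finally show ?thesis using b0 by (simp add: algebra_simps)
qed

text \<open>Compares the tail at \<open>c\<close> and \<open>c (1 + \<epsilon>)\<close> by separating the power, which contributes at most \<open>\<alpha> \<epsilon>\<close>,
from the slowly varying part.\<close>

lemma slow_part_gap:
  assumes \<epsilon>: "\<epsilon> \<ge> 0"
  shows "q n - F (c n * (1 + \<epsilon>)) \<le> q n * (\<alpha> * \<epsilon> + \<bar>slow_part P (H 0) \<alpha> (c n * (1 + \<epsilon>)) / slow_part P (H 0) \<alpha> (c n) - 1\<bar>)"
proof -
  define \<rho> where "\<rho> = slow_part P (H 0) \<alpha> (c n * (1 + \<epsilon>)) / slow_part P (H 0) \<alpha> (c n) - 1"
  define z where "z = (1 + \<epsilon>) powr (-\<alpha>)"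
  have cp: "c n > 0" using \<gamma> M_pos[of n] by (simp add: c_def)
  have qc: "q n = F (c n)" by (simp add: q_def c_def)
  have "1 + \<rho> = (1 + \<epsilon>) powr \<alpha> * F (c n * (1 + \<epsilon>)) / q n"
    using cp \<epsilon> by (simp add: \<rho>_def slow_part_def powr_mult qc)
  then have eq: "F (c n * (1 + \<epsilon>)) = q n * ((1 + \<rho>) * z)"
    using q_pos[of n] \<epsilon> by (simp add: z_def powr_minus field_simps)
  have z1: "z \<le> 1" using powr_mono[of "-\<alpha>" 0 "1 + \<epsilon>"] \<alpha> \<epsilon> by (simp add: z_def)
  have z0: "z \<ge> 0" by (simp add: z_def)
  have "z = exp (- (\<alpha> * ln (1 + \<epsilon>)))" using \<epsilon> by (simp add: z_def powr_def)
  then have "z \<ge> 1 - \<alpha> * ln (1 + \<epsilon>)" using exp_ge_add_one_self[of "- (\<alpha> * ln (1 + \<epsilon>))"] by simp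
  moreover have "\<alpha> * ln (1 + \<epsilon>) \<le> \<alpha> * \<epsilon>" using \<alpha> \<epsilon> ln_add_one_self_le_self[of \<epsilon>] by (intro mult_left_mono) auto
  ultimately have z2: "1 - z \<le> \<alpha> * \<epsilon>" by linarith
  have "\<bar>\<rho>\<bar> * z \<le> \<bar>\<rho>\<bar> * 1" using z1 by (intro mult_left_mono) auto
  moreover have "- (\<rho> * z) \<le> \<bar>\<rho>\<bar> * z" using z0 by (metis abs_ge_minus_self abs_mult abs_of_nonneg)
  ultimately have "1 - (1 + \<rho>) * z \<le> \<alpha> * \<epsilon> + \<bar>\<rho>\<bar>" using z2 by (simp add: distrib_right)
  then have "q n * (1 - (1 + \<rho>) * z) \<le> q n * (\<alpha> * \<epsilon> + \<bar>\<rho>\<bar>)" using q_pos[of n] by (intro mult_left_mono) auto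
  then show ?thesis unfolding eq \<rho>_def[symmetric] by (simp add: right_diff_distrib)
qed

text \<open>The expected number of observations in the forbidden interval is at most
\<open>n q (\<alpha> \<epsilon> + \<bar>\<rho>\<bar>)\<close>, where \<open>\<rho>\<close> is the relative change of the slowly varying part. As \<open>\<epsilon>\<close> and \<open>\<rho>\<close> are \<open>o(p powr (1 - \<beta>))\<close>
and \<open>n q p powr (1 - \<beta>)\<close> vanishes, there are none with high probability. The \<open>\<epsilon>\<close> of \<open>assumption_A\<close>
is eventually positive, since otherwise \<open>P(L > \<epsilon> M) = 1\<close> and \<open>n p\<close> would vanish.\<close>

lemma good_limit:
  obtains \<epsilon> where "(\<lambda>n. prob (space P - good (\<epsilon> n) n)) \<longlonglongrightarrow> 0"
    "eventually (\<lambda>n. 0 < \<epsilon> n \<and> \<epsilon> n \<le> 1 \<and> \<gamma> * (1 + \<epsilon> n) \<le> 1) sequentially"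
proof -
  obtain \<epsilon> where A1: "(\<lambda>n. p n powr (-(1 - \<beta>)) * \<epsilon> n) \<longlonglongrightarrow> 0"
    and A2: "(\<lambda>n. real n * p n * tail P (L 0) (\<epsilon> n * M n)) \<longlonglongrightarrow> 0"
    and A3: "(\<lambda>n. p n powr (-(1 - \<beta>)) * (slow_part P (H 0) \<alpha> (c n * (1 + \<epsilon> n)) / slow_part P (H 0) \<alpha> (c n) - 1)) \<longlonglongrightarrow> 0"
    using A unfolding assumption_A_def p_def c_def by blast
  have pp: "1 \<le> p n powr (-(1 - \<beta>))" for n
    using powr_mono'[of "-(1 - \<beta>)" 0 "p n"] p_pos[of n] tail_le_1[OF prob, of "H 0" "M n"] \<beta> by (simp add: p_def)
  have "\<epsilon> \<longlonglongrightarrow> 0"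
  proof (rule tendsto_0_le[OF A1, of _ 1])
    show "eventually (\<lambda>n. norm (\<epsilon> n) \<le> norm (p n powr (-(1 - \<beta>)) * \<epsilon> n) * 1) sequentially"
    proof (rule always_eventually, rule allI)
      fix n
      have "1 * \<bar>\<epsilon> n\<bar> \<le> p n powr (-(1 - \<beta>)) * \<bar>\<epsilon> n\<bar>" using pp by (intro mult_right_mono) auto
      then show "norm (\<epsilon> n) \<le> norm (p n powr (-(1 - \<beta>)) * \<epsilon> n) * 1" by (simp add: abs_mult)
    qed
  qed
  then have "eventually (\<lambda>n. \<epsilon> n < min 1 (1 / \<gamma> - 1)) sequentially"
    using \<gamma> by (intro order_tendstoD(2)) auto
  moreover have pos: "eventually (\<lambda>n. 0 < \<epsilon> n) sequentially"
  proof -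
    have "eventually (\<lambda>n. real n * p n * tail P (L 0) (\<epsilon> n * M n) < 1) sequentially"
      using A2 by (intro order_tendstoD(2)) auto
    then show ?thesis using eventually_greater[OF np_lim, of 1]
    proof eventually_elim
      case (elim n)
      show ?case
      proof (rule ccontr)
        assume "\<not> 0 < \<epsilon> n"
        then have "\<epsilon> n * M n \<le> 0" using M_pos[of n] by (simp add: mult_nonpos_nonneg not_less)
        then have imp: "0 < L 0 \<omega> \<longrightarrow> L 0 \<omega> > \<epsilon> n * M n" for \<omega> by linarith
        have AE: "AE \<omega> in P. L 0 \<omega> > \<epsilon> n * M n"
          by (rule AE_mp[OF L_pos[of 0]], rule AE_I2, rule imp)
        have "tail P (L 0) (\<epsilon> n * M n) = 1"
          unfolding tail_def by (rule prob_Collect_eq_1[THEN iffD2, OF _ AE]) measurable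
        then show False using elim by simp
      qed
    qed
  qed
  ultimately have ev: "eventually (\<lambda>n. 0 < \<epsilon> n \<and> \<epsilon> n \<le> 1 \<and> \<gamma> * (1 + \<epsilon> n) \<le> 1) sequentially"
    by eventually_elim (use \<gamma> in \<open>auto simp: field_simps\<close>)
  define \<rho> where "\<rho> n = slow_part P (H 0) \<alpha> (c n * (1 + \<epsilon> n)) / slow_part P (H 0) \<alpha> (c n) - 1" for n
  define g where "g n = exp (- (real n * p n)) + real n * p n * tail P (L 0) (\<epsilon> n * M n) +
      real n * q n * p n powr (1 - \<beta>) * (\<alpha> * (p n powr (-(1 - \<beta>)) * \<epsilon> n) + \<bar>p n powr (-(1 - \<beta>)) * \<rho> n\<bar>)" for n
  have "(\<lambda>n. exp (- (real n * p n))) \<longlonglongrightarrow> 0"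
    by (rule filterlim_compose[OF exp_at_bot filterlim_compose[OF filterlim_uminus_at_bot_at_top np_lim]])
  then have "g \<longlonglongrightarrow> 0 + 0 + 0 * (\<alpha> * 0 + \<bar>0\<bar>)"
    unfolding g_def using A3 unfolding \<rho>_def[symmetric]
    by (intro tendsto_add tendsto_mult tendsto_rabs A1 A2 nqp_powr tendsto_const)
  then have g: "g \<longlonglongrightarrow> 0" by simp
  have "(\<lambda>n. prob (space P - good (\<epsilon> n) n)) \<longlonglongrightarrow> 0"
  proof (rule tendsto_sandwich[OF _ _ tendsto_const g])
    show "eventually (\<lambda>n. 0 \<le> prob (space P - good (\<epsilon> n) n)) sequentially" by simp
    show "eventually (\<lambda>n. prob (space P - good (\<epsilon> n) n) \<le> g n) sequentially"
      using pos
    proof eventually_elim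
      case (elim n)
      have inv: "p n powr (1 - \<beta>) * p n powr (-(1 - \<beta>)) = 1" using p_pos[of n] by (simp flip: powr_add)
      have "real n * (q n - F (c n * (1 + \<epsilon> n))) \<le> real n * (q n * (\<alpha> * \<epsilon> n + \<bar>\<rho> n\<bar>))"
        unfolding \<rho>_def using elim by (intro mult_left_mono slow_part_gap) auto
      also have "\<dots> = real n * q n * (p n powr (1 - \<beta>) * p n powr (-(1 - \<beta>))) * (\<alpha> * \<epsilon> n + \<bar>\<rho> n\<bar>)"
        unfolding inv by simp
      also have "\<dots> = real n * q n * p n powr (1 - \<beta>) * (\<alpha> * (p n powr (-(1 - \<beta>)) * \<epsilon> n) + \<bar>p n powr (-(1 - \<beta>)) * \<rho> n\<bar>)"
        by (simp add: abs_mult algebra_simps)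
      finally show ?case using prob_not_good[OF elim, of n] by (simp add: g_def)
    qed
  qed
  with ev show thesis using that by blast
qed

lemma good_sample:
  assumes w: "\<omega> \<in> good \<epsilon> n" and \<epsilon>: "0 < \<epsilon>" "\<epsilon> \<le> 1" "\<gamma> * (1 + \<epsilon>) \<le> 1"
  shows "k_hat \<beta> \<gamma> (X n \<omega>) n = k_of \<beta> n (N n \<omega>)"
    and "\<And>j. j \<in> {1..n} \<Longrightarrow> if H j \<omega> \<le> c n then X n \<omega> j = H j \<omega> else c n < X n \<omega> j \<and> X n \<omega> j \<le> 2 * M n"
proof -
  have cM: "c n < M n" by (rule c_less_M)
  have Mp: "M n > 0" by (rule M_pos)
  have eM: "0 < \<epsilon> * M n" "\<epsilon> * M n \<le> M n" using \<epsilon> Mp mult_right_mono[of \<epsilon> 1 "M n"] by auto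
  have g: "0 < L j \<omega>" "\<not> (H j \<omega> > M n \<and> L j \<omega> > \<epsilon> * M n)" "\<not> (c n < H j \<omega> \<and> H j \<omega> \<le> c n * (1 + \<epsilon>))"
    if "j \<in> {1..n}" for j using w that unfolding good_def by blast+
  obtain i where i: "i \<in> {1..n}" "H i \<omega> > M n"
    using w unfolding good_def exceedances_def by (auto simp: card_gt_0_iff)
  have Xle: "X n \<omega> j = H j \<omega>" if "H j \<omega> \<le> M n" for j using that by (simp add: trunc_obs_def)
  have Xgt: "M n < X n \<omega> j" "X n \<omega> j \<le> M n * (1 + \<epsilon>)" if "H j \<omega> > M n" "j \<in> {1..n}" for j
    using that g[of j] by (auto simp: trunc_obs_def algebra_simps)
  have top1: "M n < order_stat (X n \<omega>) n 1"
  proof -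
    have "i \<in> {j \<in> {1..n}. X n \<omega> j > M n}" using i Xgt(1)[of i] by simp
    then have "0 < exceedances (X n \<omega>) n (M n)" unfolding exceedances_def by (subst card_gt_0_iff) auto
    then show ?thesis using i by (subst order_stat_gt_iff) auto
  qed
  have top2: "order_stat (X n \<omega>) n 1 \<le> M n * (1 + \<epsilon>)"
  proof -
    have "X n \<omega> j \<le> M n * (1 + \<epsilon>)" if "j \<in> {1..n}" for j
      using Xgt(2)[of j] Xle[of j] that eM by (cases "H j \<omega> > M n") (auto simp: algebra_simps)
    then have "{j \<in> {1..n}. X n \<omega> j > M n * (1 + \<epsilon>)} = {}" by force
    then have "exceedances (X n \<omega>) n (M n * (1 + \<epsilon>)) = 0" by (simp only: exceedances_def card.empty)
    then have "\<not> 1 \<le> exceedances (X n \<omega>) n (M n * (1 + \<epsilon>))" by simp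
    then show ?thesis using i order_stat_gt_iff[of 1 n "M n * (1 + \<epsilon>)" "X n \<omega>"] by auto
  qed
  define s where "s = \<gamma> * order_stat (X n \<omega>) n 1"
  have s1: "c n < s" using top1 \<gamma> by (simp add: s_def c_def)
  have s2: "s \<le> c n * (1 + \<epsilon>)" using mult_left_mono[OF top2, of \<gamma>] \<gamma> by (simp add: s_def c_def mult.assoc)
  have s3: "s \<le> M n"
  proof -
    have "c n * (1 + \<epsilon>) = \<gamma> * (1 + \<epsilon>) * M n" by (simp add: c_def)
    moreover have "\<gamma> * (1 + \<epsilon>) * M n \<le> 1 * M n" using \<epsilon>(3) Mp by (intro mult_right_mono) auto
    ultimately show ?thesis using s2 by linarith
  qed
  have "X n \<omega> j > s \<longleftrightarrow> H j \<omega> > c n" if j: "j \<in> {1..n}" for j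
  proof (cases "H j \<omega> > M n")
    case True
    then show ?thesis using Xgt(1)[OF True j] s3 cM by simp
  next
    case False
    then show ?thesis using Xle[of j] g(3)[OF j] s1 s2 by auto
  qed
  then have "exceedances (X n \<omega>) n s = N n \<omega>" unfolding exceedances_def N_def by (intro arg_cong[where f=card]) auto
  then show "k_hat \<beta> \<gamma> (X n \<omega>) n = k_of \<beta> n (N n \<omega>)" unfolding k_hat_eq s_def by simp
  show "if H j \<omega> \<le> c n then X n \<omega> j = H j \<omega> else c n < X n \<omega> j \<and> X n \<omega> j \<le> 2 * M n" if j: "j \<in> {1..n}" for j
  proof (cases "H j \<omega> > M n")
    case True
    then show ?thesis using Xgt[OF True j] cM eM by (auto simp: algebra_simps)
  next
    case False
    then show ?thesis using Xle[of j] Mp by auto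
  qed
qed

text \<open>Any exponent between \<open>1/2\<close>, where Chebyshev's inequality stops, and \<open>1\<close>, where the ratio to the mean
stops converging to \<open>1\<close>, would do.\<close>

definition window where "window n = {m. \<bar>real m - real n * q n\<bar> \<le> (real n * q n) powr (3/4)}"

lemma window_limit: "(\<lambda>n. prob {\<omega> \<in> space P. N n \<omega> \<notin> window n}) \<longlonglongrightarrow> 0"
proof (rule tendsto_sandwich[OF _ _ tendsto_const])
  show "eventually (\<lambda>n. 0 \<le> prob {\<omega> \<in> space P. N n \<omega> \<notin> window n}) sequentially" by simp
  have "((\<lambda>x::real. x powr (-1/2)) \<longlongrightarrow> 0) at_top" by (rule tendsto_neg_powr[OF _ filterlim_ident]) simp
  from filterlim_compose[OF this nq_lim] show "(\<lambda>n. (real n * q n) powr (-1/2)) \<longlonglongrightarrow> 0" .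
  show "eventually (\<lambda>n. prob {\<omega> \<in> space P. N n \<omega> \<notin> window n} \<le> (real n * q n) powr (-1/2)) sequentially"
    using n_pos
  proof eventually_elim
    case (elim n)
    define x where "x = real n * q n"
    have x: "x > 0" using elim q_pos[of n] by (simp add: x_def)
    define a where "a = x powr (3/4)"
    have a: "a > 0" using x by (simp add: a_def)
    have "prob {\<omega> \<in> space P. N n \<omega> \<notin> window n} \<le> prob {\<omega> \<in> space P. a \<le> \<bar>real (N n \<omega>) - real n * F (c n)\<bar>}"
      by (rule finite_measure_mono) (auto simp: window_def a_def x_def q_def c_def)
    also have "\<dots> \<le> real n * F (c n) / a\<^sup>2" unfolding N_def by (rule prob_exceedances_deviation[OF prob H a])
    also have "real n * F (c n) = x" by (simp add: x_def q_def c_def)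
    also have "a\<^sup>2 = x powr (3/2)" by (simp add: a_def power2_eq_square flip: powr_add)
    also have "x / x powr (3/2) = x powr (-1/2)" using x powr_diff[of x 1 "3/2"] by simp
    finally show ?case by (simp add: x_def)
  qed
qed

lemma window_ratio:
  assumes "eventually (\<lambda>n. m n \<in> window n) sequentially"
  shows "(\<lambda>n. real (m n) / (real n * q n)) \<longlonglongrightarrow> 1"
proof -
  have "((\<lambda>x::real. x powr (-1/4)) \<longlongrightarrow> 0) at_top" by (rule tendsto_neg_powr[OF _ filterlim_ident]) simp
  from filterlim_compose[OF this nq_lim] have l: "(\<lambda>n. (real n * q n) powr (-1/4)) \<longlonglongrightarrow> 0" .
  have "(\<lambda>n. real (m n) / (real n * q n) - 1) \<longlonglongrightarrow> 0"
  proof (rule tendsto_0_le[OF l, of _ 1])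
    show "eventually (\<lambda>n. norm (real (m n) / (real n * q n) - 1) \<le> norm ((real n * q n) powr (-1/4)) * 1) sequentially"
      using assms n_pos
    proof eventually_elim
      case (elim n)
      define x where "x = real n * q n"
      have x: "x > 0" using elim q_pos[of n] by (simp add: x_def)
      have "\<bar>real (m n) / x - 1\<bar> = \<bar>real (m n) - x\<bar> / x" using x by (simp add: field_simps abs_divide)
      also have "\<dots> \<le> x powr (3/4) / x" using elim x by (intro divide_right_mono) (auto simp: window_def x_def)
      also have "\<dots> = x powr (-1/4)" using x powr_diff[of x "3/4" 1] by simp
      finally show ?case by (simp add: x_def)
    qed
  qed
  then show ?thesis by (simp add: LIM_zero_iff)
qed

lemma k_of_ratio:
  assumes m: "(\<lambda>n. real (m n) / (real n * q n)) \<longlonglongrightarrow> 1"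
  shows "(\<lambda>n. real (k_of \<beta> n (m n)) / (real n * q n powr \<beta>)) \<longlonglongrightarrow> 1"
proof -
  have up: "(\<lambda>n. (real (m n) / (real n * q n)) powr \<beta>) \<longlonglongrightarrow> 1 powr \<beta>"
    by (intro tendsto_powr m tendsto_const) simp
  have "(\<lambda>n. 1 / (real n * q n powr \<beta>)) \<longlonglongrightarrow> 0" by (rule real_tendsto_divide_at_top[OF tendsto_const nqb_lim])
  from tendsto_diff[OF up this]
  have lo: "(\<lambda>n. (real (m n) / (real n * q n)) powr \<beta> - 1 / (real n * q n powr \<beta>)) \<longlonglongrightarrow> 1" by simp
  have eq: "real n * (1 / real n * real (m n)) powr \<beta> / (real n * q n powr \<beta>) = (real (m n) / (real n * q n)) powr \<beta>" 
    if "n > 0" for n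
    using that q_pos[of n] by (simp add: powr_divide powr_mult)
  have fl: "x - 1 \<le> real (nat \<lfloor>x\<rfloor>)" "x \<ge> 0 \<Longrightarrow> real (nat \<lfloor>x\<rfloor>) \<le> x" for x :: real by linarith+
  show ?thesis
  proof (rule tendsto_sandwich[OF _ _ lo])
    show "(\<lambda>n. (real (m n) / (real n * q n)) powr \<beta>) \<longlonglongrightarrow> 1" using up by simp
    show "eventually (\<lambda>n. (real (m n) / (real n * q n)) powr \<beta> - 1 / (real n * q n powr \<beta>) \<le> real (k_of \<beta> n (m n)) / (real n * q n powr \<beta>)) sequentially"
      using n_pos
    proof eventually_elim
      case (elim n)
      show ?case unfolding eq[OF elim, symmetric] diff_divide_distrib[symmetric] k_of_def
        by (intro divide_right_mono fl) auto
    qed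
    show "eventually (\<lambda>n. real (k_of \<beta> n (m n)) / (real n * q n powr \<beta>) \<le> (real (m n) / (real n * q n)) powr \<beta>) sequentially"
      using n_pos
    proof eventually_elim
      case (elim n)
      show ?case unfolding eq[OF elim, symmetric] k_of_def
        by (intro divide_right_mono fl) auto
    qed
  qed
qed

definition limit_char where "limit_char t = exp (- t\<^sup>2 * (1 / \<alpha>\<^sup>2) / 2)"
definition hill_error where "hill_error n k \<omega> = sqrt (real k) * (hill (X n \<omega>) k n - 1 / \<alpha>)"

text \<open>Uniformity in \<open>m\<close> follows from the result for single sequences, applied to a sequence that
picks a value violating the bound whenever there is one.\<close>

lemma conditional_char_window:
  assumes good: "eventually (\<lambda>n. 0 < \<epsilon> n \<and> \<epsilon> n \<le> 1 \<and> \<gamma> * (1 + \<epsilon> n) \<le> 1) sequentially" and \<delta>: "\<delta> > 0"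
  shows "eventually (\<lambda>n. \<forall>m\<in>window n. m \<le> n \<longrightarrow>
     norm (\<integral>\<omega>. of_bool (N n \<omega> = m) * (iexp (t * hill_error n (k_of \<beta> n m) \<omega>) - of_real (limit_char t)) \<partial>P)
     \<le> \<delta> * prob {\<omega> \<in> space P. N n \<omega> = m} + 2 * prob ({\<omega> \<in> space P. N n \<omega> = m} - good (\<epsilon> n) n)) sequentially"
proof -
  define bound where "bound n m \<longleftrightarrow> norm (\<integral>\<omega>. of_bool (N n \<omega> = m) * (iexp (t * hill_error n (k_of \<beta> n m) \<omega>) - of_real (limit_char t)) \<partial>P)
     \<le> \<delta> * prob {\<omega> \<in> space P. N n \<omega> = m} + 2 * prob ({\<omega> \<in> space P. N n \<omega> = m} - good (\<epsilon> n) n)" for n m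
  define bad where "bad n m \<longleftrightarrow> m \<in> window n \<and> m \<le> n \<and> \<not> bound n m" for n m
  \<comment> \<open>The default value, the mean rounded down, lies in the window as soon as the mean exceeds \<open>1\<close>.\<close>
  define m where "m n = (if \<exists>m. bad n m then SOME m. bad n m else nat \<lfloor>real n * q n\<rfloor>)" for n
  have mbad: "bad n (m n)" if "\<exists>m. bad n m" for n
    using that someI_ex[OF that] by (simp add: m_def)
  have mn: "m n \<le> n" for n
  proof (cases "\<exists>m. bad n m")
    case True
    then show ?thesis using mbad by (simp add: bad_def)
  next
    case False
    have "q n \<le> 1" unfolding q_def by (rule tail_le_1[OF prob])
    then have "real n * q n \<le> real n * 1" by (intro mult_left_mono) auto
    then have "nat \<lfloor>real n * q n\<rfloor> \<le> n" by linarith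
    then show ?thesis using False by (simp add: m_def)
  qed
  have "eventually (\<lambda>n. m n \<in> window n) sequentially"
    using eventually_greater[OF nq_lim, of 1]
  proof eventually_elim
    case (elim n)
    show ?case
    proof (cases "\<exists>m. bad n m")
      case True
      then show ?thesis using mbad by (simp add: bad_def)
    next
      case False
      have "\<bar>real (nat \<lfloor>real n * q n\<rfloor>) - real n * q n\<bar> \<le> 1" using elim by linarith
      also have "1 \<le> (real n * q n) powr (3/4)" using elim by (intro ge_one_powr_ge_zero) auto
      finally show ?thesis using False by (simp add: m_def window_def)
    qed
  qed
  then have mr: "(\<lambda>n. real (m n) / (real n * q n)) \<longlonglongrightarrow> 1" by (rule window_ratio)
  interpret CH: conditioned_hill P H M \<alpha> \<beta> \<gamma> "\<lambda>n. k_of \<beta> n (m n)" m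
    by unfold_locales (use k_of_ratio[OF mr] H mr in auto)
  have "eventually (\<lambda>n. bound n (m n)) sequentially"
    using CH.conditional_char_limit[OF \<delta>, of t] good
  proof eventually_elim
    case (elim n)
    have "k_of \<beta> n (m n) \<le> n" using \<beta> by (intro k_of_le mn) auto
    then have "(\<lambda>\<omega>. hill (X n \<omega>) (k_of \<beta> n (m n)) n) \<in> borel_measurable P"
      by (intro hill_measurable) measurable
    then show ?case
      using elim(1)[rule_format, of "good (\<epsilon> n) n" "X n"] good_sample(2)[of _ "\<epsilon> n" n] elim(2)
      unfolding bound_def N_def hill_error_def limit_char_def by simp
  qed
  then show ?thesis
  proof eventually_elim
    case (elim n)
    then have "\<not> bad n (m n)" by (simp add: bad_def)
    then have "\<not> (\<exists>m. bad n m)" using mbad by blast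
    then show ?case unfolding bad_def bound_def by blast
  qed
qed

text \<open>The conditional bounds are summed over \<open>m\<close>. Their relative form makes the sum of the main errors at
most \<open>\<delta>\<close>; the complement of the good event and the values outside the window are added crudely.\<close>

lemma char_limit:
  "(\<lambda>n. \<integral>\<omega>. iexp (t * hill_error n (k_hat \<beta> \<gamma> (X n \<omega>) n) \<omega>) \<partial>P) \<longlonglongrightarrow> of_real (limit_char t)"
proof -
  obtain \<epsilon> where G: "(\<lambda>n. prob (space P - good (\<epsilon> n) n)) \<longlonglongrightarrow> 0"
    and ev: "eventually (\<lambda>n. 0 < \<epsilon> n \<and> \<epsilon> n \<le> 1 \<and> \<gamma> * (1 + \<epsilon> n) \<le> 1) sequentially"
    by (rule good_limit)
  define \<psi> where "\<psi> = limit_char t"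
  have \<psi>: "0 \<le> \<psi>" "\<psi> \<le> 1" by (auto simp: \<psi>_def limit_char_def)
  define K where "K n \<omega> = k_hat \<beta> \<gamma> (X n \<omega>) n" for n \<omega>
  have K [measurable]: "K n \<in> measurable P (count_space UNIV)" for n 
    unfolding K_def by (rule k_hat_measurable) measurable
  have W [measurable]: "(\<lambda>\<omega>. hill_error n (K n \<omega>) \<omega>) \<in> borel_measurable P" for n
    unfolding hill_error_def by (rule hill_random_measurable[OF _ K]) (use \<beta> in \<open>auto simp: K_def k_hat_le\<close>)
  have Wm [measurable]: "(\<lambda>\<omega>. hill_error n (k_of \<beta> n m) \<omega>) \<in> borel_measurable P" if "m \<le> n" for n m
  proof -
    have [measurable]: "(\<lambda>\<omega>. hill (X n \<omega>) (k_of \<beta> n m) n) \<in> borel_measurable P"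
      by (rule hill_measurable) (use k_of_le[OF that] \<beta> in auto)
    show ?thesis unfolding hill_error_def by measurable
  qed
  define A where "A n m = {\<omega> \<in> space P. N n \<omega> = m}" for n m
  have [measurable]: "A n m \<in> sets P" for n m unfolding A_def by measurable
  have Nle: "N n \<omega> \<le> n" for n \<omega> unfolding N_def by (rule exceedances_le)
  have split: "(\<Sum>m\<le>n. prob (A n m \<inter> B)) = prob B" if B: "B \<in> sets P" for B n
  proof -
    have "prob (\<Union>m\<in>{..n}. A n m \<inter> B) = (\<Sum>m\<le>n. prob (A n m \<inter> B))"
      by (rule finite_measure_finite_Union) (use B in \<open>auto simp: disjoint_family_on_def A_def\<close>)
    moreover have "(\<Union>m\<in>{..n}. A n m \<inter> B) = B" using Nle sets.sets_into_space[OF B] by (auto simp: A_def)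
    ultimately show ?thesis by simp
  qed
  define U where "U n = {\<omega> \<in> space P. N n \<omega> \<notin> window n}" for n
  have U [measurable]: "U n \<in> sets P" for n unfolding U_def by measurable
  show ?thesis
  proof (rule tendstoI)
    fix e :: real assume e: "e > 0"
    define \<delta> where "\<delta> = e / 4"
    have \<delta>: "\<delta> > 0" using e by (simp add: \<delta>_def)
    have evG: "eventually (\<lambda>n. prob (space P - good (\<epsilon> n) n) < e / 16) sequentially"
      using G e by (intro order_tendstoD(2)) auto
    have evU: "eventually (\<lambda>n. prob (U n) < e / 16) sequentially"
      using window_limit e unfolding U_def by (intro order_tendstoD(2)) auto
    show "eventually (\<lambda>n. dist (\<integral>\<omega>. iexp (t * hill_error n (k_hat \<beta> \<gamma> (X n \<omega>) n) \<omega>) \<partial>P) (of_real (limit_char t)) < e) sequentially"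
      using conditional_char_window[OF ev \<delta>, of t] ev evG evU
    proof eventually_elim
      case (elim n)
      define Gn where "Gn = good (\<epsilon> n) n"
      have [measurable]: "Gn \<in> sets P" unfolding Gn_def by measurable
      define d where "d m \<omega> = of_bool (N n \<omega> = m) * (iexp (t * hill_error n (K n \<omega>) \<omega>) - of_real \<psi>)" for m \<omega>
      define d' where "d' m \<omega> = of_bool (N n \<omega> = m) * (iexp (t * hill_error n (k_of \<beta> n m) \<omega>) - of_real \<psi>)" for m \<omega>
      define D where "D m = norm (\<integral>\<omega>. d m \<omega> \<partial>P)" for m
      have two: "norm (iexp x - complex_of_real \<psi>) \<le> 2" for x
        using norm_triangle_ineq4[of "iexp x" "complex_of_real \<psi>"] \<psi> by simp
      have two': "norm (of_bool b * (iexp x - complex_of_real \<psi>)) \<le> 2" for b x using two[of x] by (cases b) auto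
      have int1: "integrable P (d m)" for m
        unfolding d_def by (rule integrable_const_bound[where B=2], rule AE_I2, rule two') measurable
      have Dm: "D m \<le> \<delta> * prob (A n m) + 4 * prob (A n m - Gn) + 2 * prob (A n m \<inter> U n)" if m: "m \<le> n" for m
      proof (cases "m \<in> window n")
        case False
        have "D m \<le> (\<integral>\<omega>. norm (d m \<omega>) \<partial>P)"
          unfolding D_def by (rule integral_norm_bound)
        also have "\<dots> \<le> (\<integral>\<omega>. 2 * indicator (A n m \<inter> U n) \<omega> \<partial>P)"
        proof (rule integral_mono)
          show "integrable P (\<lambda>\<omega>. norm (d m \<omega>))"
            using int1 by (rule integrable_norm)
          show "integrable P (\<lambda>\<omega>. 2 * indicator (A n m \<inter> U n) \<omega> :: real)" by (simp add: emeasure_eq_measure)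
          show "norm (d m \<omega>) \<le> 2 * indicator (A n m \<inter> U n) \<omega>"
            if "\<omega> \<in> space P" for \<omega>
            using that two'[of True "t * hill_error n (K n \<omega>) \<omega>"] False
            unfolding d_def by (cases "N n \<omega> = m") (simp_all add: A_def U_def del: of_real_mult)
        qed
        also have "\<dots> = 2 * prob (A n m \<inter> U n)" by simp
        finally have "D m \<le> 2 * prob (A n m \<inter> U n)" .
        moreover have "0 \<le> \<delta> * prob (A n m)" "0 \<le> 4 * prob (A n m - Gn)" using \<delta> by auto
        ultimately show ?thesis by linarith
      next
        case True
        note [measurable] = Wm[OF m]
        have int2: "integrable P (d' m)"
          unfolding d'_def by (rule integrable_const_bound[where B=2], rule AE_I2, rule two') measurable
        have "norm ((\<integral>\<omega>. d m \<omega> \<partial>P) - (\<integral>\<omega>. d' m \<omega> \<partial>P))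
           \<le> (\<integral>\<omega>. norm (d m \<omega> - d' m \<omega>) \<partial>P)"
          unfolding Bochner_Integration.integral_diff[OF int1 int2, symmetric] by (rule integral_norm_bound)
        also have "\<dots> \<le> (\<integral>\<omega>. 2 * indicator (A n m - Gn) \<omega> \<partial>P)"
        proof (rule integral_mono)
          show "integrable P (\<lambda>\<omega>. norm (d m \<omega> - d' m \<omega>))"
            using int1 int2 by (intro integrable_norm Bochner_Integration.integrable_diff)
          show "integrable P (\<lambda>\<omega>. 2 * indicator (A n m - Gn) \<omega> :: real)" by (simp add: emeasure_eq_measure)
          fix \<omega> assume w: "\<omega> \<in> space P"
          show "norm (d m \<omega> - d' m \<omega>) \<le> 2 * indicator (A n m - Gn) \<omega>"
          proof (cases "N n \<omega> = m \<and> \<omega> \<notin> Gn")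
            case True
            have "norm (iexp (t * hill_error n (K n \<omega>) \<omega>) - iexp (t * hill_error n (k_of \<beta> n m) \<omega>)) \<le> 2"
              using norm_triangle_ineq4[of "iexp (t * hill_error n (K n \<omega>) \<omega>)" "iexp (t * hill_error n (k_of \<beta> n m) \<omega>)"] by simp
            then show ?thesis using True w by (simp add: A_def d_def d'_def)
          next
            case False
            then have "N n \<omega> = m \<Longrightarrow> K n \<omega> = k_of \<beta> n m"
              using good_sample(1)[of \<omega> "\<epsilon> n" n] elim(2) by (auto simp: K_def Gn_def)
            then show ?thesis by (auto simp: d_def d'_def)
          qed
        qed
        also have "\<dots> = 2 * prob (A n m - Gn)" by simp
        finally have "D m \<le> norm (\<integral>\<omega>. d' m \<omega> \<partial>P) + 2 * prob (A n m - Gn)"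
          unfolding D_def by (smt (verit, best) norm_triangle_sub)
        also have "norm (\<integral>\<omega>. d' m \<omega> \<partial>P)
           \<le> \<delta> * prob (A n m) + 2 * prob (A n m - Gn)"
          using elim(1) True m unfolding d'_def \<psi>_def A_def Gn_def by blast
        finally have "D m \<le> \<delta> * prob (A n m) + 4 * prob (A n m - Gn)" by simp
        moreover have "0 \<le> 2 * prob (A n m \<inter> U n)" by simp
        ultimately show ?thesis by linarith
      qed
      have "(\<integral>\<omega>. iexp (t * hill_error n (K n \<omega>) \<omega>) \<partial>P) - of_real \<psi> = (\<integral>\<omega>. iexp (t * hill_error n (K n \<omega>) \<omega>) - of_real \<psi> \<partial>P)"
      proof -
        have "integrable P (\<lambda>\<omega>. iexp (t * hill_error n (K n \<omega>) \<omega>))" by (rule integrable_const_bound[where B=1]) auto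
        then show ?thesis by (simp add: prob_space)
      qed
      also have "\<dots> = (\<integral>\<omega>. (\<Sum>m\<le>n. d m \<omega>) \<partial>P)"
      proof (rule Bochner_Integration.integral_cong[OF refl])
        fix \<omega>
        have "(\<Sum>m\<le>n. of_bool (N n \<omega> = m)) = (1::complex)" using Nle[of n \<omega>] by (simp add: of_bool_def)
        then show "iexp (t * hill_error n (K n \<omega>) \<omega>) - of_real \<psi> = (\<Sum>m\<le>n. d m \<omega>)"
          unfolding d_def sum_distrib_right[symmetric] by simp
      qed
      also have "\<dots> = (\<Sum>m\<le>n. \<integral>\<omega>. d m \<omega> \<partial>P)"
        by (rule Bochner_Integration.integral_sum) (rule int1)
      finally have "norm ((\<integral>\<omega>. iexp (t * hill_error n (K n \<omega>) \<omega>) \<partial>P) - of_real \<psi>) \<le> (\<Sum>m\<le>n. D m)"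
        unfolding D_def by (simp only: norm_sum)
      also have "\<dots> \<le> (\<Sum>m\<le>n. \<delta> * prob (A n m \<inter> space P) + 4 * prob (A n m \<inter> (space P - Gn)) + 2 * prob (A n m \<inter> U n))"
      proof (rule sum_mono)
        fix m assume "m \<in> {..n}"
        moreover have "A n m \<inter> space P = A n m" "A n m \<inter> (space P - Gn) = A n m - Gn" by (auto simp: A_def)
        ultimately show "D m \<le> \<delta> * prob (A n m \<inter> space P) + 4 * prob (A n m \<inter> (space P - Gn)) + 2 * prob (A n m \<inter> U n)"
          using Dm[of m] by simp
      qed
      also have "\<dots> = \<delta> * prob (space P) + 4 * prob (space P - Gn) + 2 * prob (U n)"
        unfolding sum.distrib sum_distrib_left[symmetric] by (subst (1 2 3) split) auto
      also have "\<dots> < e" using elim(3,4) e by (simp add: \<delta>_def Gn_def prob_space)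
      finally show ?case by (simp add: dist_norm K_def \<psi>_def)
    qed
  qed
qed

lemma hill_weak_convergence:
  "weak_conv_m (\<lambda>n. distr P borel (\<lambda>\<omega>. hill_error n (k_hat \<beta> \<gamma> (X n \<omega>) n) \<omega>))
     (density lborel (\<lambda>x. ennreal (normal_density 0 (1 / \<alpha>) x)))"
proof (rule levy_continuity)
  have K: "(\<lambda>\<omega>. k_hat \<beta> \<gamma> (X n \<omega>) n) \<in> measurable P (count_space UNIV)" for n 
    by (rule k_hat_measurable) measurable
  have W: "(\<lambda>\<omega>. hill_error n (k_hat \<beta> \<gamma> (X n \<omega>) n) \<omega>) \<in> borel_measurable P" for n
    unfolding hill_error_def by (rule hill_random_measurable[OF _ K]) (use \<beta> in \<open>auto simp: k_hat_le\<close>)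
  show "real_distribution (distr P borel (\<lambda>\<omega>. hill_error n (k_hat \<beta> \<gamma> (X n \<omega>) n) \<omega>))" for n
    by (rule real_distribution_distr[OF W])
  have \<sigma>: "1 / \<alpha> > 0" using \<alpha> by simp
  show "real_distribution (density lborel (\<lambda>x. ennreal (normal_density 0 (1 / \<alpha>) x)))"
    by (rule char_normal_distribution(1)[OF \<sigma>])
  fix t
  have "char (density lborel (\<lambda>x. ennreal (normal_density 0 (1 / \<alpha>) x))) t = of_real (limit_char t)"
    unfolding char_normal_distribution(2)[OF \<sigma>] limit_char_def by (simp add: power_divide)
  moreover have "char (distr P borel (\<lambda>\<omega>. hill_error n (k_hat \<beta> \<gamma> (X n \<omega>) n) \<omega>)) t =
      (\<integral>\<omega>. iexp (t * hill_error n (k_hat \<beta> \<gamma> (X n \<omega>) n) \<omega>) \<partial>P)" for n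
    unfolding char_def by (rule integral_distr[OF W]) simp
  ultimately show "(\<lambda>n. char (distr P borel (\<lambda>\<omega>. hill_error n (k_hat \<beta> \<gamma> (X n \<omega>) n) \<omega>)) t) \<longlonglongrightarrow>
      char (density lborel (\<lambda>x. ennreal (normal_density 0 (1 / \<alpha>) x))) t"
    using char_limit[of t] by simp
qed

end

section \<open>Asymptotic normality\<close>

theorem theorem2p1:
  fixes P :: "'a measure"
    and H L :: "nat \<Rightarrow> 'a \<Rightarrow> real"
    and M :: "nat \<Rightarrow> real"
    and \<alpha> \<beta> \<gamma> :: real
    and X :: "nat \<Rightarrow> 'a \<Rightarrow> nat \<Rightarrow> real"
    and k :: "nat \<Rightarrow> 'a \<Rightarrow> nat"
  assumes "prob_space P"
    and "iid P H" and "\<And>j. AE \<omega> in P. H j \<omega> > 0"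
    and "iid P L" and "\<And>j. AE \<omega> in P. L j \<omega> > 0"
    and "prob_space.indep_var P (PiM UNIV (\<lambda>_. borel)) (\<lambda>\<omega> j. H j \<omega>)
                                (PiM UNIV (\<lambda>_. borel)) (\<lambda>\<omega> j. L j \<omega>)"
    and "\<alpha> > 0" and "regularly_varying_at_top (tail P (H 0)) (-\<alpha>)"
    and "\<And>n. M n > 0" and "filterlim M at_top sequentially"
    and "0 < \<beta>" and "\<beta> < 1" and "0 < \<gamma>" and "\<gamma> < 1"
    and "assumption_A P (H 0) (L 0) M \<alpha> \<beta> \<gamma>"
    and "assumption_B P (H 0) M"
    and "assumption_C P (H 0) M \<beta>"
    and "assumption_D P (H 0) M \<alpha> \<beta> \<gamma>"
    and "assumption_E P (H 0) M \<alpha> \<beta> \<gamma>"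
  defines "X \<equiv> \<lambda>n \<omega> j. trunc_obs H L M n j \<omega>"
    and "k \<equiv> \<lambda>n \<omega>. k_hat \<beta> \<gamma> (X n \<omega>) n"
  shows "weak_conv_m
           (\<lambda>n. distr P borel (\<lambda>\<omega>. sqrt (real (k n \<omega>)) * (hill (X n \<omega>) (k n \<omega>) n - 1 / \<alpha>)))
           (density lborel (\<lambda>x. ennreal (normal_density 0 (1 / \<alpha>) x)))"
proof -
  have "tail_asymptotics P (H 0) M \<alpha> \<beta> \<gamma>"
    by (rule tail_asymptotics.intro) (rule assms iid_measurable[OF assms(1,2)])+
  then interpret truncated_hill P H M \<alpha> \<beta> \<gamma> L
    by (rule truncated_hill.intro[OF _ truncated_hill_axioms.intro]) (rule assms)+
  show ?thesis using hill_weak_convergence unfolding hill_error_def X_def k_def .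
qed

end
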